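(* Let $S$ be a recursively enumerable $\mathcal{L}$-theory such that $S\vdash \mathsf{KP}+\mathsf{Powerset}+\Delta_0^{\mathcal{P}}\text{-}\mathsf{Collection}+\Sigma_1^{\mathcal{P}}\text{-}\mathsf{Foundation}$, and let $\mathcal{M}$ be a countable model of $S$ with underlying set $M$. Then there exists an $\mathcal{L}$-structure $\mathcal{N}$ with underlying set $N$ such that $\mathcal{M}\subseteq_e^{\mathcal{P}}\mathcal{N}$, $\mathcal{N}\models S$, and for some $d\in N$ we have $\mathcal{N}\models(x\in d)$ for all $x\in M$.
   Context: All formulae are in the language $\mathcal{L}=\{\in,=\}$ of set theory. Formula classes. $\Delta_0$: smallest class closed under propositional connectives and bounded quantification $\exists x\in y$, $\forall x\in y$; $\Sigma_1$, $\Pi_1$ are obtained by prefixing unbounded existential, resp. universal, quantifiers. $\Delta_0^{\mathcal{P}}$: smallest class of $\mathcal{L}$-formulae closed under propositional connectives and quantification of the forms $\mathcal{Q}x\in y$ and $\mathcal{Q}x\subseteq y$, where $\mathcal{Q}\in\{\exists,\forall\}$ and $x,y$ are distinct variables. $\Sigma_1^{\mathcal{P}}$, $\Pi_1^{\mathcal{P}}$ are obtained from $\Delta_0^{\mathcal{P}}$ in the same way. Schemes, for a class $\Gamma$. $\Gamma$-Separation: for $\phi(x,\vec z)\in\Gamma$, $\forall\vec z\forall w\exists y\forall x(x\in y\iff x\in w\wedge\phi(x,\vec z))$. $\Gamma$-Collection: for $\phi(x,y,\vec z)\in\Gamma$, $\forall\vec z\forall w((\forall x\in w)\exists y\,\phi\Rightarrow\exists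 C(\forall x\in w)(\exists y\in C)\phi)$. $\Gamma$-Foundation: for $\phi(x,\vec z)\in\Gamma$, $\forall\vec z(\exists x\,\phi(x,\vec z)\Rightarrow\exists y(\phi(y,\vec z)\wedge(\forall x\in y)\neg\phi(x,\vec z)))$. $\mathsf{KP}$: Extensionality, Pair, Union, $\Delta_0$-Separation, $\Delta_0$-Collection and $\Pi_1$-Foundation (no Infinity). For $\mathcal{L}$-structures $\mathcal{M},\mathcal{N}$ with underlying sets $M,N$: $\mathcal{M}\subseteq_e\mathcal{N}$ (end extension) means $\mathcal{M}$ is a substructure of $\mathcal{N}$ and whenever $y\in M$, $x\in N$ and $\mathcal{N}\models x\in y$, then $x\in M$. $\mathcal{M}\subseteq_e^{\mathcal{P}}\mathcal{N}$ (powerset-preserving end extension) means $\mathcal{M}\subseteq_e\mathcal{N}$ and whenever $y\in M$, $x\in N$ and $\mathcal{N}\models x\subseteq y$, then $x\in M$. *)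

theory Defs
  imports Main "HOL-Library.Countable_Set" "HOL-Library.Nat_Bijection"
begin

section \<open>Formulae of the language of set theory\<close>

text \<open>Variables are de Bruijn indices: in \<open>All \<phi>\<close> the bound variable is index 0 of \<open>\<phi>\<close>, and
  index \<open>Suc i\<close> of \<open>\<phi>\<close> is index \<open>i\<close> outside.\<close>

datatype fm = Mem nat nat | Eq nat nat | Fls | Imp fm fm | All fm

abbreviation Neg :: "fm \<Rightarrow> fm" where "Neg \<phi> \<equiv> Imp \<phi> Fls"
abbreviation Or :: "fm \<Rightarrow> fm \<Rightarrow> fm" where "Or \<phi> \<psi> \<equiv> Imp (Neg \<phi>) \<psi>"
abbreviation And :: "fm \<Rightarrow> fm \<Rightarrow> fm" where "And \<phi> \<psi> \<equiv> Neg (Imp \<phi> (Neg \<psi>))"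
abbreviation Iff :: "fm \<Rightarrow> fm \<Rightarrow> fm" where "Iff \<phi> \<psi> \<equiv> And (Imp \<phi> \<psi>) (Imp \<psi> \<phi>)"
abbreviation Ex :: "fm \<Rightarrow> fm" where "Ex \<phi> \<equiv> Neg (All (Neg \<phi>))"

abbreviation Sub :: "nat \<Rightarrow> nat \<Rightarrow> fm" where
  "Sub i j \<equiv> All (Imp (Mem 0 (Suc i)) (Mem 0 (Suc j)))"

text \<open>In the bounded quantifiers the bound \<open>i\<close> is an index of the outer context, so it is
  automatically distinct from the quantified variable.\<close>

abbreviation All_in :: "nat \<Rightarrow> fm \<Rightarrow> fm" where
  "All_in i \<phi> \<equiv> All (Imp (Mem 0 (Suc i)) \<phi>)"
abbreviation Ex_in :: "nat \<Rightarrow> fm \<Rightarrow> fm" where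
  "Ex_in i \<phi> \<equiv> Ex (And (Mem 0 (Suc i)) \<phi>)"
abbreviation All_sub :: "nat \<Rightarrow> fm \<Rightarrow> fm" where
  "All_sub i \<phi> \<equiv> All (Imp (Sub 0 (Suc i)) \<phi>)"
abbreviation Ex_sub :: "nat \<Rightarrow> fm \<Rightarrow> fm" where
  "Ex_sub i \<phi> \<equiv> Ex (And (Sub 0 (Suc i)) \<phi>)"

primrec fv :: "fm \<Rightarrow> nat set" where
  "fv (Mem i j) = {i, j}"
| "fv (Eq i j) = {i, j}"
| "fv Fls = {}"
| "fv (Imp \<phi> \<psi>) = fv \<phi> \<union> fv \<psi>"
| "fv (All \<phi>) = {i. Suc i \<in> fv \<phi>}"

definition sentence :: "fm \<Rightarrow> bool" where
  "sentence \<phi> \<longleftrightarrow> fv \<phi> = {}"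

definition univ_closure :: "fm \<Rightarrow> fm" where
  "univ_closure \<phi> = (All ^^ (LEAST n. \<forall>i\<in>fv \<phi>. i < n)) \<phi>"

text \<open>Renaming of free variables; since variables are the only terms, this is also substitution.\<close>

primrec ren :: "(nat \<Rightarrow> nat) \<Rightarrow> fm \<Rightarrow> fm" where
  "ren f (Mem i j) = Mem (f i) (f j)"
| "ren f (Eq i j) = Eq (f i) (f j)"
| "ren f Fls = Fls"
| "ren f (Imp \<phi> \<psi>) = Imp (ren f \<phi>) (ren f \<psi>)"
| "ren f (All \<phi>) = All (ren (case_nat 0 (\<lambda>i. Suc (f i))) \<phi>)"


section \<open>Formula classes\<close>

inductive_set Delta0 :: "fm set" where
  "Mem i j \<in> Delta0"
| "Eq i j \<in> Delta0"
| "Fls \<in> Delta0"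
| "\<phi> \<in> Delta0 \<Longrightarrow> \<psi> \<in> Delta0 \<Longrightarrow> Imp \<phi> \<psi> \<in> Delta0"
| "\<phi> \<in> Delta0 \<Longrightarrow> All_in i \<phi> \<in> Delta0"
| "\<phi> \<in> Delta0 \<Longrightarrow> Ex_in i \<phi> \<in> Delta0"

inductive_set Delta0P :: "fm set" where
  "Mem i j \<in> Delta0P"
| "Eq i j \<in> Delta0P"
| "Fls \<in> Delta0P"
| "\<phi> \<in> Delta0P \<Longrightarrow> \<psi> \<in> Delta0P \<Longrightarrow> Imp \<phi> \<psi> \<in> Delta0P"
| "\<phi> \<in> Delta0P \<Longrightarrow> All_in i \<phi> \<in> Delta0P"
| "\<phi> \<in> Delta0P \<Longrightarrow> Ex_in i \<phi> \<in> Delta0P"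
| "\<phi> \<in> Delta0P \<Longrightarrow> All_sub i \<phi> \<in> Delta0P"
| "\<phi> \<in> Delta0P \<Longrightarrow> Ex_sub i \<phi> \<in> Delta0P"

definition Ex_prefix :: "fm set \<Rightarrow> fm set" where
  "Ex_prefix \<Gamma> = {(Ex ^^ n) \<phi> | n \<phi>. \<phi> \<in> \<Gamma>}"

definition All_prefix :: "fm set \<Rightarrow> fm set" where
  "All_prefix \<Gamma> = {(All ^^ n) \<phi> | n \<phi>. \<phi> \<in> \<Gamma>}"

abbreviation Pi1 :: "fm set" where "Pi1 \<equiv> All_prefix Delta0"
abbreviation Sigma1P :: "fm set" where "Sigma1P \<equiv> Ex_prefix Delta0P"


section \<open>Axioms and schemes\<close>

definition extensionality_ax :: fm where
  "extensionality_ax = All (All (Imp (All (Iff (Mem 0 2) (Mem 0 1))) (Eq 1 0)))"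

definition pair_ax :: fm where
  "pair_ax = All (All (Ex (All (Iff (Mem 0 1) (Or (Eq 0 3) (Eq 0 2))))))"

definition union_ax :: fm where
  "union_ax = All (Ex (All (Iff (Mem 0 1) (Ex_in 2 (Mem 1 0)))))"

definition powerset_ax :: fm where
  "powerset_ax = All (Ex (All (Iff (Mem 0 1) (Sub 0 2))))"

text \<open>In the schemes the formula \<open>\<phi>\<close> is taken in the context \<open>x, \<zz>\<close> (for collection \<open>y, x, \<zz>\<close>,
  innermost first), and is renamed into the context in which it is used, so that it does not
  mention the other quantified variables.\<close>

text \<open>\<open>\<forall>\<zz> \<forall>w \<exists>y \<forall>x (x \<in> y \<longleftrightarrow> x \<in> w \<and> \<phi>(x,\<zz>))\<close>; the context of the body is \<open>x, y, w, \<zz>\<close>.\<close>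

definition separation :: "fm set \<Rightarrow> fm set" where
  "separation \<Gamma> =
     {univ_closure (All (Ex (All (Iff (Mem 0 1)
        (And (Mem 0 2) (ren (case_nat 0 (\<lambda>k. k + 3)) \<phi>)))))) | \<phi>. \<phi> \<in> \<Gamma>}"

text \<open>\<open>\<forall>\<zz> \<forall>w ((\<forall>x\<in>w) \<exists>y \<phi>(x,y,\<zz>) \<longrightarrow> \<exists>C (\<forall>x\<in>w) (\<exists>y\<in>C) \<phi>(x,y,\<zz>))\<close>; the contexts of the two
  occurrences of \<open>\<phi>\<close> are \<open>y, x, w, \<zz>\<close> and \<open>y, x, C, w, \<zz>\<close>.\<close>

definition collection :: "fm set \<Rightarrow> fm set" where
  "collection \<Gamma> =
     {univ_closure (All (Imp
        (All_in 0 (Ex (ren (case_nat 0 (case_nat 1 (\<lambda>k. k + 3))) \<phi>)))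
        (Ex (All_in 1 (Ex_in 1 (ren (case_nat 0 (case_nat 1 (\<lambda>k. k + 4))) \<phi>)))))) | \<phi>. \<phi> \<in> \<Gamma>}"

text \<open>\<open>\<forall>\<zz> (\<exists>x \<phi>(x,\<zz>) \<longrightarrow> \<exists>y (\<phi>(y,\<zz>) \<and> (\<forall>x\<in>y) \<not> \<phi>(x,\<zz>)))\<close>\<close>

definition foundation :: "fm set \<Rightarrow> fm set" where
  "foundation \<Gamma> =
     {univ_closure (Imp (Ex \<phi>)
        (Ex (And \<phi> (All_in 0 (Neg (ren (case_nat 0 (\<lambda>k. k + 2)) \<phi>)))))) | \<phi>. \<phi> \<in> \<Gamma>}"

definition KP :: "fm set" where
  "KP = {extensionality_ax, pair_ax, union_ax}
        \<union> separation Delta0 \<union> collection Delta0 \<union> foundation Pi1"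


section \<open>Derivability\<close>

text \<open>Classical natural deduction with equality. The instance of \<open>\<phi>\<close> at the variable \<open>t\<close>
  is \<open>ren (case_nat t id) \<phi>\<close>; in \<open>AllI\<close> the hypotheses are shifted to make index 0 fresh.\<close>

inductive derives :: "fm set \<Rightarrow> fm \<Rightarrow> bool" (infix \<open>\<turnstile>\<close> 50) where
  Hyp: "\<phi> \<in> \<Gamma> \<Longrightarrow> \<Gamma> \<turnstile> \<phi>"
| ImpI: "insert \<phi> \<Gamma> \<turnstile> \<psi> \<Longrightarrow> \<Gamma> \<turnstile> Imp \<phi> \<psi>"
| ImpE: "\<Gamma> \<turnstile> Imp \<phi> \<psi> \<Longrightarrow> \<Gamma> \<turnstile> \<phi> \<Longrightarrow> \<Gamma> \<turnstile> \<psi>"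
| RAA: "insert (Neg \<phi>) \<Gamma> \<turnstile> Fls \<Longrightarrow> \<Gamma> \<turnstile> \<phi>"
| AllI: "ren Suc ` \<Gamma> \<turnstile> \<phi> \<Longrightarrow> \<Gamma> \<turnstile> All \<phi>"
| AllE: "\<Gamma> \<turnstile> All \<phi> \<Longrightarrow> \<Gamma> \<turnstile> ren (case_nat t id) \<phi>"
| EqI: "\<Gamma> \<turnstile> Eq t t"
| EqE: "\<Gamma> \<turnstile> Eq s t \<Longrightarrow> \<Gamma> \<turnstile> ren (case_nat s id) \<phi> \<Longrightarrow> \<Gamma> \<turnstile> ren (case_nat t id) \<phi>"

definition derives_theory :: "fm set \<Rightarrow> fm set \<Rightarrow> bool" where
  "derives_theory S T \<longleftrightarrow> (\<forall>\<phi>\<in>T. S \<turnstile> \<phi>)"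


section \<open>Recursive enumerability\<close>

text \<open>Kleene's partial recursive functions. \<open>Pr f g\<close> recurses on the first argument, and \<open>g\<close>
  receives the predecessor, the previous value and the parameters, in this order; \<open>Mn f\<close> searches
  for the least first argument at which \<open>f\<close> vanishes, \<open>f\<close> being defined at all smaller ones.\<close>

datatype recf = Zero | Succ | Proj nat | Cn recf "recf list" | Pr recf recf | Mn recf

inductive computes :: "recf \<Rightarrow> nat list \<Rightarrow> nat \<Rightarrow> bool" where
  "computes Zero xs 0"
| "computes Succ [x] (Suc x)"
| "i < length xs \<Longrightarrow> computes (Proj i) xs (xs ! i)"
| "list_all2 (\<lambda>g y. computes g xs y) gs ys \<Longrightarrow> computes f ys z \<Longrightarrow> computes (Cn f gs) xs z"
| "computes f xs z \<Longrightarrow> computes (Pr f g) (0 # xs) z"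
| "computes (Pr f g) (n # xs) y \<Longrightarrow> computes g (n # y # xs) z \<Longrightarrow> computes (Pr f g) (Suc n # xs) z"
| "computes f (n # xs) 0 \<Longrightarrow> (\<forall>m<n. \<exists>y>0. computes f (m # xs) y) \<Longrightarrow> computes (Mn f) xs n"

definition re_set :: "nat set \<Rightarrow> bool" where
  "re_set A \<longleftrightarrow> (\<exists>f. \<forall>n. n \<in> A \<longleftrightarrow> (\<exists>y. computes f [n] y))"

primrec code :: "fm \<Rightarrow> nat" where
  "code (Mem i j) = prod_encode (0, prod_encode (i, j))"
| "code (Eq i j) = prod_encode (1, prod_encode (i, j))"
| "code Fls = prod_encode (2, 0)"
| "code (Imp \<phi> \<psi>) = prod_encode (3, prod_encode (code \<phi>, code \<psi>))"
| "code (All \<phi>) = prod_encode (4, code \<phi>)"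

lemma inj_code: "inj code"
proof (rule injI)
  fix \<phi> \<psi> assume "code \<phi> = code \<psi>"
  then show "\<phi> = \<psi>"
    by (induction \<phi> arbitrary: \<psi>) (case_tac \<psi>; auto)+
qed

definition re_theory :: "fm set \<Rightarrow> bool" where
  "re_theory S \<longleftrightarrow> (\<forall>\<phi>\<in>S. sentence \<phi>) \<and> re_set (code ` S)"


section \<open>Structures\<close>

text \<open>Only the restriction of \<open>mem\<close> to \<open>univ\<close> is relevant; equality is interpreted as identity.\<close>

record 'a lstruct =
  univ :: "'a set"
  mem :: "'a \<Rightarrow> 'a \<Rightarrow> bool"

definition is_struct :: "'a lstruct \<Rightarrow> bool" where
  "is_struct M \<longleftrightarrow> univ M \<noteq> {}"

primrec sat :: "'a lstruct \<Rightarrow> (nat \<Rightarrow> 'a) \<Rightarrow> fm \<Rightarrow> bool" where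
  "sat M e (Mem i j) \<longleftrightarrow> mem M (e i) (e j)"
| "sat M e (Eq i j) \<longleftrightarrow> e i = e j"
| "sat M e Fls \<longleftrightarrow> False"
| "sat M e (Imp \<phi> \<psi>) \<longleftrightarrow> (sat M e \<phi> \<longrightarrow> sat M e \<psi>)"
| "sat M e (All \<phi>) \<longleftrightarrow> (\<forall>a\<in>univ M. sat M (case_nat a e) \<phi>)"

definition is_model :: "'a lstruct \<Rightarrow> fm set \<Rightarrow> bool" where
  "is_model M S \<longleftrightarrow>
     is_struct M \<and> (\<forall>\<phi>\<in>S. \<forall>e. range e \<subseteq> univ M \<longrightarrow> sat M e \<phi>)"

definition substructure :: "'a lstruct \<Rightarrow> 'a lstruct \<Rightarrow> bool" where
  "substructure M N \<longleftrightarrow>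
     is_struct M \<and> is_struct N \<and> univ M \<subseteq> univ N \<and>
     (\<forall>x\<in>univ M. \<forall>y\<in>univ M. mem M x y \<longleftrightarrow> mem N x y)"

definition end_ext :: "'a lstruct \<Rightarrow> 'a lstruct \<Rightarrow> bool" where
  "end_ext M N \<longleftrightarrow>
     substructure M N \<and> (\<forall>y\<in>univ M. \<forall>x\<in>univ N. mem N x y \<longrightarrow> x \<in> univ M)"

definition sub_in :: "'a lstruct \<Rightarrow> 'a \<Rightarrow> 'a \<Rightarrow> bool" where
  "sub_in N x y \<longleftrightarrow> (\<forall>z\<in>univ N. mem N z x \<longrightarrow> mem N z y)"

definition powerset_end_ext :: "'a lstruct \<Rightarrow> 'a lstruct \<Rightarrow> bool" where
  "powerset_end_ext M N \<longleftrightarrow>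
     end_ext M N \<and> (\<forall>y\<in>univ M. \<forall>x\<in>univ N. sub_in N x y \<longrightarrow> x \<in> univ M)"

text \<open>A type \<open>'a\<close> may have no room for a proper extension of a structure on it, so extensions are
  taken over the isomorphic copy of the structure on \<open>Inl ` univ M\<close>.\<close>

definition inl_copy :: "'a lstruct \<Rightarrow> ('a + 'b) lstruct" where
  "inl_copy M = \<lparr>univ = Inl ` univ M,
                 mem = (\<lambda>x y. \<exists>a b. x = Inl a \<and> y = Inl b \<and> mem M a b)\<rparr>"

end

theory Submission
  imports Defs "HOL-Library.Countable"
begin

text \<open>This is Barwise compactness, done without the admissible cover. Literals are formulae, given by
  their numbers, in environments of terms naming the elements of \<open>M\<close>, the element \<open>d\<close> and Henkin
  witnesses. What is required of the extension is a countable set of clauses, all of them finite except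
  \<open>t \<notin> a \<or> \<Or>\<^bsub>b\<in>a\<^esub> t = b\<close>, which ensures that no elements are added to \<open>a\<close>; applied to the
  power set of \<open>a\<close>, it ensures that no subsets are added. A refutation that uses the axioms \<open>b \<in> d\<close>
  only for \<open>b \<in> u\<close> is sound in \<open>M\<close> with \<open>d := u\<close>, so there is no refutation. To build a
  valuation clause by clause one needs: if all \<open>c \<union> {l}\<close> with \<open>l \<in> C\<close> are refuted, then \<open>c\<close> is
  refuted, with a common \<open>u\<close>. This is collection for the relation ``\<open>c\<close> is refuted with bound
  \<open>u\<close>''.

  That relation has the form ``\<open>\<theta>(\<eta>, u, c)\<close> for some \<open>\<eta>\<close> in the well-founded part of the
  ordinals of \<open>M\<close>'' with \<open>\<theta>\<close> a \<open>\<Sigma>\<^sub>1\<^sup>\<P>\<close> formula. Relations of this form are closed under bounded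
  quantifiers: if every \<open>b \<in> a\<close> has such an \<open>\<eta>\<close>, a least ordinal bounding witnesses for all \<open>b\<close>
  exists by \<open>\<Sigma>\<^sub>1\<^sup>\<P>\<close>-foundation, and it is well-founded because every ill-founded ordinal is a bound.
  They are therefore also closed under inductive definitions, which gives the r.e. set \<open>S\<close> and the
  refutation relation; note that only standard derivations are admitted even if \<open>M\<close> is not
  \<open>\<omega>\<close>-standard.\<close>

section \<open>Soundness and definability\<close>

text \<open>No element of \<open>M\<close> contains all of \<open>M\<close>, so the axioms
  \<open>b \<in> d\<close> are never jointly true in \<open>M\<close>; only refutations whose uses
  of them are bounded by a set \<open>u\<close> can be checked there. Infinite clauses make
  refutations branch over a set, with a bound for each branch, and these bounds must be united. This
  is why the refutation relation has to lie in a class with collection. If \<open>M\<close> is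
  ill-founded, a derivation in the sense of \<open>M\<close> may have ill-founded rank, and then the
  external induction behind soundness does not apply. Hence ranks are taken in the well-founded
  part. That part is not definable in general, so collection for relations mentioning it is not an
  instance of an axiom scheme; \<open>std_uniform\<close> is what recovers it. The class is built
  over \<open>Delta0P\<close> because the clauses mention the power set operation, whose graph needs
  a quantifier over subsets. It is closed under positive operations only; consistency, the negation
  of refutability, is used only from outside the structure.\<close>

lemma sat_ren: "sat M e (ren f \<phi>) \<longleftrightarrow> sat M (\<lambda>i. e (f i)) \<phi>"
proof (induction \<phi> arbitrary: e f)
  case (All \<phi>)
  have "(\<lambda>i. case_nat a e (case_nat 0 (\<lambda>i. Suc (f i)) i)) = case_nat a (\<lambda>i. e (f i))" for a
    by (rule ext) (simp split: nat.split)
  then show ?case by (simp add: All)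
qed auto

lemma sat_cong_fv: "(\<And>i. i \<in> fv \<phi> \<Longrightarrow> e i = e' i) \<Longrightarrow> sat M e \<phi> \<longleftrightarrow> sat M e' \<phi>"
proof (induction \<phi> arbitrary: e e')
  case (Imp \<phi> \<psi>)
  have "sat M e \<phi> \<longleftrightarrow> sat M e' \<phi>" by (rule Imp.IH(1)) (simp add: Imp.prems)
  moreover have "sat M e \<psi> \<longleftrightarrow> sat M e' \<psi>" by (rule Imp.IH(2)) (simp add: Imp.prems)
  ultimately show ?case by simp
next
  case (All \<phi>)
  have "sat M (case_nat a e) \<phi> \<longleftrightarrow> sat M (case_nat a e') \<phi>" for a
    by (rule All.IH) (use All.prems in \<open>auto split: nat.split\<close>)
  then show ?case by simp
qed auto

lemma finite_fv: "finite (fv \<phi>)"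
proof (induction \<phi>)
  case (All \<phi>)
  have "fv (All \<phi>) = Suc -` fv \<phi>" by auto
  then show ?case using All by (simp add: finite_vimageI)
qed auto

lemma case_nat_instance: "(\<lambda>i. e (case_nat t id i)) = case_nat (e t) e"
  by (rule ext) (simp split: nat.split)

lemma derives_sound:
  "\<Gamma> \<turnstile> \<phi> \<Longrightarrow> range e \<subseteq> univ M \<Longrightarrow> \<forall>\<psi>\<in>\<Gamma>. sat M e \<psi> \<Longrightarrow> sat M e \<phi>"
proof (induct arbitrary: e rule: derives.induct)
  case (ImpI \<phi> \<Gamma> \<psi>)
  then show ?case by simp
next
  case (ImpE \<Gamma> \<phi> \<psi>)
  then show ?case by simp
next
  case (RAA \<phi> \<Gamma>)
  show ?case
  proof (rule ccontr)
    assume "\<not> sat M e \<phi>"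
    then have "\<forall>\<psi>\<in>insert (Neg \<phi>) \<Gamma>. sat M e \<psi>" using RAA(4) by simp
    then have "sat M e Fls" using RAA(2,3) by blast
    then show False by simp
  qed
next
  case (AllI \<Gamma> \<phi>)
  have "sat M (case_nat a e) \<phi>" if "a \<in> univ M" for a
  proof (rule AllI(2))
    show "range (case_nat a e) \<subseteq> univ M"
      using AllI(3) that by (simp add: image_subset_iff split: nat.split)
    show "\<forall>\<psi>\<in>ren Suc ` \<Gamma>. sat M (case_nat a e) \<psi>"
      using AllI(4) by (simp add: sat_ren)
  qed
  then show ?case by simp
next
  case (AllE \<Gamma> \<phi> t)
  have "e t \<in> univ M" using AllE(3) by auto
  moreover have "sat M e (All \<phi>)" using AllE by blast
  ultimately show ?case unfolding sat_ren case_nat_instance by simp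
next
  case (EqE \<Gamma> s t \<phi>)
  have "e s = e t" "sat M e (ren (case_nat s id) \<phi>)" using EqE by auto
  then show ?case unfolding sat_ren case_nat_instance by simp
qed (simp_all)

lemma all_case_nat: "(\<forall>e a. P (case_nat a e)) \<longleftrightarrow> (\<forall>e. P e)" for P :: "(nat \<Rightarrow> 'a) \<Rightarrow> bool"
proof (intro iffI allI)
  fix e :: "nat \<Rightarrow> 'a" assume *: "\<forall>e a. P (case_nat a e)"
  have "case_nat (e 0) (\<lambda>i. e (Suc i)) = e" by (rule ext) (simp split: nat.split)
  then show "P e" using *[rule_format, of "e 0" "\<lambda>i. e (Suc i)"] by simp
next
  fix e a assume "\<forall>e. P e"
  then show "P (case_nat a e)" by (rule spec)
qed

text \<open>Validity in all environments absorbs leading universal quantifiers, however many there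
  are, so the number chosen in \<open>univ_closure\<close> does not matter.\<close>

lemma sat_all_prefix: "(\<forall>e. sat \<lparr>univ = UNIV, mem = E\<rparr> e ((All ^^ n) \<phi>)) \<longleftrightarrow> (\<forall>e. sat \<lparr>univ = UNIV, mem = E\<rparr> e \<phi>)"
proof (induction n)
  case (Suc n)
  then show ?case using all_case_nat[of "\<lambda>e. sat \<lparr>univ = UNIV, mem = E\<rparr> e ((All ^^ n) \<phi>)"] by simp
qed simp

lemma sat_univ_closure: "(\<forall>e. sat \<lparr>univ = UNIV, mem = E\<rparr> e (univ_closure \<phi>)) \<longleftrightarrow> (\<forall>e. sat \<lparr>univ = UNIV, mem = E\<rparr> e \<phi>)"
  unfolding univ_closure_def by (rule sat_all_prefix)

lemma ren_Delta0: "\<phi> \<in> Delta0 \<Longrightarrow> ren f \<phi> \<in> Delta0"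
  by (induction arbitrary: f rule: Delta0.induct) (auto intro: Delta0.intros)

lemma ren_Delta0P: "\<phi> \<in> Delta0P \<Longrightarrow> ren f \<phi> \<in> Delta0P"
proof (induction arbitrary: f rule: Delta0P.induct)
  case (7 \<phi> i)
  show ?case using Delta0P.intros(7)[OF 7(2)] by (simp add: numeral_2_eq_2)
next
  case (8 \<phi> i)
  show ?case using Delta0P.intros(8)[OF 8(2)] by (simp add: numeral_2_eq_2)
qed (auto intro: Delta0P.intros)

text \<open>Environments with constants: a term is a variable \<open>Inl j\<close> or a parameter \<open>Inr c\<close>.\<close>

primrec app :: "nat + 'a \<Rightarrow> (nat \<Rightarrow> 'a) \<Rightarrow> 'a" where
  "app (Inl j) e = e j"
| "app (Inr c) e = c"

text \<open>A predicate on functions instead of a syntax: goals about explicit functions such as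
  \<open>\<lambda>e. e i\<close> are then solved by introduction rules, also below further
  quantifiers (\<open>tm_shift\<close>).\<close>

definition tm :: "((nat \<Rightarrow> 'a) \<Rightarrow> 'a) \<Rightarrow> bool" where
  "tm s \<longleftrightarrow> (\<exists>v. s = app v)"

lemma tm_app: "tm (app v)" by (auto simp: tm_def)
lemma tm_var: "tm (\<lambda>e. e i)"
proof -
  have "(\<lambda>e. e i) = app (Inl i)" by auto
  then show ?thesis unfolding tm_def by blast
qed
lemma tm_const: "tm (\<lambda>e. c)"
proof -
  have "(\<lambda>e. c) = app (Inr c)" by auto
  then show ?thesis unfolding tm_def by blast
qed
lemma tm_cases:
  assumes "tm s" obtains i where "s = (\<lambda>e. e i)" | c where "s = (\<lambda>e. c)"
proof -
  obtain v where v: "s = app v" using assms tm_def by auto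
  show thesis
  proof (cases v)
    case (Inl i)
    then have "s = (\<lambda>e. e i)" using v by auto
    then show ?thesis using that by blast
  next
    case (Inr c)
    then have "s = (\<lambda>e. c)" using v by auto
    then show ?thesis using that by blast
  qed
qed
lemma tm_shift: "tm s \<Longrightarrow> tm (\<lambda>e. s (\<lambda>n. e (f n)))"
  by (elim tm_cases) (auto intro: tm_var tm_const)

lemma tms_app: "(\<And>i. tm (\<tau> i)) \<Longrightarrow> \<exists>v. \<forall>i. \<tau> i = app (v i)"
  unfolding tm_def by metis

section \<open>Definability with parameters\<close>

locale structure_on =
  fixes E :: "'a \<Rightarrow> 'a \<Rightarrow> bool"
begin

abbreviation "\<S> \<equiv> \<lparr>univ = UNIV, mem = E\<rparr>"

text \<open>Every index of the formula is filled by a variable or a parameter; only finitely many of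
  them matter, since a formula has finitely many free variables. The domain \<open>Q\<close> is
  there for \<open>Delta0P_bounded\<close>, where a relation becomes \<open>Delta0\<close> on
  bounded environments only.\<close>

definition definable :: "fm set \<Rightarrow> (nat \<Rightarrow> 'a) set \<Rightarrow> ((nat \<Rightarrow> 'a) \<Rightarrow> bool) \<Rightarrow> bool" where
  "definable \<Gamma> Q R \<longleftrightarrow> (\<exists>\<phi>\<in>\<Gamma>. \<exists>\<tau>. \<forall>e\<in>Q. R e \<longleftrightarrow> sat \<S> (\<lambda>i. app (\<tau> i) e) \<phi>)"

lemma definable_mono: "definable \<Gamma> Q' R \<Longrightarrow> Q \<subseteq> Q' \<Longrightarrow> (\<And>e. e \<in> Q \<Longrightarrow> R e = R' e) \<Longrightarrow> definable \<Gamma> Q R'"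
  unfolding definable_def by (elim bexE exE, rule bexI, rule exI, rule ballI) (auto simp: subset_iff)

lemma definableI:
  assumes "\<phi> \<in> \<Gamma>" "\<And>i. tm (\<tau> i)" "\<And>e. e \<in> Q \<Longrightarrow> R e \<longleftrightarrow> sat \<S> (\<lambda>i. \<tau> i e) \<phi>"
  shows "definable \<Gamma> Q R"
proof -
  obtain v where v: "\<And>i. \<tau> i = app (v i)" using tms_app[of \<tau>] assms(2) by blast
  show ?thesis
    unfolding definable_def
    by (intro bexI[OF _ assms(1)] exI[of _ v] ballI) (use assms(3) in \<open>simp add: v\<close>)
qed

lemma definable_subst:
  assumes "definable \<Gamma> Q R" "\<And>i. tm (\<tau> i)" "\<And>e. e \<in> Q' \<Longrightarrow> (\<lambda>i. \<tau> i e) \<in> Q"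
  shows "definable \<Gamma> Q' (\<lambda>e. R (\<lambda>i. \<tau> i e))"
proof -
  from assms(1) obtain \<phi> \<sigma> where 1: "\<phi> \<in> \<Gamma>" "\<forall>e\<in>Q. R e \<longleftrightarrow> sat \<S> (\<lambda>i. app (\<sigma> i) e) \<phi>"
    unfolding definable_def by blast
  show ?thesis
  proof (rule definableI[OF 1(1)])
    show "tm (\<lambda>e. app (\<sigma> i) (\<lambda>i. \<tau> i e))" for i
      by (cases "\<sigma> i") (auto intro: assms(2) tm_const)
  qed (simp add: 1(2) assms(3))
qed

definition closed_class :: "fm set \<Rightarrow> bool" where
  "closed_class \<Gamma> \<longleftrightarrow> (\<forall>i j. Mem i j \<in> \<Gamma> \<and> Eq i j \<in> \<Gamma>) \<and> Fls \<in> \<Gamma> \<and> (\<forall>\<phi>\<in>\<Gamma>. \<forall>\<psi>\<in>\<Gamma>. Imp \<phi> \<psi> \<in> \<Gamma>)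
     \<and> (\<forall>\<phi>\<in>\<Gamma>. \<forall>i. All_in i \<phi> \<in> \<Gamma>) \<and> (\<forall>\<phi>\<in>\<Gamma>. \<forall>f. ren f \<phi> \<in> \<Gamma>)"

lemma closed_Delta0: "closed_class Delta0"
  unfolding closed_class_def by (auto intro: Delta0.intros ren_Delta0)

lemma closed_Delta0P: "closed_class Delta0P"
  unfolding closed_class_def by (auto intro: Delta0P.intros ren_Delta0P)

context fixes \<Gamma> assumes \<Gamma>: "closed_class \<Gamma>"
begin

lemma definable_false: "definable \<Gamma> Q (\<lambda>e. False)"
  by (rule definableI[where \<phi> = Fls and \<tau> = "\<lambda>i e. e i"]) (use \<Gamma> in \<open>auto simp: closed_class_def tm_var\<close>)

lemma definable_mem: 
  assumes "tm s" "tm t" shows "definable \<Gamma> Q (\<lambda>e. E (s e) (t e))"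
  by (rule definableI[where \<phi> = "Mem 0 1" and \<tau> = "case_nat s (\<lambda>i. t)"])
     (use \<Gamma> assms in \<open>auto simp: closed_class_def tm_var split: nat.split\<close>)

lemma definable_eq: 
  assumes "tm s" "tm t" shows "definable \<Gamma> Q (\<lambda>e. s e = t e)"
  by (rule definableI[where \<phi> = "Eq 0 1" and \<tau> = "case_nat s (\<lambda>i. t)"])
     (use \<Gamma> assms in \<open>auto simp: closed_class_def tm_var split: nat.split\<close>)

lemma definable_imp: 
  assumes "definable \<Gamma> Q R" "definable \<Gamma> Q R'" shows "definable \<Gamma> Q (\<lambda>e. R e \<longrightarrow> R' e)"
proof -
  from assms(1) obtain \<phi> \<sigma> where 1: "\<phi> \<in> \<Gamma>" "\<forall>e\<in>Q. R e \<longleftrightarrow> sat \<S> (\<lambda>i. app (\<sigma> i) e) \<phi>"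
    unfolding definable_def by blast
  from assms(2) obtain \<psi> \<tau> where 2: "\<psi> \<in> \<Gamma>" "\<forall>e\<in>Q. R' e \<longleftrightarrow> sat \<S> (\<lambda>i. app (\<tau> i) e) \<psi>"
    unfolding definable_def by blast
  \<comment> \<open>The two formulae come with different fillings \<open>\<sigma>\<close> and
    \<open>\<tau>\<close>; moving one to the even and the other to the odd indices lets a single
    filling serve both.\<close>
  have [simp]: "Suc (2 * i) div 2 = i" for i by presburger
  show ?thesis
    by (rule definableI[where \<phi> = "Imp (ren (\<lambda>i. 2*i) \<phi>) (ren (\<lambda>i. Suc (2*i)) \<psi>)" and
         \<tau> = "\<lambda>i. if even i then app (\<sigma> (i div 2)) else app (\<tau> (i div 2))"])
       (use \<Gamma> 1 2 in \<open>auto simp: closed_class_def tm_app sat_ren\<close>)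
qed

lemma definable_ball:
  assumes "tm s" "definable \<Gamma> Q' (\<lambda>e. R (e 0) (\<lambda>n. e (Suc n)))"
   "\<And>e x. e \<in> Q \<Longrightarrow> E x (s e) \<Longrightarrow> case_nat x e \<in> Q'"
  shows "definable \<Gamma> Q (\<lambda>e. \<forall>x. E x (s e) \<longrightarrow> R x e)"
proof -
  from assms(2) obtain \<phi> \<tau> where 1: "\<phi> \<in> \<Gamma>" "\<forall>e\<in>Q'. R (e 0) (\<lambda>n. e (Suc n)) \<longleftrightarrow> sat \<S> (\<lambda>i. app (\<tau> i) e) \<phi>"
    unfolding definable_def by blast
  have 2: "R x e \<longleftrightarrow> sat \<S> (\<lambda>i. app (\<tau> i) (case_nat x e)) \<phi>" if "e \<in> Q" "E x (s e)" for x e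
    using 1(2)[rule_format, of "case_nat x e"] assms(3)[OF that] by simp
  \<comment> \<open>In the body of the new formula, index 0 is \<open>x\<close>, index 1 is the
    bound \<open>s\<close>, and index \<open>i + 2\<close> carries the term that
    \<open>\<phi>\<close> had at \<open>i\<close>. Indices of \<open>\<phi>\<close> filled by the
    quantified variable are sent to 0; the value \<open>s\<close> given to them in
    \<open>\<sigma>\<close> is a dummy.\<close>
  define k where "k i = (if \<tau> i = Inl 0 then 0 else Suc (Suc i))" for i :: nat
  define \<sigma> where "\<sigma> = case_nat s (\<lambda>i. case \<tau> i of Inl 0 \<Rightarrow> s | Inl (Suc j) \<Rightarrow> (\<lambda>e. e j) | Inr c \<Rightarrow> (\<lambda>e. c))"
  have 3: "(\<lambda>i. case_nat x (\<lambda>i. \<sigma> i e) (k i)) = (\<lambda>i. app (\<tau> i) (case_nat x e))" for x e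
    by (rule ext) (auto simp: k_def \<sigma>_def split: sum.splits nat.splits)
  show ?thesis
  proof (rule definableI[where \<phi> = "All_in 0 (ren k \<phi>)" and \<tau> = \<sigma>])
    show "All_in 0 (ren k \<phi>) \<in> \<Gamma>" using \<Gamma> 1(1) by (auto simp: closed_class_def)
    show "tm (\<sigma> i)" for i
      by (auto simp: \<sigma>_def assms(1) tm_var tm_const split: nat.split sum.split)
    fix e assume "e \<in> Q"
    then show "(\<forall>x. E x (s e) \<longrightarrow> R x e) \<longleftrightarrow> sat \<S> (\<lambda>i. \<sigma> i e) (All_in 0 (ren k \<phi>))"
      using 2 by (simp add: sat_ren 3) (simp add: \<sigma>_def)
  qed
qed

lemma definable_neg: "definable \<Gamma> Q R \<Longrightarrow> definable \<Gamma> Q (\<lambda>e. \<not> R e)"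
  using definable_imp[of Q R "\<lambda>e. False"] definable_false by simp

lemma definable_disj: "definable \<Gamma> Q R \<Longrightarrow> definable \<Gamma> Q R' \<Longrightarrow> definable \<Gamma> Q (\<lambda>e. R e \<or> R' e)"
  using definable_imp[of Q "\<lambda>e. \<not> R e" R'] definable_neg by (simp add: imp_conv_disj)

lemma definable_conj: "definable \<Gamma> Q R \<Longrightarrow> definable \<Gamma> Q R' \<Longrightarrow> definable \<Gamma> Q (\<lambda>e. R e \<and> R' e)"
  using definable_neg[OF definable_imp[of Q R "\<lambda>e. \<not> R' e"]] definable_neg by simp

lemma definable_bex:
  assumes "tm s" "definable \<Gamma> Q' (\<lambda>e. R (e 0) (\<lambda>n. e (Suc n)))"
   "\<And>e x. e \<in> Q \<Longrightarrow> E x (s e) \<Longrightarrow> case_nat x e \<in> Q'"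
  shows "definable \<Gamma> Q (\<lambda>e. \<exists>x. E x (s e) \<and> R x e)"
  using definable_neg[OF definable_ball[OF assms(1) definable_neg[OF assms(2)], of Q]] assms(3) by simp

end

text \<open>\<open>DP\<close>, \<open>SP\<close> and \<open>SS\<close> are boldface classes of relations, on environments: \<open>\<Delta>\<^sub>0\<^sup>\<P>\<close>,
  \<open>\<Sigma>\<^sub>1\<^sup>\<P>\<close> (with a single unbounded quantifier), and the relations that are \<open>\<Sigma>\<^sub>1\<close> on the
  power-admissible cover.\<close>

definition DP :: "((nat \<Rightarrow> 'a) \<Rightarrow> bool) \<Rightarrow> bool" where
  "DP = definable Delta0P UNIV"

lemmas DP_mem = definable_mem[OF closed_Delta0P, of _ _ UNIV, folded DP_def]
lemmas DP_eq = definable_eq[OF closed_Delta0P, of _ _ UNIV, folded DP_def]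
lemmas DP_neg = definable_neg[OF closed_Delta0P, of UNIV, folded DP_def]
lemmas DP_disj = definable_disj[OF closed_Delta0P, of UNIV, folded DP_def]
lemmas DP_conj = definable_conj[OF closed_Delta0P, of UNIV, folded DP_def]

lemma DP_ball: "tm s \<Longrightarrow> DP (\<lambda>e. R (e 0) (\<lambda>n. e (Suc n))) \<Longrightarrow> DP (\<lambda>e. \<forall>x. E x (s e) \<longrightarrow> R x e)"
  unfolding DP_def by (erule definable_ball[OF closed_Delta0P]) auto

lemma DP_bex: "tm s \<Longrightarrow> DP (\<lambda>e. R (e 0) (\<lambda>n. e (Suc n))) \<Longrightarrow> DP (\<lambda>e. \<exists>x. E x (s e) \<and> R x e)"
  unfolding DP_def by (erule definable_bex[OF closed_Delta0P]) auto

lemma DP_subst: "DP R \<Longrightarrow> (\<And>i. tm (\<tau> i)) \<Longrightarrow> DP (\<lambda>e. R (\<lambda>i. \<tau> i e))"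
  unfolding DP_def by (erule definable_subst) auto

text \<open>The only closure rule for \<open>DP\<close> that produces a subset quantifier; it makes
  the graph of the power set operation \<open>DP\<close>.\<close>

lemma DP_subset_ball: "DP (\<lambda>e. \<forall>x. (\<forall>z. E z x \<longrightarrow> E z (e 1)) \<longrightarrow> E x (e 0))"
  unfolding DP_def
  by (rule definableI[where \<phi> = "All_sub 1 (Mem 0 1)" and \<tau> = "\<lambda>i e. e i"])
     (auto intro: Delta0P.intros tm_var)

lemma DP_subst1: "DP (\<lambda>e. R (e 0)) \<Longrightarrow> tm a \<Longrightarrow> DP (\<lambda>e. R (a e))"
  using DP_subst[of "\<lambda>e. R (e 0)" "\<lambda>i. a"] by simp

lemma DP_subst3: "DP (\<lambda>e. R (e 0) (e 1) (e 2)) \<Longrightarrow> tm a \<Longrightarrow> tm b \<Longrightarrow> tm c \<Longrightarrow> DP (\<lambda>e. R (a e) (b e) (c e))"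
  using DP_subst[of "\<lambda>e. R (e 0) (e 1) (e 2)" "case_nat a (case_nat b (\<lambda>i. c))"]
  by (simp add: numeral_2_eq_2 split: nat.split)

end

section \<open>Separation, collection and foundation for definable relations\<close>

lemma case_nat_eta: "case_nat (e 0) (\<lambda>n. e (Suc n)) = e"
  by (rule ext) (simp split: nat.split)

lemma sat_eta: "(\<lambda>e. sat M (case_nat (e 0) (\<lambda>n. e (Suc n))) \<phi>) = (\<lambda>e. sat M e \<phi>)"
  by (rule ext) (simp only: case_nat_eta)

text \<open>The universe is the whole type, which avoids relativising every statement to a carrier.
  The given model is brought into this form by transport to \<open>nat\<close>.\<close>

locale kp_powerset = structure_on E for E :: "'a \<Rightarrow> 'a \<Rightarrow> bool" +
  assumes extensionality: "(\<And>z. E z x \<longleftrightarrow> E z y) \<Longrightarrow> x = y"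
    and ex_upair: "\<exists>z. \<forall>w. E w z \<longleftrightarrow> w = x \<or> w = y"
    and ex_union: "\<exists>z. \<forall>w. E w z \<longleftrightarrow> (\<exists>v. E v x \<and> E w v)"
    and ex_power: "\<exists>z. \<forall>w. E w z \<longleftrightarrow> (\<forall>v. E v w \<longrightarrow> E v x)"
    and Delta0_separation: "\<phi> \<in> Delta0 \<Longrightarrow> \<exists>y. \<forall>x. E x y \<longleftrightarrow> E x w \<and> sat \<S> (case_nat x e) \<phi>"
    and Delta0P_collection: "\<phi> \<in> Delta0P \<Longrightarrow>
       (\<And>x. E x w \<Longrightarrow> \<exists>y. sat \<S> (case_nat y (case_nat x e)) \<phi>) \<Longrightarrow>
       \<exists>C. \<forall>x. E x w \<longrightarrow> (\<exists>y. E y C \<and> sat \<S> (case_nat y (case_nat x e)) \<phi>)"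
    and Sigma1P_foundation: "\<phi> \<in> Sigma1P \<Longrightarrow> sat \<S> (case_nat x e) \<phi> \<Longrightarrow>
       \<exists>y. sat \<S> (case_nat y e) \<phi> \<and> (\<forall>x. E x y \<longrightarrow> \<not> sat \<S> (case_nat x e) \<phi>)"
begin

section \<open>Set operations and bounded formulae\<close>

definition upr where "upr x y = (SOME z. \<forall>w. E w z \<longleftrightarrow> w = x \<or> w = y)"
definition un where "un x = (SOME z. \<forall>w. E w z \<longleftrightarrow> (\<exists>v. E v x \<and> E w v))"
definition pw where "pw x = (SOME z. \<forall>w. E w z \<longleftrightarrow> (\<forall>v. E v w \<longrightarrow> E v x))"
definition emp where "emp = (SOME z. \<forall>w. \<not> E w z)"
definition ins where "ins x y = un (upr (upr x x) y)"
definition pr where "pr x y = upr (upr x x) (upr x y)"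

lemma E_upr[simp]: "E w (upr x y) \<longleftrightarrow> w = x \<or> w = y"
  unfolding upr_def using someI_ex[OF ex_upair] by blast
lemma E_un[simp]: "E w (un x) \<longleftrightarrow> (\<exists>v. E v x \<and> E w v)"
  unfolding un_def using someI_ex[OF ex_union] by blast
lemma E_pw[simp]: "E w (pw x) \<longleftrightarrow> (\<forall>v. E v w \<longrightarrow> E v x)"
  unfolding pw_def using someI_ex[OF ex_power] by blast
lemma E_emp[simp]: "\<not> E w emp"
proof -
  have "\<exists>z. \<forall>w. \<not> E w z"
    using Delta0_separation[OF Delta0.intros(3)] by auto
  from someI_ex[OF this] show ?thesis unfolding emp_def by blast
qed
lemma E_ins[simp]: "E w (ins x y) \<longleftrightarrow> w = x \<or> E w y"
  unfolding ins_def by auto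

lemma upr_eq_iff: "upr a b = upr c d \<longleftrightarrow> (a = c \<and> b = d) \<or> (a = d \<and> b = c)"
proof
  assume "upr a b = upr c d"
  then have "E w (upr a b) \<longleftrightarrow> E w (upr c d)" for w by simp
  then show "(a = c \<and> b = d) \<or> (a = d \<and> b = c)" by (simp only: E_upr) metis
next
  assume "(a = c \<and> b = d) \<or> (a = d \<and> b = c)"
  then show "upr a b = upr c d" by (intro extensionality) auto
qed

lemma pr_eq_iff[simp]: "pr a b = pr c d \<longleftrightarrow> a = c \<and> b = d"
  unfolding pr_def upr_eq_iff by auto

lemma ex_finite_set: "finite A \<Longrightarrow> \<exists>b. \<forall>x. E x b \<longleftrightarrow> x \<in> A"
proof (induction rule: finite_induct)
  case empty
  then show ?case by (intro exI[of _ emp]) simp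
next
  case (insert x F)
  then obtain b where "\<forall>x. E x b \<longleftrightarrow> x \<in> F" by blast
  then show ?case by (intro exI[of _ "ins x b"]) simp
qed

lemma bounded_case_nat: "(\<forall>i. E (case_nat x e i) b) \<longleftrightarrow> E x b \<and> (\<forall>i. E (e i) b)"
proof
  assume *: "\<forall>i. E (case_nat x e i) b"
  show "E x b \<and> (\<forall>i. E (e i) b)" using *[rule_format, of 0] *[rule_format, of "Suc i" for i] by simp
qed (simp split: nat.split)

text \<open>On a bounded domain the subset quantifiers can be bounded by power sets.\<close>

lemma Delta0P_bounded:
  "\<phi> \<in> Delta0P \<Longrightarrow> definable Delta0 {e. \<forall>i. E (e i) B} (\<lambda>e. sat \<S> e \<phi>)"
proof (induction arbitrary: B rule: Delta0P.induct)
  case (1 i j)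
  show ?case by (simp add: definable_mem closed_Delta0 tm_var)
next
  case (2 i j)
  show ?case by (simp add: definable_eq closed_Delta0 tm_var)
next
  case 3
  show ?case by (simp add: definable_false closed_Delta0)
next
  case (4 \<phi> \<psi>)
  show ?case by (simp add: definable_imp[OF closed_Delta0 4(3,4)])
next
  case (5 \<phi> i)
  \<comment> \<open>\<open>B\<close> together with its union: it still bounds an environment with
    values in \<open>B\<close> after adding an element of one of these values.\<close>
  let ?B = "un (upr B (un B))"
  have "definable Delta0 {e. \<forall>i. E (e i) ?B} (\<lambda>e. sat \<S> (case_nat (e 0) (\<lambda>n. e (Suc n))) \<phi>)"
    by (subst sat_eta, insert 5(2)[of ?B], assumption)
  then have "definable Delta0 {e. \<forall>i. E (e i) B} (\<lambda>e. \<forall>x. E x (e i) \<longrightarrow> sat \<S> (case_nat x e) \<phi>)"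
    by (rule definable_ball[where R = "\<lambda>x e. sat \<S> (case_nat x e) \<phi>", OF closed_Delta0 tm_var])
       (erule CollectE, rule CollectI, subst bounded_case_nat, fastforce)
  then show ?case by simp
next
  case (6 \<phi> i)
  let ?B = "un (upr B (un B))"
  have "definable Delta0 {e. \<forall>i. E (e i) ?B} (\<lambda>e. sat \<S> (case_nat (e 0) (\<lambda>n. e (Suc n))) \<phi>)"
    by (subst sat_eta, insert 6(2)[of ?B], assumption)
  then have "definable Delta0 {e. \<forall>i. E (e i) B} (\<lambda>e. \<exists>x. E x (e i) \<and> sat \<S> (case_nat x e) \<phi>)"
    by (rule definable_bex[where R = "\<lambda>x e. sat \<S> (case_nat x e) \<phi>", OF closed_Delta0 tm_var])
       (erule CollectE, rule CollectI, subst bounded_case_nat, fastforce)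
  then show ?case by simp
next
  case (7 \<phi> i)
  \<comment> \<open>A subset of an element of \<open>B\<close> is a subset of the union of
    \<open>B\<close>, so the power set of that union both bounds the quantifier and has to be added
    to the bound on environments.\<close>
  let ?B = "un (upr B (pw (un B)))"
  have sub: "definable Delta0 Q (\<lambda>e. \<forall>z. E z (e 0) \<longrightarrow> E z (e (Suc i)))" for Q
    by (rule definable_ball[OF closed_Delta0 tm_var], rule definable_mem[OF closed_Delta0 tm_var tm_var], rule UNIV_I)
  have "definable Delta0 {e. \<forall>i. E (e i) ?B} (\<lambda>e. sat \<S> (case_nat (e 0) (\<lambda>n. e (Suc n))) \<phi>)"
    by (subst sat_eta, insert 7(2)[of ?B], assumption)
  from definable_imp[OF closed_Delta0 sub this]
  have "definable Delta0 {e. \<forall>i. E (e i) B}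
     (\<lambda>e. \<forall>x. E x (pw (un B)) \<longrightarrow> (\<forall>z. E z x \<longrightarrow> E z (e i)) \<longrightarrow> sat \<S> (case_nat x e) \<phi>)"
    by (rule definable_ball[where R = "\<lambda>x e. (\<forall>z. E z x \<longrightarrow> E z (e i)) \<longrightarrow> sat \<S> (case_nat x e) \<phi>", OF closed_Delta0 tm_const])
       (erule CollectE, rule CollectI, subst bounded_case_nat, fastforce)
  then show ?case by (rule definable_mono) auto
next
  case (8 \<phi> i)
  let ?B = "un (upr B (pw (un B)))"
  have sub: "definable Delta0 Q (\<lambda>e. \<forall>z. E z (e 0) \<longrightarrow> E z (e (Suc i)))" for Q
    by (rule definable_ball[OF closed_Delta0 tm_var], rule definable_mem[OF closed_Delta0 tm_var tm_var], rule UNIV_I)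
  have "definable Delta0 {e. \<forall>i. E (e i) ?B} (\<lambda>e. sat \<S> (case_nat (e 0) (\<lambda>n. e (Suc n))) \<phi>)"
    by (subst sat_eta, insert 8(2)[of ?B], assumption)
  from definable_conj[OF closed_Delta0 sub this]
  have "definable Delta0 {e. \<forall>i. E (e i) B}
     (\<lambda>e. \<exists>x. E x (pw (un B)) \<and> (\<forall>z. E z x \<longrightarrow> E z (e i)) \<and> sat \<S> (case_nat x e) \<phi>)"
    by (rule definable_bex[where R = "\<lambda>x e. (\<forall>z. E z x \<longrightarrow> E z (e i)) \<and> sat \<S> (case_nat x e) \<phi>", OF closed_Delta0 tm_const])
       (erule CollectE, rule CollectI, subst bounded_case_nat, fastforce)
  then show ?case by (rule definable_mono) auto
qed

text \<open>Brings a definition into the shape of the axiom schemes: the two arguments become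
  indices 0 and 1, and the parameters move into the rest \<open>p\<close> of the
  environment.\<close>

lemma definable_binary:
  assumes "closed_class \<Gamma>" "definable \<Gamma> Q (\<lambda>e. R (e 0) (e 1))"
  shows "\<exists>\<phi>\<in>\<Gamma>. \<exists>p. \<forall>x y. case_nat x (\<lambda>_. y) \<in> Q \<longrightarrow> (R x y \<longleftrightarrow> sat \<S> (case_nat x (case_nat y p)) \<phi>)"
proof -
  obtain \<phi> \<tau> where 1: "\<phi> \<in> \<Gamma>" "\<forall>e\<in>Q. R (e 0) (e 1) \<longleftrightarrow> sat \<S> (\<lambda>i. app (\<tau> i) e) \<phi>"
    using assms(2) unfolding definable_def by blast
  define k where "k i = (case \<tau> i of Inl 0 \<Rightarrow> 0 | Inl (Suc j) \<Rightarrow> 1 | Inr c \<Rightarrow> i + 2)" for i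
  define p where "p i = (case \<tau> i of Inl j \<Rightarrow> undefined | Inr c \<Rightarrow> c)" for i
  have 2: "(\<lambda>i. case_nat x (case_nat y p) (k i)) = (\<lambda>i. app (\<tau> i) (case_nat x (\<lambda>_. y)))" for x y
    by (rule ext) (simp add: k_def p_def split: sum.split nat.split)
  show ?thesis
  proof (intro bexI exI allI impI)
    show "ren k \<phi> \<in> \<Gamma>" using assms(1) 1(1) by (simp add: closed_class_def)
    fix x y assume "case_nat x (\<lambda>_. y) \<in> Q"
    then show "R x y \<longleftrightarrow> sat \<S> (case_nat x (case_nat y p)) (ren k \<phi>)"
      using 1(2)[rule_format, of "case_nat x (\<lambda>_. y)"] by (simp add: sat_ren 2)
  qed
qed

text \<open>Reduced to \<open>Delta0\<close> separation by \<open>Delta0P_bounded\<close>, which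
  requires a bound on the whole environment. The finitely many parameters at free variables of
  \<open>\<phi>\<close> form a set \<open>b\<close>, and all other indices are filled with
  \<open>x\<close> itself, which lies in \<open>w\<close>.\<close>

lemma DP_separation:
  assumes "DP (\<lambda>e. R (e 0))"
  shows "\<exists>y. \<forall>x. E x y \<longleftrightarrow> E x w \<and> R x"
proof -
  obtain \<phi> \<tau> where 1: "\<phi> \<in> Delta0P" "\<forall>e. R (e 0) \<longleftrightarrow> sat \<S> (\<lambda>i. app (\<tau> i) e) \<phi>"
    using assms unfolding definable_def DP_def by blast
  define \<tau>' where "\<tau>' i = (case \<tau> i of Inl j \<Rightarrow> (\<lambda>e. e 0) | Inr c \<Rightarrow> if i \<in> fv \<phi> then (\<lambda>e. c) else (\<lambda>e::nat\<Rightarrow>'a. e 0))" for i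
  have tm: "tm (\<tau>' i)" for i
    by (simp add: \<tau>'_def tm_var tm_const split: sum.split)
  have sat: "R x \<longleftrightarrow> sat \<S> (\<lambda>i. \<tau>' i e) \<phi>" if "e 0 = x" for x e
  proof -
    have "R x \<longleftrightarrow> sat \<S> (\<lambda>i. app (\<tau> i) (\<lambda>_. x)) \<phi>"
      using 1(2)[rule_format, of "\<lambda>_. x"] by simp
    also have "\<dots> \<longleftrightarrow> sat \<S> (\<lambda>i. \<tau>' i e) \<phi>"
      by (rule sat_cong_fv) (simp add: \<tau>'_def that split: sum.split)
    finally show ?thesis .
  qed
  obtain b where b: "\<forall>x. E x b \<longleftrightarrow> x \<in> (\<lambda>i. \<tau>' i undefined) ` fv \<phi>"
    using ex_finite_set[OF finite_imageI[OF finite_fv]] by blast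
  have "definable Delta0 {e. E (e 0) w} (\<lambda>e. sat \<S> (\<lambda>i. \<tau>' i e) \<phi>)"
  proof (rule definable_subst[where R = "\<lambda>e. sat \<S> e \<phi>" and \<tau> = \<tau>'])
    show "definable Delta0 {e. \<forall>i. E (e i) (un (upr w b))} (\<lambda>e. sat \<S> e \<phi>)"
      by (rule Delta0P_bounded[OF 1(1)])
    show "tm (\<tau>' i)" for i by (rule tm)
    fix e :: "nat \<Rightarrow> 'a" assume e: "e \<in> {e. E (e 0) w}"
    have "E (\<tau>' i e) w \<or> E (\<tau>' i e) b" for i
    proof (cases "\<tau> i")
      case (Inr c)
      have "E c b" if "i \<in> fv \<phi>"
      proof -
        have "c = \<tau>' i undefined" using Inr that by (simp add: \<tau>'_def)
        then have "c \<in> (\<lambda>i. \<tau>' i undefined) ` fv \<phi>" using that by (rule image_eqI)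
        then show ?thesis using b by simp
      qed
      then show ?thesis using e Inr by (simp add: \<tau>'_def)
    qed (use e in \<open>simp add: \<tau>'_def\<close>)
    then show "(\<lambda>i. \<tau>' i e) \<in> {e. \<forall>i. E (e i) (un (upr w b))}" by auto
  qed
  then have "definable Delta0 {e. E (e 0) w} (\<lambda>e. R (e 0))"
    by (rule definable_mono) (simp_all add: sat)
  from definable_binary[OF closed_Delta0, of _ "\<lambda>x y. R x", OF this]
  obtain \<psi> p where 2: "\<psi> \<in> Delta0" "\<And>x y. E x w \<Longrightarrow> R x \<longleftrightarrow> sat \<S> (case_nat x (case_nat y p)) \<psi>"
    by auto
  have "\<exists>z. \<forall>x. E x z \<longleftrightarrow> E x w \<and> sat \<S> (case_nat x (case_nat w p)) \<psi>"
    by (rule Delta0_separation[OF 2(1)])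
  then show ?thesis using 2(2) by blast
qed

section \<open>Closure of the existential class and its schemes\<close>

definition SP :: "((nat \<Rightarrow> 'a) \<Rightarrow> bool) \<Rightarrow> bool" where
  "SP R \<longleftrightarrow> (\<exists>D. DP D \<and> (\<forall>e. R e \<longleftrightarrow> (\<exists>s. D (case_nat s e))))"

lemma SPI: "DP D \<Longrightarrow> (\<And>e. R e \<longleftrightarrow> (\<exists>s. D (case_nat s e))) \<Longrightarrow> SP R"
  unfolding SP_def by blast

lemma SPE:
  assumes "SP R" obtains D where "DP D" "R = (\<lambda>e. \<exists>s. D (case_nat s e))"
proof -
  obtain D where "DP D" "\<forall>e. R e \<longleftrightarrow> (\<exists>s. D (case_nat s e))" using assms unfolding SP_def by blast
  then show thesis by (intro that[of D] ext) auto
qed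

lemma DP_env: "DP D \<Longrightarrow> (\<And>i. tm (\<lambda>e. f e i)) \<Longrightarrow> DP (\<lambda>e. D (f e))"
  using DP_subst[of D "\<lambda>i e. f e i"] by simp

lemma SP_DP: "DP R \<Longrightarrow> SP R"
  by (rule SPI[of "\<lambda>e. R (\<lambda>i. e (Suc i))"]) (auto intro: DP_env tm_var)

lemma SP_env:
  assumes "SP R" "\<And>i. tm (\<lambda>e. f e i)"
  shows "SP (\<lambda>e. R (f e))"
proof -
  obtain D where D: "DP D" "R = (\<lambda>e. \<exists>s. D (case_nat s e))" using assms(1) by (rule SPE)
  show ?thesis unfolding D(2)
  proof (rule SPI)
    show "DP (\<lambda>e. D (case_nat (e 0) (f (\<lambda>n. e (Suc n)))))"
    proof (rule DP_env[OF D(1)])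
      show "tm (\<lambda>e. case_nat (e 0) (f (\<lambda>n. e (Suc n))) i)" for i
        by (cases i) (auto simp: tm_var intro: tm_shift[OF assms(2)])
    qed
  qed simp
qed

lemma tm_case_nat: "tm a \<Longrightarrow> (\<And>i. tm (\<lambda>e. g e i)) \<Longrightarrow> tm (\<lambda>e. case_nat (a e) (g e) i)"
  by (cases i) auto

text \<open>Two unbounded quantifiers are contracted into one over a set having both witnesses as
  elements; an unordered pair is such a set. \<open>SP_conj\<close> uses the same device.\<close>

lemma SP_ex:
  assumes "SP (\<lambda>e. R (e 0) (\<lambda>n. e (Suc n)))" shows "SP (\<lambda>e. \<exists>x. R x e)"
proof -
  obtain D where D: "DP D" "(\<lambda>e. R (e 0) (\<lambda>n. e (Suc n))) = (\<lambda>e. \<exists>s. D (case_nat s e))"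
    using assms(1) by (rule SPE)
  have R: "R x e \<longleftrightarrow> (\<exists>s. D (case_nat s (case_nat x e)))" for x e
    using fun_cong[OF D(2), of "case_nat x e"] by simp
  show ?thesis
  proof (rule SPI)
    show "DP (\<lambda>e. \<exists>x. E x (e 0) \<and> (\<exists>s. E s (e 0) \<and> D (case_nat s (case_nat x (\<lambda>n. e (Suc n))))))"
      by (intro DP_bex DP_env[OF D(1)] tm_var tm_case_nat)
  next
    fix e
    show "(\<exists>x. R x e) \<longleftrightarrow>
      (\<exists>q. \<exists>x. E x (case_nat q e 0) \<and> (\<exists>s. E s (case_nat q e 0) \<and> D (case_nat s (case_nat x (\<lambda>n. case_nat q e (Suc n))))))"
      (is "?l \<longleftrightarrow> ?r")
    proof
      assume ?l
      then obtain x s where "D (case_nat s (case_nat x e))" using R by blast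
      then show ?r by (intro exI[of _ "upr x s"] exI[of _ x] conjI exI[of _ s]) simp_all
    qed (auto simp: R)
  qed
qed

lemma SP_conj:
  assumes "SP R1" "SP R2" shows "SP (\<lambda>e. R1 e \<and> R2 e)"
proof -
  obtain D1 where D1: "DP D1" "R1 = (\<lambda>e. \<exists>s. D1 (case_nat s e))" using assms(1) by (rule SPE)
  obtain D2 where D2: "DP D2" "R2 = (\<lambda>e. \<exists>s. D2 (case_nat s e))" using assms(2) by (rule SPE)
  show ?thesis
  proof (rule SPI)
    show "DP (\<lambda>e. \<exists>s. E s (e 0) \<and> (\<exists>t. E t (e 0) \<and> D1 (case_nat s (\<lambda>n. e (Suc n))) \<and> D2 (case_nat t (\<lambda>n. e (Suc n)))))"
      by (intro DP_bex DP_conj DP_env[OF D1(1)] DP_env[OF D2(1)] tm_var tm_case_nat)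
  next
    fix e
    show "(R1 e \<and> R2 e) \<longleftrightarrow>
      (\<exists>q s. E s (case_nat q e 0) \<and> (\<exists>t. E t (case_nat q e 0) \<and> D1 (case_nat s (\<lambda>n. case_nat q e (Suc n)))
         \<and> D2 (case_nat t (\<lambda>n. case_nat q e (Suc n)))))" (is "?l \<longleftrightarrow> ?r")
    proof
      assume ?l
      then obtain t s where "D1 (case_nat s e)" "D2 (case_nat t e)" using D1 D2 by blast
      then show ?r by (intro exI[of _ "upr s t"] exI[of _ s] conjI exI[of _ t]) simp_all
    qed (auto simp: D1 D2)
  qed
qed

lemma SP_disj:
  assumes "SP R1" "SP R2" shows "SP (\<lambda>e. R1 e \<or> R2 e)"
proof -
  obtain D1 where D1: "DP D1" "R1 = (\<lambda>e. \<exists>s. D1 (case_nat s e))" using assms(1) by (rule SPE)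
  obtain D2 where D2: "DP D2" "R2 = (\<lambda>e. \<exists>s. D2 (case_nat s e))" using assms(2) by (rule SPE)
  show ?thesis by (rule SPI[OF DP_disj[OF D1(1) D2(1)]]) (auto simp: D1 D2)
qed

lemma SP_bex: "tm s \<Longrightarrow> SP (\<lambda>e. R (e 0) (\<lambda>n. e (Suc n))) \<Longrightarrow> SP (\<lambda>e. \<exists>x. E x (s e) \<and> R x e)"
  by (rule SP_ex, rule SP_conj[OF SP_DP], rule DP_mem[OF tm_var], erule tm_shift)

lemma SP_collection:
  assumes "SP (\<lambda>e. R (e 0) (e 1))" "\<And>x. E x w \<Longrightarrow> \<exists>y. R x y"
  shows "\<exists>C. (\<forall>x. E x w \<longrightarrow> (\<exists>y. E y C \<and> R x y)) \<and> (\<forall>y. E y C \<longrightarrow> (\<exists>x. E x w \<and> R x y))"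
proof -
  obtain D' where D': "DP D'" "(\<lambda>e. R (e 0) (e 1)) = (\<lambda>e. \<exists>s. D' (case_nat s e))"
    using assms(1) by (rule SPE)
  define D where "D s x y = D' (case_nat s (case_nat x (\<lambda>_. y)))" for s x y
  have R: "R x y \<longleftrightarrow> (\<exists>s. D s x y)" for x y
    using fun_cong[OF D'(2), of "case_nat x (\<lambda>_. y)"] by (simp add: D_def)
  have D: "tm a \<Longrightarrow> tm b \<Longrightarrow> tm c \<Longrightarrow> DP (\<lambda>e. D (a e) (b e) (c e))" for a b c
    unfolding D_def by (intro DP_env[OF D'(1)] tm_case_nat)
  \<comment> \<open>Collection is applied to sets \<open>q\<close> containing both a value
    \<open>y\<close> and a witness \<open>s\<close> for it, so that the union of the collected set
    contains both.\<close>
  have "DP (\<lambda>e. \<exists>y. E y (e 0) \<and> (\<exists>s. E s (e 0) \<and> D s (e 1) y))"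
    by (intro DP_bex D tm_var)
  then have "definable Delta0P UNIV (\<lambda>e. (\<lambda>q x. \<exists>y. E y q \<and> (\<exists>s. E s q \<and> D s x y)) (e 0) (e 1))"
    unfolding DP_def by simp
  from definable_binary[OF closed_Delta0P this]
  obtain \<phi> p where 1: "\<phi> \<in> Delta0P"
    "\<And>q x. (\<exists>y. E y q \<and> (\<exists>s. E s q \<and> D s x y)) \<longleftrightarrow> sat \<S> (case_nat q (case_nat x p)) \<phi>"
    by auto
  have "\<exists>C. \<forall>x. E x w \<longrightarrow> (\<exists>q. E q C \<and> sat \<S> (case_nat q (case_nat x p)) \<phi>)"
  proof (rule Delta0P_collection[OF 1(1)])
    fix x assume "E x w"
    then obtain y s where "D s x y" using assms(2) R by blast
    then have "\<exists>y'. E y' (upr y s) \<and> (\<exists>s'. E s' (upr y s) \<and> D s' x y')" by auto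
    then show "\<exists>q. sat \<S> (case_nat q (case_nat x p)) \<phi>" unfolding 1(2) by blast
  qed
  then obtain C where C: "\<And>x. E x w \<Longrightarrow> \<exists>q. E q C \<and> (\<exists>y. E y q \<and> (\<exists>s. E s q \<and> D s x y))"
    unfolding 1(2) by blast
  have "\<exists>W. \<forall>y. E y W \<longleftrightarrow> E y (un C) \<and> (\<exists>x. E x w \<and> (\<exists>s. E s (un C) \<and> D s x y))"
    by (intro DP_separation DP_bex D tm_var tm_const)
  then obtain W where W: "\<forall>y. E y W \<longleftrightarrow> E y (un C) \<and> (\<exists>x. E x w \<and> (\<exists>s. E s (un C) \<and> D s x y))" by blast
  have "\<exists>y. E y W \<and> R x y" if xw: "E x w" for x
  proof -
    obtain q y s where "E q C" "E y q" "E s q" "D s x y" using C[OF xw] by blast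
    then show ?thesis using W R xw by (intro exI[of _ y]) auto
  qed
  then show ?thesis using W R by (intro exI[of _ W]) blast
qed

lemma SP_foundation:
  assumes "SP (\<lambda>e. R (e 0))" "R x"
  shows "\<exists>y. R y \<and> (\<forall>x. E x y \<longrightarrow> \<not> R x)"
proof -
  obtain D where D: "DP D" "(\<lambda>e. R (e 0)) = (\<lambda>e. \<exists>s. D (case_nat s e))"
    using assms(1) by (rule SPE)
  have R: "R x \<longleftrightarrow> (\<exists>s. D (case_nat s (\<lambda>_. x)))" for x
    using fun_cong[OF D(2), of "\<lambda>_. x"] by simp
  have "DP (\<lambda>e. D (case_nat (e 0) (\<lambda>_. e 1)))"
    by (intro DP_env[OF D(1)] tm_case_nat tm_var)
  then have "definable Delta0P UNIV (\<lambda>e. (\<lambda>s x. D (case_nat s (\<lambda>_. x))) (e 0) (e 1))"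
    unfolding DP_def by simp
  from definable_binary[OF closed_Delta0P this]
  obtain \<phi> p where 1: "\<phi> \<in> Delta0P"
    "\<And>s x. D (case_nat s (\<lambda>_. x)) \<longleftrightarrow> sat \<S> (case_nat s (case_nat x p)) \<phi>" by auto
  have 2: "R x \<longleftrightarrow> sat \<S> (case_nat x p) (Ex \<phi>)" for x
    unfolding R 1(2) by simp
  have "Ex \<phi> = (Ex ^^ 1) \<phi>" by simp
  then have "Ex \<phi> \<in> Sigma1P" unfolding Ex_prefix_def using 1(1) by blast
  from Sigma1P_foundation[OF this assms(2)[unfolded 2]] show ?thesis unfolding 2 by blast
qed

text \<open>Collection gives one set \<open>C\<close> of witnesses good for all \<open>x\<close>, so
  the unbounded quantifier moves in front of the bounded one.\<close>

lemma SP_ball: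
  assumes "tm s" "SP (\<lambda>e. R (e 0) (\<lambda>n. e (Suc n)))" shows "SP (\<lambda>e. \<forall>x. E x (s e) \<longrightarrow> R x e)"
proof -
  obtain D where D: "DP D" "(\<lambda>e. R (e 0) (\<lambda>n. e (Suc n))) = (\<lambda>e. \<exists>s. D (case_nat s e))"
    using assms(2) by (rule SPE)
  have R: "R x e \<longleftrightarrow> (\<exists>s. D (case_nat s (case_nat x e)))" for x e
    using fun_cong[OF D(2), of "case_nat x e"] by simp
  show ?thesis
  proof (rule SPI)
    show "DP (\<lambda>e. \<forall>x. E x (s (\<lambda>n. e (Suc n))) \<longrightarrow> (\<exists>t. E t (e 0) \<and> D (case_nat t (case_nat x (\<lambda>n. e (Suc n))))))"
      by (intro DP_ball DP_bex DP_env[OF D(1)] tm_var tm_case_nat tm_shift[OF assms(1)])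
  next
    fix e
    have "\<exists>C. \<forall>x. E x (s e) \<longrightarrow> (\<exists>t. E t C \<and> D (case_nat t (case_nat x e)))" if "\<forall>x. E x (s e) \<longrightarrow> R x e"
    proof -
      have "SP (\<lambda>e'. D (case_nat (e' 1) (case_nat (e' 0) e)))"
        by (intro SP_DP DP_env[OF D(1)] tm_case_nat tm_var tm_const)
      then have "SP (\<lambda>e'. (\<lambda>x t. D (case_nat t (case_nat x e))) (e' 0) (e' 1))" by simp
      from SP_collection[OF this, of "s e"] show ?thesis using that R by blast
    qed
    then show "(\<forall>x. E x (s e) \<longrightarrow> R x e) \<longleftrightarrow>
      (\<exists>C. \<forall>x. E x (s (\<lambda>n. case_nat C e (Suc n))) \<longrightarrow> 
        (\<exists>t. E t (case_nat C e 0) \<and> D (case_nat t (case_nat x (\<lambda>n. case_nat C e (Suc n))))))"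
      using R by auto
  qed
qed

end

section \<open>Ordinals and the well-founded part\<close>

context kp_powerset begin

lemma SP_subst1: "SP (\<lambda>e. R (e 0)) \<Longrightarrow> tm a \<Longrightarrow> SP (\<lambda>e. R (a e))"
  using SP_env[of "\<lambda>e. R (e 0)" "\<lambda>e i. a e"] by simp

lemma SP_subst2: "SP (\<lambda>e. R (e 0) (e 1)) \<Longrightarrow> tm a \<Longrightarrow> tm b \<Longrightarrow> SP (\<lambda>e. R (a e) (b e))"
  using SP_env[of "\<lambda>e. R (e 0) (e 1)" "\<lambda>e. case_nat (a e) (\<lambda>_. b e)"] by (simp add: tm_case_nat)

section \<open>Internal ordinals\<close>

definition Ord :: "'a \<Rightarrow> bool" where
  "Ord x \<longleftrightarrow> (\<forall>y. E y x \<longrightarrow> (\<forall>z. E z y \<longrightarrow> E z x)) \<and>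
     (\<forall>y. E y x \<longrightarrow> (\<forall>z. E z y \<longrightarrow> (\<forall>w. E w z \<longrightarrow> E w y)))"

lemma DP_Ord: "tm a \<Longrightarrow> DP (\<lambda>e. Ord (a e))"
proof (rule DP_subst1[of Ord])
  show "DP (\<lambda>e. Ord (e 0))"
    unfolding Ord_def by (intro DP_conj DP_ball DP_mem tm_var)
qed

lemma Ord_mem: "Ord x \<Longrightarrow> E y x \<Longrightarrow> Ord y"
  unfolding Ord_def by blast

lemma Ord_trans: "Ord x \<Longrightarrow> E y x \<Longrightarrow> E z y \<Longrightarrow> E z x"
  unfolding Ord_def by blast

lemma Ord_succ: assumes "Ord x" shows "Ord (ins x x)"
proof -
  have t: "E z x" if "E y x" "E z y" for y z using assms that unfolding Ord_def by blast
  have u: "E w y" if "E y x" "E z y" "E w z" for w y z using assms that unfolding Ord_def by blast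
  show ?thesis unfolding Ord_def by (auto intro: t u)
qed

lemma mem_irrefl: "\<not> E x x"
proof -
  have "SP (\<lambda>e. e 0 = x)" by (intro SP_DP DP_eq tm_var tm_const)
  then have "SP (\<lambda>e. (\<lambda>z. z = x) (e 0))" by simp
  from SP_foundation[of "\<lambda>z. z = x", OF this refl] show ?thesis by blast
qed

text \<open>Foundation is used twice: \<open>\<alpha>\<close> is minimal among ordinals incomparable
  with some ordinal, and \<open>\<beta>\<close> is minimal among those incomparable with
  \<open>\<alpha>\<close>. Elements of either are comparable with the other, which forces them into
  it, so the two are equal by extensionality.\<close>

lemma Ord_linear:
  assumes "Ord a" "Ord b" shows "E a b \<or> a = b \<or> E b a"
proof (rule ccontr)
  define cmp where "cmp a b \<longleftrightarrow> E a b \<or> a = b \<or> E b a" for a b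
  assume "\<not> ?thesis"
  then have "\<not> cmp a b" unfolding cmp_def .
  have DP: "DP (\<lambda>e. Ord (s e) \<and> \<not> cmp (t e) (s e))" if "tm s" "tm t" for s t
    unfolding cmp_def by (intro DP_conj DP_Ord DP_neg DP_disj DP_mem DP_eq that)
  have "SP (\<lambda>e. (\<lambda>x. Ord x \<and> (\<exists>y. Ord y \<and> \<not> cmp x y)) (e 0))"
    by (rule SP_conj[OF SP_DP[OF DP_Ord[OF tm_var]]], rule SP_ex, rule SP_DP, rule DP; rule tm_var)
  from SP_foundation[of "\<lambda>x. Ord x \<and> (\<exists>y. Ord y \<and> \<not> cmp x y)", OF this, of a] assms \<open>\<not> cmp a b\<close> obtain \<alpha> b' where
    \<alpha>: "Ord \<alpha>" "Ord b'" "\<not> cmp \<alpha> b'" and min\<alpha>: "\<And>x y. E x \<alpha> \<Longrightarrow> Ord x \<Longrightarrow> Ord y \<Longrightarrow> cmp x y" by blast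
  have "SP (\<lambda>e. (\<lambda>y. Ord y \<and> \<not> cmp \<alpha> y) (e 0))"
    by (rule SP_DP, rule DP; rule tm_var tm_const)
  from SP_foundation[of "\<lambda>y. Ord y \<and> \<not> cmp \<alpha> y", OF this, of b'] \<alpha> obtain \<beta> where
    \<beta>: "Ord \<beta>" "\<not> cmp \<alpha> \<beta>" and min\<beta>: "\<And>y. E y \<beta> \<Longrightarrow> Ord y \<Longrightarrow> cmp \<alpha> y" by blast
  have "\<alpha> = \<beta>"
  proof (rule extensionality)
    fix z show "E z \<alpha> \<longleftrightarrow> E z \<beta>"
    proof
      assume z: "E z \<alpha>"
      have "cmp z \<beta>" using min\<alpha>[OF z Ord_mem[OF \<alpha>(1) z] \<beta>(1)] .
      then show "E z \<beta>" using \<beta>(2) z Ord_trans[OF \<alpha>(1) z] unfolding cmp_def by blast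
    next
      assume z: "E z \<beta>"
      have "cmp \<alpha> z" using min\<beta>[OF z Ord_mem[OF \<beta>(1) z]] .
      then show "E z \<alpha>" using \<beta>(2) z Ord_trans[OF \<beta>(1) z] unfolding cmp_def by blast
    qed
  qed
  then show False using \<beta>(2) by (simp add: cmp_def)
qed

text \<open>\<open>Wellfounded.accp\<close> is well-foundedness as seen from outside; the foundation
  scheme holds in the structure even when some of its ordinals are not \<open>std\<close>.\<close>

definition std :: "'a \<Rightarrow> bool" where "std x \<longleftrightarrow> Ord x \<and> Wellfounded.accp E x"

lemma std_mem: "std x \<Longrightarrow> E y x \<Longrightarrow> std y"
  unfolding std_def by (blast intro: Ord_mem accp_downward)

lemma std_succ: assumes "std x" shows "std (ins x x)"
proof -
  have "Wellfounded.accp E (ins x x)"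
  proof (rule accp.accI)
    fix y assume "E y (ins x x)"
    then have "y = x \<or> E y x" by simp
    then show "Wellfounded.accp E y" using assms std_mem unfolding std_def by blast
  qed
  then show ?thesis using assms Ord_succ unfolding std_def by blast
qed

lemma std_emp: "std emp"
proof -
  have "Wellfounded.accp E emp" by (rule accp.accI) simp
  then show ?thesis unfolding std_def Ord_def by simp
qed

lemma std_less_Ord: "std x \<Longrightarrow> Ord y \<Longrightarrow> \<not> std y \<Longrightarrow> E x y"
  using Ord_linear[of x y] std_mem[of x y] unfolding std_def by blast

lemma std_max:
  assumes "std a" "std b" shows "\<exists>c. std c \<and> E a c \<and> E b c"
proof -
  have "E a b \<or> a = b \<or> E b a" using assms Ord_linear by (simp add: std_def)
  then show ?thesis using std_succ[OF assms(1)] std_succ[OF assms(2)] by auto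
qed

text \<open>A least bound is either standard, or some smaller nonstandard ordinal is a bound as well.\<close>

lemma std_uniform:
  assumes T: "SP (\<lambda>e. T (e 0) (e 1))" and "\<And>b. E b a \<Longrightarrow> \<exists>\<eta>. std \<eta> \<and> T \<eta> b"
  shows "\<exists>\<sigma>. std \<sigma> \<and> (\<forall>b. E b a \<longrightarrow> (\<exists>\<eta>. E \<eta> \<sigma> \<and> T \<eta> b))"
proof -
  define G where "G \<sigma> \<longleftrightarrow> Ord \<sigma> \<and> (\<forall>b. E b a \<longrightarrow> (\<exists>\<eta>. E \<eta> \<sigma> \<and> T \<eta> b))" for \<sigma>
  have T': "SP (\<lambda>e. T (s e) (t e))" if "tm s" "tm t" for s t
    using SP_subst2[of T, OF T that] .
  have G: "SP (\<lambda>e. G (e 0))"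
    unfolding G_def
    by (rule SP_conj[OF SP_DP[OF DP_Ord[OF tm_var]]], rule SP_ball[OF tm_const], rule SP_bex[OF tm_var], rule T'; rule tm_var)
  \<comment> \<open>\<open>std\<close> cannot occur in the collected relation, so \<open>Ord\<close>
    stands in for it. The resulting bound may be nonstandard; it only shows that some ordinal
    satisfies \<open>G\<close>.\<close>
  have "SP (\<lambda>e. Ord (e 1) \<and> T (e 1) (e 0))"
    by (rule SP_conj[OF SP_DP[OF DP_Ord[OF tm_var]] T'[OF tm_var tm_var]])
  then have "SP (\<lambda>e. (\<lambda>b \<eta>. Ord \<eta> \<and> T \<eta> b) (e 0) (e 1))" by simp
  from SP_collection[of "\<lambda>b \<eta>. Ord \<eta> \<and> T \<eta> b", OF this, of a] assms(2)
  obtain C where C': "\<forall>b. E b a \<longrightarrow> (\<exists>\<eta>. E \<eta> C \<and> Ord \<eta> \<and> T \<eta> b)" "\<forall>\<eta>. E \<eta> C \<longrightarrow> (\<exists>b. E b a \<and> Ord \<eta> \<and> T \<eta> b)"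
    unfolding std_def by blast
  have C: "\<exists>\<eta>. E \<eta> C \<and> Ord \<eta> \<and> T \<eta> b" if "E b a" for b using C'(1) that by blast
  have COrd: "Ord \<eta>" if "E \<eta> C" for \<eta> using C'(2) that by blast
  let ?\<sigma> = "ins (un C) (un C)"
  have "E z (un C)" if "E y (un C)" "E z y" for y z
    using that Ord_trans[OF COrd] by (simp only: E_un) blast
  moreover have "E w y" if "E y (un C)" "E z y" "E w z" for w y z
    using that Ord_trans[OF Ord_mem[OF COrd]] by (simp only: E_un) blast
  ultimately have "Ord (un C)" unfolding Ord_def by blast
  have "E \<eta> ?\<sigma>" if "E \<eta> C" for \<eta>
    using Ord_linear[OF COrd[OF that] \<open>Ord (un C)\<close>] mem_irrefl[of "un C"] that by auto
  then have "G ?\<sigma>" unfolding G_def using C Ord_succ[OF \<open>Ord (un C)\<close>] by blast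
  from SP_foundation[of G, OF G this] obtain \<sigma> where \<sigma>: "G \<sigma>" "\<And>x. E x \<sigma> \<Longrightarrow> \<not> G x" by blast
  have "std \<sigma>"
  proof (rule ccontr)
    assume "\<not> std \<sigma>"
    then obtain \<sigma>' where \<sigma>': "E \<sigma>' \<sigma>" "\<not> Wellfounded.accp E \<sigma>'"
      using \<sigma>(1) unfolding G_def std_def by (blast intro: accp.accI)
    then have "Ord \<sigma>'" "\<not> std \<sigma>'" using \<sigma>(1) Ord_mem unfolding G_def std_def by blast+
    \<comment> \<open>The witnesses used here are the standard ones from the hypothesis, not the
      collected ones: every standard ordinal lies below the nonstandard
      \<open>\<sigma>'\<close>.\<close>
    then have "G \<sigma>'" unfolding G_def using assms(2) std_less_Ord by blast
    then show False using \<sigma>(2) \<sigma>'(1) by blast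
  qed
  then show ?thesis using \<sigma>(1) unfolding G_def by blast
qed

text \<open>Since \<open>std\<close> is not definable inside the structure, \<open>SS\<close> is in general larger than \<open>SP\<close>.\<close>

definition SS :: "((nat \<Rightarrow> 'a) \<Rightarrow> bool) \<Rightarrow> bool" where
  "SS R \<longleftrightarrow> (\<exists>T. SP T \<and> (\<forall>e. R e \<longleftrightarrow> (\<exists>\<eta>. std \<eta> \<and> T (case_nat \<eta> e))))"

lemma SSI: "SP T \<Longrightarrow> (\<And>e. R e \<longleftrightarrow> (\<exists>\<eta>. std \<eta> \<and> T (case_nat \<eta> e))) \<Longrightarrow> SS R"
  unfolding SS_def by blast

lemma SSE:
  assumes "SS R" obtains T where "SP T" "R = (\<lambda>e. \<exists>\<eta>. std \<eta> \<and> T (case_nat \<eta> e))"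
proof -
  obtain D where "SP D" "\<forall>e. R e \<longleftrightarrow> (\<exists>s. std s \<and> D (case_nat s e))" using assms unfolding SS_def by blast
  then show thesis by (intro that[of D] ext) auto
qed

lemma SS_SP: "SP R \<Longrightarrow> SS R"
  by (rule SSI[of "\<lambda>e. R (\<lambda>i. e (Suc i))"]) (auto intro: SP_env tm_var std_emp)

lemma SS_env:
  assumes "SS R" "\<And>i. tm (\<lambda>e. f e i)"
  shows "SS (\<lambda>e. R (f e))"
proof -
  obtain D where D: "SP D" "R = (\<lambda>e. \<exists>s. std s \<and> D (case_nat s e))" using assms(1) by (rule SSE)
  show ?thesis unfolding D(2)
  proof (rule SSI)
    show "SP (\<lambda>e. D (case_nat (e 0) (f (\<lambda>n. e (Suc n)))))"
    proof (rule SP_env[OF D(1)])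
      show "tm (\<lambda>e. case_nat (e 0) (f (\<lambda>n. e (Suc n))) i)" for i
        by (cases i) (auto simp: tm_var intro: tm_shift[OF assms(2)])
    qed
  qed simp
qed

lemma SS_ex:
  assumes "SS (\<lambda>e. R (e 0) (\<lambda>n. e (Suc n)))" shows "SS (\<lambda>e. \<exists>x. R x e)"
proof -
  obtain D where D: "SP D" "(\<lambda>e. R (e 0) (\<lambda>n. e (Suc n))) = (\<lambda>e. \<exists>s. std s \<and> D (case_nat s e))"
    using assms(1) by (rule SSE)
  have R: "R x e \<longleftrightarrow> (\<exists>s. std s \<and> D (case_nat s (case_nat x e)))" for x e
    using fun_cong[OF D(2), of "case_nat x e"] by simp
  show ?thesis
  proof (rule SSI)
    show "SP (\<lambda>e. \<exists>x. D (case_nat (e 0) (case_nat x (\<lambda>n. e (Suc n)))))"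
      by (intro SP_ex SP_env[OF D(1)] tm_var tm_case_nat)
  qed (auto simp: R)
qed

lemma SS_conj:
  assumes "SS R1" "SS R2" shows "SS (\<lambda>e. R1 e \<and> R2 e)"
proof -
  obtain D1 where D1: "SP D1" "R1 = (\<lambda>e. \<exists>s. std s \<and> D1 (case_nat s e))" using assms(1) by (rule SSE)
  obtain D2 where D2: "SP D2" "R2 = (\<lambda>e. \<exists>s. std s \<and> D2 (case_nat s e))" using assms(2) by (rule SSE)
  show ?thesis
  proof (rule SSI)
    show "SP (\<lambda>e. (\<exists>s. E s (e 0) \<and> D1 (case_nat s (\<lambda>n. e (Suc n)))) \<and> (\<exists>t. E t (e 0) \<and> D2 (case_nat t (\<lambda>n. e (Suc n)))))"
      by (intro SP_bex SP_conj SP_env[OF D1(1)] SP_env[OF D2(1)] tm_var tm_case_nat)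
  next
    fix e
    show "(R1 e \<and> R2 e) \<longleftrightarrow>
      (\<exists>q. std q \<and> (\<exists>s. E s (case_nat q e 0) \<and> D1 (case_nat s (\<lambda>n. case_nat q e (Suc n)))) \<and>
         (\<exists>t. E t (case_nat q e 0) \<and> D2 (case_nat t (\<lambda>n. case_nat q e (Suc n)))))" (is "?l \<longleftrightarrow> ?r")
    proof
      assume ?l
      then obtain t s where "std s" "D1 (case_nat s e)" "std t" "D2 (case_nat t e)" using D1 D2 by blast
      moreover obtain q where "std q" "E s q" "E t q" using std_max[OF \<open>std s\<close> \<open>std t\<close>] by blast
      ultimately show ?r by auto
    qed (auto simp: D1 D2 dest: std_mem)
  qed
qed

lemma SS_disj:
  assumes "SS R1" "SS R2" shows "SS (\<lambda>e. R1 e \<or> R2 e)"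
proof -
  obtain D1 where D1: "SP D1" "R1 = (\<lambda>e. \<exists>s. std s \<and> D1 (case_nat s e))" using assms(1) by (rule SSE)
  obtain D2 where D2: "SP D2" "R2 = (\<lambda>e. \<exists>s. std s \<and> D2 (case_nat s e))" using assms(2) by (rule SSE)
  show ?thesis by (rule SSI[OF SP_disj[OF D1(1) D2(1)]]) (auto simp: D1 D2)
qed

text \<open>\<open>std_uniform\<close> gives one standard ordinal bounding the indices for all
  \<open>x\<close>. Conversely, an index below a standard ordinal is itself standard.\<close>

lemma SS_ball_tm:
  assumes "tm s" "SS (\<lambda>e. R (e 0) (\<lambda>n. e (Suc n)))" shows "SS (\<lambda>e. \<forall>x. E x (s e) \<longrightarrow> R x e)"
proof -
  obtain D where D: "SP D" "(\<lambda>e. R (e 0) (\<lambda>n. e (Suc n))) = (\<lambda>e. \<exists>s. std s \<and> D (case_nat s e))"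
    using assms(2) by (rule SSE)
  have R: "R x e \<longleftrightarrow> (\<exists>s. std s \<and> D (case_nat s (case_nat x e)))" for x e
    using fun_cong[OF D(2), of "case_nat x e"] by simp
  show ?thesis
  proof (rule SSI)
    show "SP (\<lambda>e. \<forall>x. E x (s (\<lambda>n. e (Suc n))) \<longrightarrow> (\<exists>t. E t (e 0) \<and> D (case_nat t (case_nat x (\<lambda>n. e (Suc n))))))"
      by (intro SP_ball SP_bex SP_env[OF D(1)] tm_var tm_case_nat tm_shift[OF assms(1)])
  next
    fix e
    have "\<exists>C. std C \<and> (\<forall>x. E x (s e) \<longrightarrow> (\<exists>t. E t C \<and> D (case_nat t (case_nat x e))))" if "\<forall>x. E x (s e) \<longrightarrow> R x e"
    proof (rule std_uniform[where T = "\<lambda>t x. D (case_nat t (case_nat x e))"])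
      show "SP (\<lambda>e'. D (case_nat (e' 0) (case_nat (e' 1) e)))"
        by (intro SP_env[OF D(1)] tm_case_nat tm_var tm_const)
    qed (use that R in blast)
    then show "(\<forall>x. E x (s e) \<longrightarrow> R x e) \<longleftrightarrow>
      (\<exists>C. std C \<and> (\<forall>x. E x (s (\<lambda>n. case_nat C e (Suc n))) \<longrightarrow> 
        (\<exists>t. E t (case_nat C e 0) \<and> D (case_nat t (case_nat x (\<lambda>n. case_nat C e (Suc n)))))))"
      using std_mem by (simp only: R nat.case) blast
  qed
qed

text \<open>After a standard \<open>\<sigma>\<close> bounding all indices is fixed, the relation
  restricted to indices below \<open>\<sigma>\<close> is \<open>SP\<close>, and strong collection
  applies to it.\<close>

lemma SS_collection:
  assumes "SS (\<lambda>e. R (e 0) (e 1))" "\<And>x. E x w \<Longrightarrow> \<exists>y. R x y"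
  shows "\<exists>C. (\<forall>x. E x w \<longrightarrow> (\<exists>y. E y C \<and> R x y)) \<and> (\<forall>y. E y C \<longrightarrow> (\<exists>x. E x w \<and> R x y))"
proof -
  obtain T' where T': "SP T'" "(\<lambda>e. R (e 0) (e 1)) = (\<lambda>e. \<exists>s. std s \<and> T' (case_nat s e))"
    using assms(1) by (rule SSE)
  define T where "T s x y = T' (case_nat s (case_nat x (\<lambda>_. y)))" for s x y
  have R: "R x y \<longleftrightarrow> (\<exists>s. std s \<and> T s x y)" for x y
    using fun_cong[OF T'(2), of "case_nat x (\<lambda>_. y)"] by (simp add: T_def)
  have T: "tm a \<Longrightarrow> tm b \<Longrightarrow> tm c \<Longrightarrow> SP (\<lambda>e. T (a e) (b e) (c e))" for a b c
    unfolding T_def by (intro SP_env[OF T'(1)] tm_case_nat)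
  have "\<exists>\<sigma>. std \<sigma> \<and> (\<forall>x. E x w \<longrightarrow> (\<exists>\<eta>. E \<eta> \<sigma> \<and> (\<exists>y. T \<eta> x y)))"
  proof (rule std_uniform[where T = "\<lambda>\<eta> x. \<exists>y. T \<eta> x y"])
    show "SP (\<lambda>e. \<exists>y. T (e 0) (e 1) y)"
      by (rule SP_ex, rule T; rule tm_var)
  qed (use assms(2) R in blast)
  then obtain \<sigma> where \<sigma>: "std \<sigma>" "\<forall>x. E x w \<longrightarrow> (\<exists>\<eta>. E \<eta> \<sigma> \<and> (\<exists>y. T \<eta> x y))" by blast
  have "SP (\<lambda>e. \<exists>\<eta>. E \<eta> \<sigma> \<and> T \<eta> (e 0) (e 1))"
    by (rule SP_bex[OF tm_const], rule T; rule tm_var)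
  then have "SP (\<lambda>e. (\<lambda>x y. \<exists>\<eta>. E \<eta> \<sigma> \<and> T \<eta> x y) (e 0) (e 1))" by simp
  from SP_collection[of "\<lambda>x y. \<exists>\<eta>. E \<eta> \<sigma> \<and> T \<eta> x y", OF this, of w] \<sigma>(2) obtain C where
    C: "\<forall>x. E x w \<longrightarrow> (\<exists>y. E y C \<and> (\<exists>\<eta>. E \<eta> \<sigma> \<and> T \<eta> x y))" 
       "\<forall>y. E y C \<longrightarrow> (\<exists>x. E x w \<and> (\<exists>\<eta>. E \<eta> \<sigma> \<and> T \<eta> x y))" by blast
  then show ?thesis using R std_mem[OF \<sigma>(1)] by blast
qed

section \<open>Graphs of set operations and substitution of terms\<close>

lemma DP_upr: "DP (\<lambda>e. e 0 = upr (e 1) (e 2))"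
proof -
  have "z = upr x y \<longleftrightarrow> E x z \<and> E y z \<and> (\<forall>w. E w z \<longrightarrow> w = x \<or> w = y)" for x y z
  proof
    assume "E x z \<and> E y z \<and> (\<forall>w. E w z \<longrightarrow> w = x \<or> w = y)"
    then show "z = upr x y" by (intro extensionality) auto
  qed simp
  then show ?thesis by (simp only:) (intro DP_conj DP_mem DP_ball DP_disj DP_eq tm_var)
qed

lemma DP_pr: "DP (\<lambda>e. e 0 = pr (e 1) (e 2))"
proof -
  have "z = pr x y \<longleftrightarrow> (\<exists>a. E a z \<and> (\<exists>b. E b z \<and> a = upr x x \<and> b = upr x y \<and> z = upr a b))" for x y z
    unfolding pr_def by auto
  then show ?thesis
    by (simp only:) (intro DP_bex DP_conj DP_subst3[of "\<lambda>z x y. z = upr x y", OF DP_upr] tm_var)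
qed

lemma DP_ins: "DP (\<lambda>e. e 0 = ins (e 1) (e 2))"
proof -
  have "z = ins x y \<longleftrightarrow> E x z \<and> (\<forall>w. E w y \<longrightarrow> E w z) \<and> (\<forall>w. E w z \<longrightarrow> w = x \<or> E w y)" for x y z
  proof
    assume "E x z \<and> (\<forall>w. E w y \<longrightarrow> E w z) \<and> (\<forall>w. E w z \<longrightarrow> w = x \<or> E w y)"
    then show "z = ins x y" by (intro extensionality) auto
  qed simp
  then show ?thesis by (simp only:) (intro DP_conj DP_mem DP_ball DP_disj DP_eq tm_var)
qed

lemma DP_pw: "DP (\<lambda>e. e 0 = pw (e 1))"
proof -
  have "z = pw x \<longleftrightarrow> (\<forall>w. E w z \<longrightarrow> (\<forall>v. E v w \<longrightarrow> E v x)) \<and> (\<forall>w. (\<forall>v. E v w \<longrightarrow> E v x) \<longrightarrow> E w z)" for x z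
  proof
    assume "(\<forall>w. E w z \<longrightarrow> (\<forall>v. E v w \<longrightarrow> E v x)) \<and> (\<forall>w. (\<forall>v. E v w \<longrightarrow> E v x) \<longrightarrow> E w z)"
    then show "z = pw x" by (intro extensionality) (simp, blast)
  qed simp
  then show ?thesis by (simp only:) (intro DP_conj DP_mem DP_ball DP_subset_ball tm_var)
qed

text \<open>Terms with a \<open>\<Sigma>\<^sub>1\<^sup>\<P>\<close> graph can be substituted into \<open>SS\<close> relations, unlike into \<open>DP\<close> ones.\<close>

definition tmd :: "((nat \<Rightarrow> 'a) \<Rightarrow> 'a) \<Rightarrow> bool" where
  "tmd s \<longleftrightarrow> SP (\<lambda>e. e 0 = s (\<lambda>n. e (Suc n)))"

lemma tmd_tm: "tm s \<Longrightarrow> tmd s"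
  unfolding tmd_def by (rule SP_DP, rule DP_eq[OF tm_var], erule tm_shift)

lemma tmd_var: "tmd (\<lambda>e. e i)" by (rule tmd_tm[OF tm_var])
lemma tmd_const: "tmd (\<lambda>e. c)" by (rule tmd_tm[OF tm_const])

lemma tmd_graph:
  assumes "tmd s" "tm a" "\<And>i. tm (\<lambda>e. f e i)" shows "SP (\<lambda>e. a e = s (f e))"
  using SP_env[OF assms(1)[unfolded tmd_def], of "\<lambda>e. case_nat (a e) (f e)"] assms(2,3)
  by (simp add: tm_case_nat)

lemma tmd_app2:
  assumes F: "DP (\<lambda>e. e 0 = F (e 1) (e 2))" and "tmd s" "tmd t"
  shows "tmd (\<lambda>e. F (s e) (t e))"
proof -
  have "SP (\<lambda>e. \<exists>x. x = s (\<lambda>n. e (Suc n)) \<and> (\<exists>y. y = t (\<lambda>n. e (Suc n)) \<and> e 0 = F x y))"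
    by (intro SP_ex SP_conj tmd_graph[OF assms(2)] tmd_graph[OF assms(3)] 
      SP_DP[OF DP_subst3[of "\<lambda>z x y. z = F x y", OF F]] tm_var)
  then show ?thesis unfolding tmd_def by simp
qed

lemmas tmd_upr = tmd_app2[of upr, OF DP_upr]
lemmas tmd_pr = tmd_app2[of pr, OF DP_pr]
lemmas tmd_ins = tmd_app2[of ins, OF DP_ins]

lemma SS_bind: "tmd s \<Longrightarrow> SS (\<lambda>e. R (e 0) (\<lambda>n. e (Suc n))) \<Longrightarrow> SS (\<lambda>e. R (s e) e)"
proof -
  assume s: "tmd s" and R: "SS (\<lambda>e. R (e 0) (\<lambda>n. e (Suc n)))"
  have "SS (\<lambda>e. \<exists>x. x = s e \<and> R x e)"
    by (rule SS_ex, rule SS_conj[OF SS_SP[OF tmd_graph[OF s]] R]; rule tm_var)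
  then show ?thesis by simp
qed

lemma SS_app1:
  assumes "SS (\<lambda>e. R (e 0))" "tmd s" shows "SS (\<lambda>e. R (s e))"
  by (rule SS_bind[OF assms(2), of "\<lambda>x e. R x"]) (rule assms(1))

lemma SS_app2:
  assumes "SS (\<lambda>e. R (e 0) (e 1))" "tmd s" "tmd t" shows "SS (\<lambda>e. R (s e) (t e))"
proof -
  have "SS (\<lambda>e. \<exists>x. x = s e \<and> (\<exists>y. y = t e \<and> R x y))"
    by (rule SS_ex, rule SS_conj[OF SS_SP[OF tmd_graph[OF assms(2)]]], rule tm_var, rule tm_var,
        rule SS_ex, rule SS_conj[OF SS_SP[OF tmd_graph[OF assms(3)]]], rule tm_var, rule tm_var)
       (use SS_env[OF assms(1), of "\<lambda>e. case_nat (e 1) (\<lambda>_. e 0)"] in \<open>simp add: tm_case_nat tm_var\<close>)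
  then show ?thesis by simp
qed

lemma SS_eq: "tmd s \<Longrightarrow> tmd t \<Longrightarrow> SS (\<lambda>e. s e = t e)"
  by (rule SS_app2[of "(=)"]) (intro SS_SP SP_DP DP_eq tm_var)

lemma SS_neq: "tmd s \<Longrightarrow> tmd t \<Longrightarrow> SS (\<lambda>e. s e \<noteq> t e)"
  by (rule SS_app2[of "(\<noteq>)"]) (intro SS_SP SP_DP DP_neg DP_eq tm_var)

lemma SS_mem: "tmd s \<Longrightarrow> tmd t \<Longrightarrow> SS (\<lambda>e. E (s e) (t e))"
  by (rule SS_app2[of "E"]) (intro SS_SP SP_DP DP_mem tm_var)

lemma SS_pw: "tmd s \<Longrightarrow> tmd t \<Longrightarrow> SS (\<lambda>e. s e = pw (t e))"
  by (rule SS_app2[of "\<lambda>x y. x = pw y"]) (intro SS_SP SP_DP DP_pw)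

lemma SS_ball:
  assumes "tmd s" "SS (\<lambda>e. R (e 0) (\<lambda>n. e (Suc n)))"
  shows "SS (\<lambda>e. \<forall>x. E x (s e) \<longrightarrow> R x e)"
proof (rule SS_bind[OF assms(1), of "\<lambda>a e. \<forall>x. E x a \<longrightarrow> R x e"])
  show "SS (\<lambda>e. \<forall>x. E x (e 0) \<longrightarrow> R x (\<lambda>n. e (Suc n)))"
    by (rule SS_ball_tm[OF tm_var])
       (use SS_env[OF assms(2), of "\<lambda>e. case_nat (e 0) (\<lambda>n. e (Suc (Suc n)))"] in \<open>simp add: tm_case_nat tm_var\<close>)
qed

lemma SS_bex: "tmd s \<Longrightarrow> SS (\<lambda>e. R (e 0) (\<lambda>n. e (Suc n))) \<Longrightarrow> SS (\<lambda>e. \<exists>x. E x (s e) \<and> R x e)"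
proof (rule SS_ex, rule SS_conj)
  assume s: "tmd s"
  have "SS (\<lambda>e. \<exists>y. y = s (\<lambda>n. e (Suc n)) \<and> E (e 0) y)"
    by (intro SS_ex SS_SP SP_conj tmd_graph[OF s] SP_DP DP_mem tm_var)
  then show "SS (\<lambda>e. E (e 0) (s (\<lambda>n. e (Suc n))))" by simp
qed

text \<open>\<open>J x t\<close> is read as a rule with conclusion \<open>x\<close> whose premises are the elements of \<open>t\<close>. In
  \<open>SS_lfp\<close>, a derivation is coded by a set of pairs (rank, element) each of which is justified by
  pairs of smaller rank; the element is derivable iff its rank can be chosen standard.\<close>

inductive lfpJ :: "('a \<Rightarrow> 'a \<Rightarrow> bool) \<Rightarrow> 'a \<Rightarrow> bool" for J where
  lfpJ: "J x t \<Longrightarrow> (\<forall>y. E y t \<longrightarrow> lfpJ J y) \<Longrightarrow> lfpJ J x"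

lemma SS_lfp:
  assumes "SS (\<lambda>e. J (e 0) (e 1))" shows "SS (\<lambda>e. lfpJ J (e 0))"
proof -
  obtain T' where T': "SP T'" "(\<lambda>e. J (e 0) (e 1)) = (\<lambda>e. \<exists>s. std s \<and> T' (case_nat s e))"
    using assms(1) by (rule SSE)
  define T where "T s x y = T' (case_nat s (case_nat x (\<lambda>_. y)))" for s x y
  have J: "J x y \<longleftrightarrow> (\<exists>s. std s \<and> T s x y)" for x y
    using fun_cong[OF T'(2), of "case_nat x (\<lambda>_. y)"] by (simp add: T_def)
  have T: "tm a \<Longrightarrow> tm b \<Longrightarrow> tm c \<Longrightarrow> SP (\<lambda>e. T (a e) (b e) (c e))" for a b c
    unfolding T_def by (intro SP_env[OF T'(1)] tm_case_nat)
  have pr: "tm a \<Longrightarrow> tm b \<Longrightarrow> tm c \<Longrightarrow> SP (\<lambda>e. a e = pr (b e) (c e))" for a b c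
    by (rule SP_DP[OF DP_subst3[of "\<lambda>z x y. z = pr x y", OF DP_pr]])
  \<comment> \<open>The rank \<open>\<zeta>\<close> bounds not only the ranks of the premises but
    also the index \<open>\<eta>\<close> confirming the rule. A standard rank thus guarantees that
    the rule is a genuine instance of \<open>J\<close>.\<close>
  define Cor where "Cor w \<longleftrightarrow> (\<forall>p. E p w \<longrightarrow> (\<exists>\<zeta> y t. p = pr \<zeta> y \<and> (\<exists>\<eta>. E \<eta> \<zeta> \<and> T \<eta> y t) \<and>
    (\<forall>z. E z t \<longrightarrow> (\<exists>\<zeta>'. E \<zeta>' \<zeta> \<and> (\<exists>q. E q w \<and> q = pr \<zeta>' z)))))" for w
  have "SP (\<lambda>e. Cor (e 0))" unfolding Cor_def
    by (intro SP_ball SP_ex SP_conj SP_bex pr T tm_var)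
  then have Cor: "tm a \<Longrightarrow> SP (\<lambda>e. Cor (a e))" for a by (rule SP_subst1)
  define \<theta> where "\<theta> \<eta> x \<longleftrightarrow> (\<exists>w. Cor w \<and> (\<exists>p. E p w \<and> p = pr \<eta> x))" for \<eta> x
  have \<theta>: "SP (\<lambda>e. \<theta> (e 0) (e 1))" unfolding \<theta>_def
    by (intro SP_ex SP_conj SP_bex pr Cor tm_var)
  have 1: "\<exists>\<eta>. std \<eta> \<and> \<theta> \<eta> x" if "lfpJ J x" for x
    using that
  proof induction
    case (lfpJ x t)
    obtain \<eta>0 where \<eta>0: "std \<eta>0" "T \<eta>0 x t" using lfpJ(1) J by blast
    obtain \<sigma> where \<sigma>: "std \<sigma>" "\<forall>z. E z t \<longrightarrow> (\<exists>\<eta>. E \<eta> \<sigma> \<and> \<theta> \<eta> z)"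
      using std_uniform[of \<theta>, OF \<theta>, of t] lfpJ(2) by blast
    define P where "P z w \<longleftrightarrow> Cor w \<and> (\<exists>\<zeta>. E \<zeta> \<sigma> \<and> (\<exists>p. E p w \<and> p = pr \<zeta> z))" for z w
    have "SP (\<lambda>e. P (e 0) (e 1))" unfolding P_def
      by (intro SP_conj SP_bex pr Cor tm_var tm_const)
    moreover have "\<exists>w. P z w" if "E z t" for z
      using \<sigma>(2) that unfolding P_def \<theta>_def by blast
    ultimately have "\<exists>W. (\<forall>z. E z t \<longrightarrow> (\<exists>w. E w W \<and> P z w)) \<and> (\<forall>w. E w W \<longrightarrow> (\<exists>z. E z t \<and> P z w))"
      by (rule SP_collection[of P])
    then obtain W where W: "\<forall>z. E z t \<longrightarrow> (\<exists>w. E w W \<and> P z w)" "\<forall>w. E w W \<longrightarrow> (\<exists>z. E z t \<and> P z w)" by blast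
    \<comment> \<open>The new rank must exceed the index \<open>\<eta>0\<close> of the last rule and
      every rank used for the premises, all of which are below \<open>\<sigma>\<close>.\<close>
    obtain \<tau> where \<tau>: "std \<tau>" "E \<eta>0 \<tau>" "E \<sigma> \<tau>" using std_max[OF \<eta>0(1) \<sigma>(1)] by blast
    have \<sigma>\<tau>: "E \<zeta> \<tau>" if "E \<zeta> \<sigma>" for \<zeta>
      using Ord_trans[of \<tau> \<sigma> \<zeta>] \<tau> that unfolding std_def by blast
    let ?w = "ins (pr \<tau> x) (un W)"
    have "\<exists>\<zeta> y t. p = pr \<zeta> y \<and> (\<exists>\<eta>. E \<eta> \<zeta> \<and> T \<eta> y t) \<and>
        (\<forall>z. E z t \<longrightarrow> (\<exists>\<zeta>'. E \<zeta>' \<zeta> \<and> (\<exists>q. E q ?w \<and> q = pr \<zeta>' z)))" if "E p ?w" for p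
    proof (cases "p = pr \<tau> x")
      case True
      have "\<exists>\<zeta>'. E \<zeta>' \<tau> \<and> (\<exists>q. E q ?w \<and> q = pr \<zeta>' z)" if zt: "E z t" for z
      proof -
        obtain w \<zeta> where "E w W" "E \<zeta> \<sigma>" "E (pr \<zeta> z) w" using W(1) zt unfolding P_def by blast
        then show ?thesis using \<sigma>\<tau> by auto
      qed
      then show ?thesis using True \<tau>(2) \<eta>0(2) by blast
    next
      case False
      then obtain w where w: "E w W" "E p w" using \<open>E p ?w\<close> by auto
      then have "Cor w" using W(2) unfolding P_def by blast
      then obtain \<zeta> y t' where "p = pr \<zeta> y" "\<exists>\<eta>. E \<eta> \<zeta> \<and> T \<eta> y t'"
        "\<forall>z. E z t' \<longrightarrow> (\<exists>\<zeta>'. E \<zeta>' \<zeta> \<and> (\<exists>q. E q w \<and> q = pr \<zeta>' z))" unfolding Cor_def using w(2) by blast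
      moreover have "E q ?w" if "E q w" for q using that w(1) by auto
      ultimately show ?thesis by blast
    qed
    then have "Cor ?w" unfolding Cor_def by blast
    then have "\<theta> \<tau> x" unfolding \<theta>_def by auto
    then show ?case using \<tau>(1) by blast
  qed
  \<comment> \<open>The set \<open>w\<close> stays fixed while the rank decreases; the induction is
    external, which is why the rank has to be well-founded.\<close>
  have 2: "lfpJ J y" if "Wellfounded.accp E \<zeta>" "Ord \<zeta>" "Cor w" "E (pr \<zeta> y) w" for \<zeta> y w
    using that(1,2,4)
  proof (induction \<zeta> arbitrary: y rule: accp_induct_rule)
    case (1 \<zeta>)
    then obtain t \<eta> where t: "E \<eta> \<zeta>" "T \<eta> y t" "\<forall>z. E z t \<longrightarrow> (\<exists>\<zeta>'. E \<zeta>' \<zeta> \<and> E (pr \<zeta>' z) w)"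
      using \<open>Cor w\<close> unfolding Cor_def by force
    have "std \<zeta>" using 1(1,3) unfolding std_def by blast
    then have "std \<eta>" using t(1) by (rule std_mem)
    then have "J y t" using J t(2) by blast
    moreover have "lfpJ J z" if "E z t" for z
    proof -
      obtain \<zeta>' where "E \<zeta>' \<zeta>" "E (pr \<zeta>' z) w" using t(3) \<open>E z t\<close> by blast
      then show ?thesis using 1(2) Ord_mem[OF 1(3)] by blast
    qed
    ultimately show ?case by (blast intro: lfpJ.lfpJ)
  qed
  show ?thesis
  proof (rule SSI[OF \<theta>])
    fix e
    show "lfpJ J (e 0) \<longleftrightarrow> (\<exists>\<eta>. std \<eta> \<and> \<theta> (case_nat \<eta> e 0) (case_nat \<eta> e 1))"
      using 1[of "e 0"] 2 unfolding \<theta>_def std_def by auto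
  qed
qed

end

section \<open>Numbers and recursive functions\<close>

context kp_powerset begin

lemma SS_lfpI:
  assumes "SS (\<lambda>e. J (e 0) (e 1))" "\<And>x t. J x t \<Longrightarrow> (\<And>y. E y t \<Longrightarrow> I y) \<Longrightarrow> I x" "\<And>x. I x \<Longrightarrow> lfpJ J x"
  shows "SS (\<lambda>e. I (e 0))"
proof -
  have "I x" if "lfpJ J x" for x
    using that by induction (blast intro: assms(2))
  then have "I = lfpJ J" using assms(3) by blast
  then show ?thesis using SS_lfp[OF assms(1)] by simp
qed

lemma SS_app3:
  assumes "SS (\<lambda>e. R (e 0) (e 1) (e 2))" "tmd s" "tmd t" "tmd v" shows "SS (\<lambda>e. R (s e) (t e) (v e))"
proof -
  have "SS (\<lambda>e. (\<lambda>p. \<exists>x y z. p = pr x (pr y z) \<and> R x y z) (e 0))"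
    by (intro SS_ex SS_conj SS_eq tmd_var tmd_pr)
       (use SS_env[OF assms(1), of "\<lambda>e. case_nat (e 2) (case_nat (e 1) (\<lambda>_. e 0))"] in 
         \<open>simp add: tm_case_nat tm_var numeral_2_eq_2\<close>)
  from SS_app1[OF this, of "\<lambda>e. pr (s e) (pr (t e) (v e))"] show ?thesis
    using assms(2-4) by (simp add: tmd_pr)
qed

lemmas SS_intros = SS_conj SS_disj SS_ex SS_eq SS_neq SS_mem tmd_pr tmd_ins tmd_upr tmd_var tmd_const

section \<open>Numerals and arithmetic\<close>

primrec num :: "nat \<Rightarrow> 'a" where
  "num 0 = emp"
| "num (Suc n) = ins (num n) (num n)"

lemma E_num: "E x (num n) \<longleftrightarrow> (\<exists>m<n. x = num m)"
  by (induction n) (auto simp: less_Suc_eq)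

lemma num_inj[simp]: "num m = num n \<longleftrightarrow> m = n"
proof
  assume *: "num m = num n"
  show "m = n"
  proof (rule ccontr)
    assume "m \<noteq> n"
    then have "m < n \<or> n < m" by (simp add: nat_neq_iff)
    then have "E (num m) (num n) \<or> E (num n) (num m)" unfolding E_num by blast
    then show False using * mem_irrefl by simp
  qed
qed simp

lemma pr_neq_emp[simp]: "pr a b \<noteq> emp" "emp \<noteq> pr a b"
proof -
  have "E (upr a a) (pr a b)" unfolding pr_def by simp
  then show "pr a b \<noteq> emp" by auto
  then show "emp \<noteq> pr a b" by simp
qed

text \<open>Only numbers of the metatheory count, even if the structure has nonstandard natural
  numbers. That this is an \<open>SS\<close> relation rests on \<open>SS_lfp\<close>, which admits
  standard ranks only.\<close>

definition isnum :: "'a \<Rightarrow> bool" where "isnum x \<longleftrightarrow> (\<exists>n. x = num n)"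

lemma isnum_num[simp]: "isnum (num n)" by (auto simp: isnum_def)

lemma isnum_succ: "isnum a \<Longrightarrow> isnum (ins a a)"
  unfolding isnum_def by (metis num.simps(2))

lemma SS_isnum: "tmd s \<Longrightarrow> SS (\<lambda>e. isnum (s e))"
proof (rule SS_app1[of isnum])
  \<comment> \<open>A rule without premises has \<open>t = emp\<close>; a rule with the single
    premise \<open>a\<close> has the singleton \<open>upr a a\<close>. The rule relations below
    follow the same pattern.\<close>
  define J where "J x t \<longleftrightarrow> (x = emp \<and> t = emp) \<or> (\<exists>a. x = ins a a \<and> t = upr a a)" for x t
  show "SS (\<lambda>e. isnum (e 0))"
  proof (rule SS_lfpI)
    show "SS (\<lambda>e. J (e 0) (e 1))" unfolding J_def by (intro SS_intros)
    show "isnum x" if J: "J x t" and IH: "\<And>y. E y t \<Longrightarrow> isnum y" for x t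
    proof (cases "x = emp")
      case True
      then show ?thesis using isnum_num[of 0] by simp
    next
      case False
      then obtain a where "x = ins a a" "t = upr a a" using J unfolding J_def by blast
      then show ?thesis using IH[of a] isnum_succ by simp
    qed
    have "lfpJ J (num n)" for n
    proof (induction n)
      case 0
      show ?case by (rule lfpJ.lfpJ[of _ _ emp]) (auto simp: J_def)
    next
      case (Suc n)
      show ?case by (rule lfpJ.lfpJ[of _ _ "upr (num n) (num n)"]) (use Suc in \<open>auto simp: J_def\<close>)
    qed
    then show "lfpJ J x" if "isnum x" for x using that unfolding isnum_def by blast
  qed
qed

definition isadd :: "'a \<Rightarrow> 'a \<Rightarrow> 'a \<Rightarrow> bool" where
  "isadd x y z \<longleftrightarrow> (\<exists>m n. x = num m \<and> y = num n \<and> z = num (m + n))"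

lemma SS_isadd: "tmd s \<Longrightarrow> tmd t \<Longrightarrow> tmd v \<Longrightarrow> SS (\<lambda>e. isadd (s e) (t e) (v e))"
proof -
  assume stv: "tmd s" "tmd t" "tmd v"
  define J where "J x t \<longleftrightarrow> (\<exists>a. isnum a \<and> x = pr emp (pr a a) \<and> t = emp)
     \<or> (\<exists>a b c. x = pr (ins a a) (pr b (ins c c)) \<and> t = upr (pr a (pr b c)) (pr a (pr b c)))" for x t
  define I where "I x \<longleftrightarrow> (\<exists>m n. x = pr (num m) (pr (num n) (num (m + n))))" for x
  have "SS (\<lambda>e. I (e 0))"
  proof (rule SS_lfpI)
    show "SS (\<lambda>e. J (e 0) (e 1))" unfolding J_def by (intro SS_intros SS_isnum)
    show "I x" if J: "J x t" and IH: "\<And>y. E y t \<Longrightarrow> I y" for x t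
    proof -
      consider a where "isnum a" "x = pr emp (pr a a)" | 
        a b c where "x = pr (ins a a) (pr b (ins c c))" "t = upr (pr a (pr b c)) (pr a (pr b c))"
        using J unfolding J_def by blast
      then show ?thesis
      proof cases
        case 1
        then show ?thesis unfolding I_def isnum_def by (metis add_0 num.simps(1))
      next
        case 2
        then have "I (pr a (pr b c))" using IH by simp
        then obtain m n where "a = num m" "b = num n" "c = num (m + n)" unfolding I_def by auto
        then have "x = pr (num (Suc m)) (pr (num n) (num (Suc m + n)))" using 2 by simp
        then show ?thesis unfolding I_def by blast
      qed
    qed
    have "lfpJ J (pr (num m) (pr (num n) (num (m + n))))" for m n
    proof (induction m)
      case 0
      show ?case by (rule lfpJ.lfpJ[of _ _ emp]) (auto simp: J_def)
    next
      case (Suc m)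
      show ?case by (rule lfpJ.lfpJ[of _ _ "upr (pr (num m) (pr (num n) (num (m + n)))) (pr (num m) (pr (num n) (num (m + n))))"])
         (use Suc in \<open>auto simp: J_def\<close>)
    qed
    then show "lfpJ J x" if "I x" for x using that unfolding I_def by blast
  qed
  from SS_app1[of I, OF this, of "\<lambda>e. pr (s e) (pr (t e) (v e))"] stv
  show ?thesis unfolding I_def isadd_def by (simp add: tmd_pr)
qed

text \<open>Triangle numbers are the ingredient of the pairing function:
  \<open>prod_encode (m, n)\<close> is \<open>triangle (m + n) + m\<close>.\<close>

definition istri :: "'a \<Rightarrow> 'a \<Rightarrow> bool" where
  "istri x y \<longleftrightarrow> (\<exists>n. x = num n \<and> y = num (triangle n))"

lemma SS_istri: "tmd s \<Longrightarrow> tmd t \<Longrightarrow> SS (\<lambda>e. istri (s e) (t e))"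
proof -
  assume st: "tmd s" "tmd t"
  define J where "J x t \<longleftrightarrow> (x = pr emp emp \<and> t = emp)
     \<or> (\<exists>a b c. x = pr (ins a a) c \<and> isadd b (ins a a) c \<and> t = upr (pr a b) (pr a b))" for x t
  define I where "I x \<longleftrightarrow> (\<exists>n. x = pr (num n) (num (triangle n)))" for x
  have "SS (\<lambda>e. I (e 0))"
  proof (rule SS_lfpI)
    show "SS (\<lambda>e. J (e 0) (e 1))" unfolding J_def by (intro SS_intros SS_isadd)
    show "I x" if J: "J x t" and IH: "\<And>y. E y t \<Longrightarrow> I y" for x t
    proof -
      consider "x = pr emp emp" | 
        a b c where "x = pr (ins a a) c" "isadd b (ins a a) c" "t = upr (pr a b) (pr a b)"
        using J unfolding J_def by blast
      then show ?thesis
      proof cases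
        case 1
        then have "x = pr (num 0) (num (triangle 0))" by simp
        then show ?thesis unfolding I_def by blast
      next
        case 2
        then have "I (pr a b)" using IH by simp
        then obtain n where ab: "a = num n" "b = num (triangle n)" unfolding I_def by auto
        then have "isadd (num (triangle n)) (num (Suc n)) c" using 2(2) by simp
        then have "c = num (triangle n + Suc n)" unfolding isadd_def by (auto simp del: num.simps)
        then have "x = pr (num (Suc n)) (num (triangle (Suc n)))" using 2(1) ab by simp
        then show ?thesis unfolding I_def by blast
      qed
    qed
    have "lfpJ J (pr (num n) (num (triangle n)))" for n
    proof (induction n)
      case 0
      show ?case by (rule lfpJ.lfpJ[of _ _ emp]) (auto simp: J_def)
    next
      case (Suc n)
      have "isadd (num (triangle n)) (num (Suc n)) (num (triangle (Suc n)))" 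
        unfolding isadd_def triangle_Suc by blast
      then have "J (pr (num (Suc n)) (num (triangle (Suc n)))) (upr (pr (num n) (num (triangle n))) (pr (num n) (num (triangle n))))"
        unfolding J_def num.simps(2)[of n] by blast
      then show ?case by (rule lfpJ.lfpJ) (use Suc in simp)
    qed
    then show "lfpJ J x" if "I x" for x using that unfolding I_def by blast
  qed
  from SS_app1[of I, OF this, of "\<lambda>e. pr (s e) (t e)"] st
  show ?thesis unfolding I_def istri_def by (simp add: tmd_pr)
qed

definition ispe :: "'a \<Rightarrow> 'a \<Rightarrow> 'a \<Rightarrow> bool" where
  "ispe x y z \<longleftrightarrow> (\<exists>m n. x = num m \<and> y = num n \<and> z = num (prod_encode (m, n)))"

lemma SS_ispe: "tmd s \<Longrightarrow> tmd t \<Longrightarrow> tmd v \<Longrightarrow> SS (\<lambda>e. ispe (s e) (t e) (v e))"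
proof (rule SS_app3[of ispe])
  have "ispe x y z \<longleftrightarrow> (\<exists>a b. isadd x y a \<and> istri a b \<and> isadd b x z)" for x y z
    unfolding ispe_def isadd_def istri_def prod_encode_def by auto
  then show "SS (\<lambda>e. ispe (e 0) (e 1) (e 2))"
    by (simp only:) (intro SS_intros SS_isadd SS_istri)
qed

section \<open>Lists of numbers and partial recursive functions\<close>

primrec nl :: "nat list \<Rightarrow> 'a" where
  "nl [] = emp"
| "nl (n # ns) = pr (num n) (nl ns)"

lemma nl_inj[simp]: "nl xs = nl ys \<longleftrightarrow> xs = ys"
proof (induction xs arbitrary: ys)
  case Nil
  then show ?case by (cases ys) auto
next
  case (Cons a xs)
  then show ?case by (cases ys) auto
qed

lemma nl_eq_pr: "nl xs = pr a b \<longleftrightarrow> (\<exists>n ns. xs = n # ns \<and> a = num n \<and> b = nl ns)"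
  by (cases xs) auto

lemma pr_eq_nl: "pr a b = nl xs \<longleftrightarrow> (\<exists>n ns. xs = n # ns \<and> a = num n \<and> b = nl ns)"
  using nl_eq_pr[of xs a b] by auto

definition isnl :: "'a \<Rightarrow> bool" where "isnl x \<longleftrightarrow> (\<exists>xs. x = nl xs)"

lemma SS_isnl: "tmd s \<Longrightarrow> SS (\<lambda>e. isnl (s e))"
proof (rule SS_app1[of isnl])
  define J where "J x t \<longleftrightarrow> (x = emp \<and> t = emp) \<or> (\<exists>a b. isnum a \<and> x = pr a b \<and> t = upr b b)" for x t
  show "SS (\<lambda>e. isnl (e 0))"
  proof (rule SS_lfpI)
    show "SS (\<lambda>e. J (e 0) (e 1))" unfolding J_def by (intro SS_intros SS_isnum)
    show "isnl x" if J: "J x t" and IH: "\<And>y. E y t \<Longrightarrow> isnl y" for x t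
    proof (cases "x = emp")
      case True
      then show ?thesis unfolding isnl_def by (metis nl.simps(1))
    next
      case False
      then obtain a b where *: "isnum a" "x = pr a b" "t = upr b b" using J unfolding J_def by blast
      then have "isnl b" using IH by simp
      then show ?thesis using * unfolding isnl_def isnum_def by (metis nl.simps(2))
    qed
    have "lfpJ J (nl xs)" for xs
    proof (induction xs)
      case Nil
      show ?case by (rule lfpJ.lfpJ[of _ _ emp]) (auto simp: J_def)
    next
      case (Cons a xs)
      show ?case by (rule lfpJ.lfpJ[of _ _ "upr (nl xs) (nl xs)"]) (use Cons in \<open>auto simp: J_def\<close>)
    qed
    then show "lfpJ J x" if "isnl x" for x using that unfolding isnl_def by blast
  qed
qed

inductive_cases computes_ZeroE: "computes Zero xs z"
inductive_cases computes_SuccE: "computes Succ xs z"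
inductive_cases computes_ProjE: "computes (Proj i) xs z"
inductive_cases computes_CnE: "computes (Cn f gs) xs z"
inductive_cases computes_Pr0E: "computes (Pr f g) (0 # xs) z"
inductive_cases computes_PrSE: "computes (Pr f g) (Suc n # xs) z"
inductive_cases computes_PrE: "computes (Pr f g) xs z"
inductive_cases computes_MnE: "computes (Mn f) xs z"

definition iscomp :: "recf \<Rightarrow> 'a \<Rightarrow> 'a \<Rightarrow> bool" where
  "iscomp f x y \<longleftrightarrow> (\<exists>xs z. x = nl xs \<and> y = num z \<and> computes f xs z)"

definition isproj :: "nat \<Rightarrow> 'a \<Rightarrow> 'a \<Rightarrow> bool" where
  "isproj i x y \<longleftrightarrow> (\<exists>xs. x = nl xs \<and> i < length xs \<and> y = num (xs ! i))"

lemma SS_isproj: "SS (\<lambda>e. isproj i (e 0) (e 1))"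
proof (induction i)
  case 0
  have "isproj 0 x y \<longleftrightarrow> (\<exists>t. isnum y \<and> isnl t \<and> x = pr y t)" for x y
  proof
    assume "isproj 0 x y"
    then obtain xs where "x = nl xs" "0 < length xs" "y = num (xs ! 0)" unfolding isproj_def by blast
    then show "\<exists>t. isnum y \<and> isnl t \<and> x = pr y t" by (cases xs) (auto simp: isnum_def isnl_def)
  next
    assume "\<exists>t. isnum y \<and> isnl t \<and> x = pr y t"
    then obtain n ns where "x = nl (n # ns)" "y = num n" unfolding isnum_def isnl_def by auto
    then show "isproj 0 x y" unfolding isproj_def by (intro exI[of _ "n # ns"]) simp
  qed
  then show ?case by (simp only:) (intro SS_intros SS_isnum SS_isnl)
next
  case (Suc i)
  have "isproj (Suc i) x y \<longleftrightarrow> (\<exists>a t. isnum a \<and> x = pr a t \<and> isproj i t y)" for x y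
  proof
    assume "isproj (Suc i) x y"
    then obtain xs where "x = nl xs" "Suc i < length xs" "y = num (xs ! Suc i)" unfolding isproj_def by blast
    then show "\<exists>a t. isnum a \<and> x = pr a t \<and> isproj i t y" by (cases xs) (auto simp: isnum_def isproj_def)
  next
    assume "\<exists>a t. isnum a \<and> x = pr a t \<and> isproj i t y"
    then obtain n ns where "x = nl (n # ns)" "i < length ns" "y = num (ns ! i)" unfolding isnum_def isproj_def by auto
    then show "isproj (Suc i) x y" unfolding isproj_def by (intro exI[of _ "n # ns"]) simp
  qed
  then show ?case by (simp only:) (intro SS_intros SS_isnum SS_app2[OF Suc])
qed

definition iscomps :: "recf list \<Rightarrow> 'a \<Rightarrow> 'a \<Rightarrow> bool" where
  "iscomps gs x y \<longleftrightarrow> (\<exists>xs ys. x = nl xs \<and> y = nl ys \<and> list_all2 (\<lambda>g y. computes g xs y) gs ys)"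

lemma SS_iscomps:
  assumes "\<And>g. g \<in> set gs \<Longrightarrow> SS (\<lambda>e. iscomp g (e 0) (e 1))"
  shows "SS (\<lambda>e. iscomps gs (e 0) (e 1))"
  using assms
proof (induction gs)
  case Nil
  have "iscomps [] x y \<longleftrightarrow> isnl x \<and> y = emp" for x y
    unfolding iscomps_def isnl_def by (metis list_all2_Nil nl.simps(1))
  then show ?case by (simp only:) (intro SS_intros SS_isnl)
next
  case (Cons g gs)
  have gs: "SS (\<lambda>e. iscomps gs (e 0) (e 1))" by (rule Cons.IH, rule Cons.prems) simp
  have g: "SS (\<lambda>e. iscomp g (e 0) (e 1))" by (rule Cons.prems) simp
  have "iscomps (g # gs) x y \<longleftrightarrow> (\<exists>a b. y = pr a b \<and> iscomp g x a \<and> iscomps gs x b)" for x y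
  proof
    assume "iscomps (g # gs) x y"
    then obtain xs z zs where "x = nl xs" "y = nl (z # zs)" "computes g xs z" "list_all2 (\<lambda>g y. computes g xs y) gs zs"
      unfolding iscomps_def by (metis list_all2_Cons1)
    then show "\<exists>a b. y = pr a b \<and> iscomp g x a \<and> iscomps gs x b"
      unfolding iscomps_def iscomp_def by (intro exI[of _ "num z"] exI[of _ "nl zs"]) auto
  next
    assume "\<exists>a b. y = pr a b \<and> iscomp g x a \<and> iscomps gs x b"
    then obtain xs z zs where "x = nl xs" "y = nl (z # zs)" "computes g xs z" "list_all2 (\<lambda>g y. computes g xs y) gs zs"
      unfolding iscomps_def iscomp_def by auto
    then show "iscomps (g # gs) x y"
      unfolding iscomps_def by (intro exI[of _ xs] exI[of _ "z # zs"]) auto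
  qed
  then show ?case
    by (simp only:) (intro SS_intros SS_app2[of "iscomp g", OF g] SS_app2[of "iscomps gs", OF gs])
qed

text \<open>External induction on the program. Composition is an existential quantifier over the
  intermediate results. Minimisation is a bounded one over the elements of a numeral, which are
  exactly the smaller numerals. Primitive recursion needs a least fixed point of its own.\<close>

lemma SS_iscomp0: "SS (\<lambda>e. iscomp f (e 0) (e 1))"
proof (induction f)
  case Zero
  have "iscomp Zero x y \<longleftrightarrow> isnl x \<and> y = emp" for x y
    unfolding iscomp_def isnl_def by (metis computes.intros(1) computes_ZeroE num.simps(1))
  then show ?case by (simp only:) (intro SS_intros SS_isnl)
next
  case Succ
  have "iscomp Succ x y \<longleftrightarrow> (\<exists>a. isnum a \<and> x = pr a emp \<and> y = ins a a)" for x y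
  proof
    assume "iscomp Succ x y"
    then show "\<exists>a. isnum a \<and> x = pr a emp \<and> y = ins a a"
      unfolding iscomp_def by (auto elim!: computes_SuccE)
  next
    assume "\<exists>a. isnum a \<and> x = pr a emp \<and> y = ins a a"
    then obtain n where "x = nl [n]" "y = num (Suc n)" unfolding isnum_def by auto
    then show "iscomp Succ x y" unfolding iscomp_def using computes.intros(2) by blast
  qed
  then show ?case by (simp only:) (intro SS_intros SS_isnum)
next
  case (Proj i)
  have "iscomp (Proj i) x y \<longleftrightarrow> isproj i x y" for x y
    unfolding iscomp_def isproj_def by (metis computes.intros(3) computes_ProjE)
  then show ?case by (simp only: SS_isproj)
next
  case (Cn f gs)
  have "iscomp (Cn f gs) x y \<longleftrightarrow> (\<exists>z. iscomps gs x z \<and> iscomp f z y)" for x y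
  proof
    assume "iscomp (Cn f gs) x y"
    then show "\<exists>z. iscomps gs x z \<and> iscomp f z y"
      unfolding iscomp_def iscomps_def by (metis computes_CnE)
  next
    assume "\<exists>z. iscomps gs x z \<and> iscomp f z y"
    then obtain xs ys zs z where "x = nl xs" "list_all2 (\<lambda>g y. computes g xs y) gs ys" "nl ys = nl zs" "y = num z" "computes f zs z"
      unfolding iscomp_def iscomps_def by blast
    then show "iscomp (Cn f gs) x y" unfolding iscomp_def by (metis computes.intros(4) nl_inj)
  qed
  then show ?case
    by (simp only:) (intro SS_intros SS_app2[of "iscomp f", OF Cn(1)] SS_app2[of "iscomps gs", OF SS_iscomps[OF Cn(2)]])
next
  case (Pr f g)
  \<comment> \<open>The derived elements are pairs of an argument list and a value. The recursive
    rule has the value at the predecessor as its only premise; \<open>iscomp g\<close> is a side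
    condition, in \<open>SS\<close> by the induction hypothesis.\<close>
  define J where "J p t \<longleftrightarrow> (\<exists>xs y. iscomp f xs y \<and> p = pr (pr emp xs) y \<and> t = emp) \<or>
    (\<exists>n xs y z. p = pr (pr (ins n n) xs) z \<and> iscomp g (pr n (pr y xs)) z \<and> t = upr (pr (pr n xs) y) (pr (pr n xs) y))" for p t
  define I where "I p \<longleftrightarrow> (\<exists>xs z. p = pr (nl xs) (num z) \<and> computes (Pr f g) xs z)" for p
  have "SS (\<lambda>e. I (e 0))"
  proof (rule SS_lfpI)
    show "SS (\<lambda>e. J (e 0) (e 1))" unfolding J_def 
      by (intro SS_intros SS_app2[of "iscomp f", OF Pr(1)] SS_app2[of "iscomp g", OF Pr(2)])
    show "I p" if J: "J p t" and IH: "\<And>y. E y t \<Longrightarrow> I y" for p t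
    proof -
      consider xs y where "iscomp f xs y" "p = pr (pr emp xs) y"
        | n xs y z where "p = pr (pr (ins n n) xs) z" "iscomp g (pr n (pr y xs)) z" "t = upr (pr (pr n xs) y) (pr (pr n xs) y)"
        using J unfolding J_def by blast
      then show ?thesis
      proof cases
        case 1
        then obtain ys k where "p = pr (nl (0 # ys)) (num k)" "computes f ys k" unfolding iscomp_def by auto
        then show ?thesis unfolding I_def using computes.intros(5) by blast
      next
        case 2
        then have "I (pr (pr n xs) y)" using IH by simp
        then obtain m ms k where 3: "n = num m" "xs = nl ms" "y = num k" "computes (Pr f g) (m # ms) k"
          unfolding I_def by (auto simp: pr_eq_nl)
        have "iscomp g (nl (m # k # ms)) z" using 2(2) 3 by simp
        then obtain l where "z = num l" "computes g (m # k # ms) l"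
          unfolding iscomp_def by (auto simp del: nl.simps)
        then have "p = pr (nl (Suc m # ms)) (num l)" "computes (Pr f g) (Suc m # ms) l"
          using 2(1) 3 computes.intros(6) by simp_all
        then show ?thesis unfolding I_def by blast
      qed
    qed
    have L: "lfpJ J (pr (nl (n # xs)) (num z))" if "computes (Pr f g) (n # xs) z" for n xs z
      using that
    proof (induction n arbitrary: z)
      case 0
      from 0 have "computes f xs z" by (rule computes_Pr0E)
      then have "J (pr (nl (0 # xs)) (num z)) emp" unfolding J_def iscomp_def by auto
      then show ?case by (rule lfpJ.lfpJ) simp
    next
      case (Suc n)
      from Suc.prems obtain y where y: "computes (Pr f g) (n # xs) y" "computes g (n # y # xs) z" by (rule computes_PrSE)
      have "iscomp g (pr (num n) (pr (num y) (nl xs))) (num z)" 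
        unfolding iscomp_def using y(2) by (intro exI[of _ "n # y # xs"] exI[of _ z]) simp
      then have "J (pr (nl (Suc n # xs)) (num z)) (upr (pr (nl (n # xs)) (num y)) (pr (nl (n # xs)) (num y)))"
        unfolding J_def nl.simps num.simps by blast
      then show ?case by (rule lfpJ.lfpJ) (use Suc.IH[OF y(1)] in simp)
    qed
    show "lfpJ J x" if Ix: "I x" for x
    proof -
      obtain xs z where x: "x = pr (nl xs) (num z)" "computes (Pr f g) xs z" using Ix unfolding I_def by blast
      then obtain n ns where "xs = n # ns" by (auto elim: computes_PrE)
      then show ?thesis using x L by simp
    qed
  qed
  from SS_app1[of I, OF this, of "\<lambda>e. pr (e 0) (e 1)"]
  show ?case unfolding I_def iscomp_def by (simp add: tmd_pr tmd_var)
next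
  case (Mn f)
  have "iscomp (Mn f) x y \<longleftrightarrow> isnum y \<and> iscomp f (pr y x) emp \<and> (\<forall>m. E m y \<longrightarrow> (\<exists>v. v \<noteq> emp \<and> iscomp f (pr m x) v))" for x y
  proof
    assume "iscomp (Mn f) x y"
    then obtain xs n where 1: "x = nl xs" "y = num n" "computes (Mn f) xs n" unfolding iscomp_def by blast
    from 1(3) have 2: "computes f (n # xs) 0" "\<forall>m<n. \<exists>y>0. computes f (m # xs) y" by (auto elim: computes_MnE)
    have "iscomp f (pr y x) emp" unfolding iscomp_def using 2(1) 1 
      by (intro exI[of _ "n # xs"] exI[of _ 0]) simp
    moreover have "\<exists>v. v \<noteq> emp \<and> iscomp f (pr m x) v" if "E m y" for m
    proof -
      obtain k where k: "k < n" "m = num k" using \<open>E m y\<close> 1(2) E_num by blast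
      then obtain v where v: "v > 0" "computes f (k # xs) v" using 2(2) by blast
      have "num v \<noteq> num 0" using v(1) by (simp only: num_inj)
      moreover have "iscomp f (pr m x) (num v)" unfolding iscomp_def using v(2) 1 k
        by (intro exI[of _ "k # xs"] exI[of _ v]) simp
      ultimately show ?thesis by (metis num.simps(1))
    qed
    ultimately show "isnum y \<and> iscomp f (pr y x) emp \<and> (\<forall>m. E m y \<longrightarrow> (\<exists>v. v \<noteq> emp \<and> iscomp f (pr m x) v))"
      using 1(2) by simp
  next
    assume *: "isnum y \<and> iscomp f (pr y x) emp \<and> (\<forall>m. E m y \<longrightarrow> (\<exists>v. v \<noteq> emp \<and> iscomp f (pr m x) v))"
    then obtain n where n: "y = num n" unfolding isnum_def by blast
    have "iscomp f (pr (num n) x) (num 0)" using * n by simp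
    then obtain xs where xs: "x = nl xs" "computes f (n # xs) 0" 
      unfolding iscomp_def by (auto simp: pr_eq_nl simp del: num.simps)
    have "\<exists>z>0. computes f (m # xs) z" if "m < n" for m
    proof -
      obtain v where v: "v \<noteq> emp" "iscomp f (nl (m # xs)) v" using * n xs(1) \<open>m < n\<close> E_num by (metis nl.simps(2))
      then obtain z where "v = num z" "computes f (m # xs) z" unfolding iscomp_def by (auto simp del: nl.simps)
      moreover have "z \<noteq> 0" using v(1) \<open>v = num z\<close> num.simps(1) by metis
      ultimately show ?thesis by blast
    qed
    then have "computes (Mn f) xs n" using computes.intros(7)[of f n xs] xs(2) by blast
    then show "iscomp (Mn f) x y" unfolding iscomp_def using n xs(1) by blast
  qed
  then show ?case
    by (simp only:) (intro SS_intros SS_ball SS_isnum SS_app2[of "iscomp f", OF Mn])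
qed

lemma SS_re_set:
  assumes "re_set A" "tmd s" shows "SS (\<lambda>e. \<exists>n\<in>A. s e = num n)"
proof -
  obtain f where f: "\<And>n. n \<in> A \<longleftrightarrow> (\<exists>y. computes f [n] y)" using assms(1) unfolding re_set_def by blast
  have "(\<exists>n\<in>A. x = num n) \<longleftrightarrow> (\<exists>y. iscomp f (pr x emp) y)" for x
  proof
    assume "\<exists>n\<in>A. x = num n"
    then obtain n y where "x = num n" "computes f [n] y" using f by blast
    then show "\<exists>y. iscomp f (pr x emp) y" unfolding iscomp_def 
      by (intro exI[of _ "num y"] exI[of _ "[n]"] exI[of _ y]) simp
  next
    assume "\<exists>y. iscomp f (pr x emp) y"
    then obtain xs z where "pr x emp = nl xs" "computes f xs z" unfolding iscomp_def by blast
    moreover then obtain n where "xs = [n]" "x = num n"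
      by (cases xs; cases "tl xs") auto
    ultimately show "\<exists>n\<in>A. x = num n" using f by blast
  qed
  moreover have "SS (\<lambda>e. \<exists>y. iscomp f (pr (e 0) emp) y)"
    by (intro SS_intros SS_app2[of "iscomp f", OF SS_iscomp0])
  ultimately have "SS (\<lambda>e. \<exists>n\<in>A. e 0 = num n)" by (simp only:)
  from SS_app1[OF this assms(2)] show ?thesis .
qed

end

section \<open>Clauses and refutations\<close>

text \<open>\<open>New\<close> names the element \<open>d\<close>, \<open>Wit n t\<close> names a counterexample to the universal formula with
  matrix \<open>n\<close> in the environment \<open>t\<close>. Environments are lists built by \<open>Ext\<close>, not distinguished
  from terms.\<close>

datatype 'a trm = Par 'a | New | Wit nat "'a trm" | Ext "'a trm" "'a trm"

inductive lkp :: "nat \<Rightarrow> 'a trm \<Rightarrow> 'a trm \<Rightarrow> bool" where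
  lkp_0: "lkp 0 (Ext s t) s"
| lkp_Suc: "lkp i t r \<Longrightarrow> lkp (Suc i) (Ext s t) r"

text \<open>With \<open>k = 0\<close> or \<open>k = 1\<close> this is the code of an atomic formula;
  with \<open>k = 3\<close>, \<open>i\<close> and \<open>j\<close> are themselves numbers of
  formulae and it is their implication.\<close>

abbreviation atm :: "nat \<Rightarrow> nat \<Rightarrow> nat \<Rightarrow> nat" where
  "atm k i j \<equiv> prod_encode (k, prod_encode (i, j))"

text \<open>The environment with \<open>s\<close> at index 0 and \<open>t\<close> at index 1.
  \<open>New\<close> merely ends the list: \<open>lkp\<close> finds nothing beyond it.\<close>

abbreviation pairt :: "'a trm \<Rightarrow> 'a trm \<Rightarrow> 'a trm" where
  "pairt s t \<equiv> Ext s (Ext t New)"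

text \<open>In the environment \<open>y, a\<close>: every subset of \<open>a\<close> is an element of \<open>y\<close>.\<close>

definition pow_fm :: fm where "pow_fm = All (Imp (Sub 0 2) (Mem 0 1))"

declare (in kp_powerset) num.simps [simp del]

context kp_powerset begin

section \<open>Codes of terms in the structure\<close>

primrec tc :: "'a trm \<Rightarrow> 'a" where
  "tc (Par b) = pr (num 0) b"
| "tc New = pr (num 1) emp"
| "tc (Wit n t) = pr (num 2) (pr (num n) (tc t))"
| "tc (Ext s t) = pr (num 3) (pr (tc s) (tc t))"

lemma tc_inj[simp]: "tc s = tc t \<longleftrightarrow> s = t"
proof (induction s arbitrary: t)
  case (Par x)
  then show ?case by (cases t) auto
next
  case New
  then show ?case by (cases t) auto
next
  case (Wit x1 s)
  then show ?case by (cases t) auto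
next
  case (Ext s1 s2)
  then show ?case by (cases t) auto
qed

definition ist :: "'a \<Rightarrow> bool" where "ist x \<longleftrightarrow> (\<exists>t. x = tc t)"

lemma ist_tc[simp]: "ist (tc t)" by (auto simp: ist_def)

lemma SS_ist: "tmd s \<Longrightarrow> SS (\<lambda>e. ist (s e))"
proof (rule SS_app1[of ist])
  define J where "J x t \<longleftrightarrow> ((\<exists>b. x = pr (num 0) b) \<or> x = pr (num 1) emp) \<and> t = emp \<or>
    (\<exists>n a. isnum n \<and> x = pr (num 2) (pr n a) \<and> t = upr a a) \<or> (\<exists>a b. x = pr (num 3) (pr a b) \<and> t = upr a b)" for x t
  show "SS (\<lambda>e. ist (e 0))"
  proof (rule SS_lfpI)
    show "SS (\<lambda>e. J (e 0) (e 1))" unfolding J_def by (intro SS_intros SS_isnum)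
    show "ist x" if J: "J x t" and IH: "\<And>y. E y t \<Longrightarrow> ist y" for x t
    proof -
      consider b where "x = pr (num 0) b" | "x = pr (num 1) emp" | n a where "isnum n" "x = pr (num 2) (pr n a)" "t = upr a a"
        | a b where "x = pr (num 3) (pr a b)" "t = upr a b"
        using J unfolding J_def by blast
      then show ?thesis
      proof cases
        case 1
        then have "x = tc (Par b)" by simp
        then show ?thesis unfolding ist_def by blast
      next
        case 2
        then have "x = tc New" by simp
        then show ?thesis unfolding ist_def by blast
      next
        case 3
        then have "ist a" using IH by simp
        then obtain m s where "a = tc s" "n = num m" using 3(1) unfolding ist_def isnum_def by blast
        then have "x = tc (Wit m s)" using 3 by simp
        then show ?thesis unfolding ist_def by blast
      next
        case 4
        then have "ist a" "ist b" using IH by simp_all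
        then obtain s s' where "a = tc s" "b = tc s'" unfolding ist_def by blast
        then have "x = tc (Ext s s')" using 4 by simp
        then show ?thesis unfolding ist_def by blast
      qed
    qed
    have "lfpJ J (tc t)" for t
    proof (induction t)
      case (Par b)
      show ?case by (rule lfpJ.lfpJ[of _ _ emp]) (auto simp: J_def)
    next
      case New
      show ?case by (rule lfpJ.lfpJ[of _ _ emp]) (auto simp: J_def)
    next
      case (Wit n t)
      show ?case by (rule lfpJ.lfpJ[of _ _ "upr (tc t) (tc t)"]) (use Wit in \<open>auto simp: J_def\<close>)
    next
      case (Ext s t)
      show ?case by (rule lfpJ.lfpJ[of _ _ "upr (tc s) (tc t)"]) (use Ext in \<open>auto simp: J_def\<close>)
    qed
    then show "lfpJ J x" if "ist x" for x using that unfolding ist_def by blast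
  qed
qed

definition islk :: "'a \<Rightarrow> 'a \<Rightarrow> 'a \<Rightarrow> bool" where
  "islk i x y \<longleftrightarrow> (\<exists>n t s. i = num n \<and> x = tc t \<and> y = tc s \<and> lkp n t s)"

lemma SS_islk: "tmd s \<Longrightarrow> tmd t \<Longrightarrow> tmd v \<Longrightarrow> SS (\<lambda>e. islk (s e) (t e) (v e))"
proof -
  assume stv: "tmd s" "tmd t" "tmd v"
  define J where "J x t \<longleftrightarrow> (\<exists>a b. ist a \<and> ist b \<and> x = pr (num 0) (pr (pr (num 3) (pr a b)) a) \<and> t = emp)
     \<or> (\<exists>i a b r. ist a \<and> x = pr (ins i i) (pr (pr (num 3) (pr a b)) r) \<and> t = upr (pr i (pr b r)) (pr i (pr b r)))" for x t
  define I where "I x \<longleftrightarrow> (\<exists>n t s. x = pr (num n) (pr (tc t) (tc s)) \<and> lkp n t s)" for x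
  have "SS (\<lambda>e. I (e 0))"
  proof (rule SS_lfpI)
    show "SS (\<lambda>e. J (e 0) (e 1))" unfolding J_def by (intro SS_intros SS_ist)
    show "I x" if J: "J x t" and IH: "\<And>y. E y t \<Longrightarrow> I y" for x t
    proof -
      consider a b where "ist a" "ist b" "x = pr (num 0) (pr (pr (num 3) (pr a b)) a)" | 
        i a b r where "ist a" "x = pr (ins i i) (pr (pr (num 3) (pr a b)) r)" "t = upr (pr i (pr b r)) (pr i (pr b r))"
        using J unfolding J_def by blast
      then show ?thesis
      proof cases
        case 1
        then obtain s s' where "a = tc s" "b = tc s'" unfolding ist_def by blast
        then have "x = pr (num 0) (pr (tc (Ext s s')) (tc s))" using 1 by simp
        then show ?thesis unfolding I_def using lkp_0 by blast
      next
        case 2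
        then have "I (pr i (pr b r))" using IH by simp
        then obtain n s s' where *: "i = num n" "b = tc s" "r = tc s'" "lkp n s s'" unfolding I_def by auto
        obtain a' where "a = tc a'" using 2(1) unfolding ist_def by blast
        then have "x = pr (num (Suc n)) (pr (tc (Ext a' s)) (tc s'))" using 2 * by (simp add: num.simps)
        then show ?thesis unfolding I_def using lkp_Suc[OF *(4)] by blast
      qed
    qed
    have "lfpJ J (pr (num n) (pr (tc t) (tc s)))" if "lkp n t s" for n t s
      using that
    proof induction
      case (lkp_0 s t)
      show ?case by (rule lfpJ.lfpJ[of _ _ emp]) (auto simp: J_def)
    next
      case (lkp_Suc i t r s)
      let ?t = "pr (num i) (pr (tc t) (tc r))"
      show ?case by (rule lfpJ.lfpJ[of _ _ "upr ?t ?t"]) (use lkp_Suc in \<open>auto simp: J_def num.simps\<close>)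
    qed
    then show "lfpJ J x" if "I x" for x using that unfolding I_def by blast
  qed
  from SS_app1[of I, OF this, of "\<lambda>e. pr (s e) (pr (t e) (v e))"] stv
  show ?thesis unfolding I_def islk_def by (simp add: tmd_pr)
qed

text \<open>A literal consists of a sign (1 positive, 0 negative), the number of a formula and an
  environment.\<close>

abbreviation "lt b x e \<equiv> pr (num b) (pr x e)"

abbreviation pos :: "nat \<Rightarrow> 'a trm \<Rightarrow> 'a" where "pos n t \<equiv> lt 1 (num n) (tc t)"
abbreviation neg :: "nat \<Rightarrow> 'a trm \<Rightarrow> 'a" where "neg n t \<equiv> lt 0 (num n) (tc t)"

abbreviation "cl1 x \<equiv> ins x emp"
abbreviation "cl2 x y \<equiv> ins x (ins y emp)"
abbreviation "cl3 x y z \<equiv> ins x (ins y (ins z emp))"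
abbreviation "cl4 x y z w \<equiv> ins x (ins y (ins z (ins w emp)))"

text \<open>Literals and clauses are elements of the structure, so that the literals of a clause can be
  quantified over by a bounded quantifier. \<open>cl_par\<close> and \<open>cl_omit\<close> make the model an extension in
  which the elements of \<open>a\<close> are named by the old ones.\<close>

definition cl_fls :: "'a \<Rightarrow> bool" where
  "cl_fls C \<longleftrightarrow> (\<exists>t. C = cl1 (neg (prod_encode (2, 0)) t))"

definition cl_imp :: "'a \<Rightarrow> bool" where
  "cl_imp C \<longleftrightarrow> (\<exists>p q t. C = cl3 (neg (atm 3 p q) t) (neg p t) (pos q t) \<or>
     C = cl2 (pos (atm 3 p q) t) (pos p t) \<or> C = cl2 (pos (atm 3 p q) t) (neg q t))"

text \<open>The first kind is instantiation; the second is the Henkin axiom making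
  \<open>Wit p t\<close> a counterexample if there is one.\<close>

definition cl_all :: "'a \<Rightarrow> bool" where
  "cl_all C \<longleftrightarrow> (\<exists>p s t. C = cl2 (neg (prod_encode (4, p)) t) (pos p (Ext s t)) \<or>
     C = cl2 (pos (prod_encode (4, p)) t) (neg p (Ext (Wit p t) t)))"

text \<open>Reduces atomic formulae in arbitrary environments to one canonical form in a two-element
  environment, so that the remaining clauses about membership and equality can be stated for pairs
  of terms.\<close>

definition cl_atom :: "nat \<Rightarrow> 'a \<Rightarrow> bool" where
  "cl_atom k C \<longleftrightarrow> (\<exists>i j t r s. lkp i t r \<and> lkp j t s \<and>
     (C = cl2 (neg (atm k i j) t) (pos (atm k 0 1) (pairt r s)) \<or>
      C = cl2 (pos (atm k i j) t) (neg (atm k 0 1) (pairt r s))))"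

text \<open>Reflexivity and the Euclidean law, which together give symmetry and transitivity, and
  congruence for membership.\<close>

definition cl_eq :: "'a \<Rightarrow> bool" where
  "cl_eq C \<longleftrightarrow> (\<exists>r s t v. C = cl1 (pos (atm 1 0 1) (pairt t t)) \<or>
     C = cl3 (neg (atm 1 0 1) (pairt s t)) (neg (atm 1 0 1) (pairt s r)) (pos (atm 1 0 1) (pairt t r)) \<or>
     C = cl4 (neg (atm 1 0 1) (pairt r s)) (neg (atm 1 0 1) (pairt t v)) (neg (atm 0 0 1) (pairt r t)) (pos (atm 0 0 1) (pairt s v)))"

definition cl_ax :: "nat set \<Rightarrow> 'a \<Rightarrow> bool" where
  "cl_ax A C \<longleftrightarrow> (\<exists>n\<in>A. C = cl1 (pos n New))"

text \<open>Only the first kind depends on \<open>u\<close>, and it does so monotonically;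
  \<open>clause_mono\<close> rests on this. The last kind makes \<open>pw a\<close> bound the
  subsets of \<open>a\<close> in the extension.\<close>

definition cl_par :: "'a \<Rightarrow> 'a \<Rightarrow> bool" where
  "cl_par u C \<longleftrightarrow> (\<exists>a b. E b u \<and> C = cl1 (pos (atm 0 0 1) (pairt (Par b) New)) \<or>
     E b a \<and> C = cl1 (pos (atm 0 0 1) (pairt (Par b) (Par a))) \<or>
     a \<noteq> b \<and> C = cl1 (neg (atm 1 0 1) (pairt (Par a) (Par b))) \<or>
     b = pw a \<and> C = cl1 (pos (code pow_fm) (pairt (Par b) (Par a))))"

definition cl_omit :: "'a \<Rightarrow> bool" where
  "cl_omit C \<longleftrightarrow> (\<exists>a t. \<forall>x. E x C \<longleftrightarrow> x = neg (atm 0 0 1) (pairt t (Par a)) \<or>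
      (\<exists>b. E b a \<and> x = pos (atm 1 0 1) (pairt t (Par b))))"

lemma SS_cl_fls: "SS (\<lambda>e. cl_fls (e 0))"
proof -
  have "cl_fls C \<longleftrightarrow> (\<exists>e. ist e \<and> C = cl1 (lt 0 (num (prod_encode (2, 0))) e))" for C
    unfolding cl_fls_def ist_def by blast
  then show ?thesis by (simp only:) (intro SS_intros SS_ist)
qed

lemma SS_cl_imp: "SS (\<lambda>e. cl_imp (e 0))"
proof -
  have "cl_imp C \<longleftrightarrow> (\<exists>p q y x e. ispe p q y \<and> ispe (num 3) y x \<and> ist e \<and> 
     (C = cl3 (lt 0 x e) (lt 0 p e) (lt 1 q e) \<or> C = cl2 (lt 1 x e) (lt 1 p e) \<or> C = cl2 (lt 1 x e) (lt 0 q e)))" (is "?l \<longleftrightarrow> ?r") for C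
  proof
    assume ?l
    then obtain p q t where "C = cl3 (neg (atm 3 p q) t) (neg p t) (pos q t) \<or>
     C = cl2 (pos (atm 3 p q) t) (pos p t) \<or> C = cl2 (pos (atm 3 p q) t) (neg q t)" unfolding cl_imp_def by blast
    then show ?r unfolding ispe_def
      by (intro exI[of _ "num p"] exI[of _ "num q"] exI[of _ "num (prod_encode (p, q))"] exI[of _ "num (atm 3 p q)"] exI[of _ "tc t"]) auto
  next
    assume ?r
    then show ?l unfolding ispe_def ist_def cl_imp_def by (elim exE conjE) (simp, blast)
  qed
  then show ?thesis by (simp only:) (intro SS_intros SS_ist SS_ispe)
qed

lemma SS_cl_all: "SS (\<lambda>e. cl_all (e 0))"
proof -
  have "cl_all C \<longleftrightarrow> (\<exists>p x a e. ispe (num 4) p x \<and> ist a \<and> ist e \<and> 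
     (C = cl2 (lt 0 x e) (lt 1 p (pr (num 3) (pr a e))) \<or> C = cl2 (lt 1 x e) (lt 0 p (pr (num 3) (pr (pr (num 2) (pr p e)) e)))))" (is "?l \<longleftrightarrow> ?r") for C
  proof
    assume ?l
    then obtain p s t where "C = cl2 (neg (prod_encode (4, p)) t) (pos p (Ext s t)) \<or>
     C = cl2 (pos (prod_encode (4, p)) t) (neg p (Ext (Wit p t) t))" unfolding cl_all_def by blast
    then show ?r unfolding ispe_def
      by (intro exI[of _ "num p"] exI[of _ "num (prod_encode (4, p))"] exI[of _ "tc s"] exI[of _ "tc t"]) auto
  next
    assume ?r
    then obtain m s t where "C = cl2 (neg (prod_encode (4, m)) t) (pos m (Ext s t)) \<or>
     C = cl2 (pos (prod_encode (4, m)) t) (neg m (Ext (Wit m t) t))" 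
      unfolding ispe_def ist_def by (elim exE conjE) simp
    then show ?l unfolding cl_all_def by blast
  qed
  then show ?thesis by (simp only:) (intro SS_intros SS_ist SS_ispe)
qed

lemma SS_cl_atom: "SS (\<lambda>e. cl_atom k (e 0))"
proof -
  have "cl_atom k C \<longleftrightarrow> (\<exists>i j y x e r s. ispe i j y \<and> ispe (num k) y x \<and> islk i e r \<and> islk j e s \<and> 
     (C = cl2 (lt 0 x e) (lt 1 (num (atm k 0 1)) (pr (num 3) (pr r (pr (num 3) (pr s (tc New)))))) \<or>
      C = cl2 (lt 1 x e) (lt 0 (num (atm k 0 1)) (pr (num 3) (pr r (pr (num 3) (pr s (tc New))))))))" (is "?l \<longleftrightarrow> ?r") for C
  proof
    assume ?l
    then obtain i j t r s where *: "lkp i t r" "lkp j t s"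
     "C = cl2 (neg (atm k i j) t) (pos (atm k 0 1) (pairt r s)) \<or>
      C = cl2 (pos (atm k i j) t) (neg (atm k 0 1) (pairt r s))" unfolding cl_atom_def by blast
    have "ispe (num i) (num j) (num (prod_encode (i, j)))" "ispe (num k) (num (prod_encode (i, j))) (num (atm k i j))"
      "islk (num i) (tc t) (tc r)" "islk (num j) (tc t) (tc s)"
      unfolding ispe_def islk_def using *(1,2) by blast+
    moreover note *(3)[unfolded tc.simps(4)]
    ultimately show ?r by (intro exI conjI)
  next
    assume ?r
    then obtain i j t r s where "lkp i t r" "lkp j t s"
     "C = cl2 (neg (atm k i j) t) (pos (atm k 0 1) (pairt r s)) \<or>
      C = cl2 (pos (atm k i j) t) (neg (atm k 0 1) (pairt r s))"
      unfolding ispe_def islk_def by (elim exE conjE) simp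
    then show ?l unfolding cl_atom_def by blast
  qed
  then show ?thesis by (simp only:) (intro SS_intros SS_islk SS_ispe)
qed

lemma SS_cl_eq: "SS (\<lambda>e. cl_eq (e 0))"
proof -
  have "cl_eq C \<longleftrightarrow> (\<exists>r s t v. ist r \<and> ist s \<and> ist t \<and> ist v \<and> 
    (C = cl1 (lt 1 (num (atm 1 0 1)) (pr (num 3) (pr t (pr (num 3) (pr t (tc New)))))) \<or>
     C = cl3 (lt 0 (num (atm 1 0 1)) (pr (num 3) (pr s (pr (num 3) (pr t (tc New))))))
             (lt 0 (num (atm 1 0 1)) (pr (num 3) (pr s (pr (num 3) (pr r (tc New))))))
             (lt 1 (num (atm 1 0 1)) (pr (num 3) (pr t (pr (num 3) (pr r (tc New)))))) \<or>
     C = cl4 (lt 0 (num (atm 1 0 1)) (pr (num 3) (pr r (pr (num 3) (pr s (tc New))))))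
             (lt 0 (num (atm 1 0 1)) (pr (num 3) (pr t (pr (num 3) (pr v (tc New))))))
             (lt 0 (num (atm 0 0 1)) (pr (num 3) (pr r (pr (num 3) (pr t (tc New))))))
             (lt 1 (num (atm 0 0 1)) (pr (num 3) (pr s (pr (num 3) (pr v (tc New))))))))" (is "?l \<longleftrightarrow> ?r") for C
  proof
    assume ?l
    then obtain r s t v where "C = cl1 (pos (atm 1 0 1) (pairt t t)) \<or>
     C = cl3 (neg (atm 1 0 1) (pairt s t)) (neg (atm 1 0 1) (pairt s r)) (pos (atm 1 0 1) (pairt t r)) \<or>
     C = cl4 (neg (atm 1 0 1) (pairt r s)) (neg (atm 1 0 1) (pairt t v)) (neg (atm 0 0 1) (pairt r t)) (pos (atm 0 0 1) (pairt s v))"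
      unfolding cl_eq_def by (elim exE)
    note * = this[unfolded tc.simps(4)]
    show ?r using ist_tc[of r] ist_tc[of s] ist_tc[of t] ist_tc[of v] * by (intro exI conjI)
  next
    assume ?r
    then obtain r s t v where "ist r" "ist s" "ist t" "ist v" and *:
      "C = cl1 (lt 1 (num (atm 1 0 1)) (pr (num 3) (pr t (pr (num 3) (pr t (tc New)))))) \<or>
     C = cl3 (lt 0 (num (atm 1 0 1)) (pr (num 3) (pr s (pr (num 3) (pr t (tc New))))))
             (lt 0 (num (atm 1 0 1)) (pr (num 3) (pr s (pr (num 3) (pr r (tc New))))))
             (lt 1 (num (atm 1 0 1)) (pr (num 3) (pr t (pr (num 3) (pr r (tc New)))))) \<or>
     C = cl4 (lt 0 (num (atm 1 0 1)) (pr (num 3) (pr r (pr (num 3) (pr s (tc New))))))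
             (lt 0 (num (atm 1 0 1)) (pr (num 3) (pr t (pr (num 3) (pr v (tc New))))))
             (lt 0 (num (atm 0 0 1)) (pr (num 3) (pr r (pr (num 3) (pr t (tc New))))))
             (lt 1 (num (atm 0 0 1)) (pr (num 3) (pr s (pr (num 3) (pr v (tc New))))))"
      by (elim exE conjE)
    moreover obtain r' s' t' v' where "r = tc r'" "s = tc s'" "t = tc t'" "v = tc v'"
      using calculation(1-4) unfolding ist_def by blast
    ultimately show ?l unfolding cl_eq_def 
      by (intro exI[of _ r'] exI[of _ s'] exI[of _ t'] exI[of _ v']) (simp only: tc.simps(4))
  qed
  then show ?thesis by (simp only:) (intro SS_intros SS_ist)
qed

lemma SS_cl_ax:
  assumes "re_set A" shows "SS (\<lambda>e. cl_ax A (e 0))"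
proof -
  have "cl_ax A C \<longleftrightarrow> (\<exists>x. (\<exists>n\<in>A. x = num n) \<and> C = cl1 (lt 1 x (tc New)))" for C
    unfolding cl_ax_def by blast
  then show ?thesis by (simp only:) (intro SS_intros SS_re_set[OF assms])
qed

lemma SS_cl_par: "SS (\<lambda>e. cl_par (e 0) (e 1))"
  unfolding cl_par_def tc.simps by (intro SS_intros SS_pw)

text \<open>The clause is not a term with a definable graph at hand, so its description is split
  into two inclusions: one quantifies over the clause, the other over \<open>a\<close>, both
  boundedly.\<close>

lemma SS_cl_omit: "SS (\<lambda>e. cl_omit (e 0))"
proof -
  have "cl_omit C \<longleftrightarrow> (\<exists>a t. ist t \<and> 
    (\<forall>x. E x C \<longrightarrow> x = lt 0 (num (atm 0 0 1)) (pr (num 3) (pr t (pr (num 3) (pr (pr (num 0) a) (tc New))))) \<or>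
      (\<exists>b. E b a \<and> x = lt 1 (num (atm 1 0 1)) (pr (num 3) (pr t (pr (num 3) (pr (pr (num 0) b) (tc New))))))) \<and>
    E (lt 0 (num (atm 0 0 1)) (pr (num 3) (pr t (pr (num 3) (pr (pr (num 0) a) (tc New)))))) C \<and>
    (\<forall>b. E b a \<longrightarrow> E (lt 1 (num (atm 1 0 1)) (pr (num 3) (pr t (pr (num 3) (pr (pr (num 0) b) (tc New)))))) C))" for C
    unfolding cl_omit_def ist_def tc.simps(1,4) by blast
  then show ?thesis by (simp only:) (intro SS_intros SS_ball SS_bex SS_ist)
qed

definition clause :: "nat set \<Rightarrow> 'a \<Rightarrow> 'a \<Rightarrow> bool" where
  "clause A u C \<longleftrightarrow> cl_fls C \<or> cl_imp C \<or> cl_all C \<or> cl_atom 0 C \<or> cl_atom 1 C \<or> cl_eq C \<or> cl_ax A C \<or> cl_par u C \<or> cl_omit C"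

lemma SS_clause: "re_set A \<Longrightarrow> SS (\<lambda>e. clause A (e 0) (e 1))"
  unfolding clause_def
  by (intro SS_disj SS_app1[OF SS_cl_fls] SS_app1[OF SS_cl_imp] SS_app1[OF SS_cl_all] SS_app1[OF SS_cl_atom]
    SS_app1[OF SS_cl_eq] SS_app1[OF SS_cl_ax] SS_cl_par SS_app1[OF SS_cl_omit] tmd_var)

lemma clause_mono: "clause A u C \<Longrightarrow> (\<And>x. E x u \<Longrightarrow> E x v) \<Longrightarrow> clause A v C"
  unfolding clause_def cl_par_def by blast

text \<open>\<open>ref A u c\<close>: the set of literals \<open>c\<close> is refuted, using only axioms \<open>b \<in> d\<close> with \<open>b \<in> u\<close>.\<close>

inductive ref :: "nat set \<Rightarrow> 'a \<Rightarrow> 'a \<Rightarrow> bool" for A u where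
  ref_contra: "E (pos n t) c \<Longrightarrow> E (neg n t) c \<Longrightarrow> ref A u c"
| ref_clause: "clause A u C \<Longrightarrow> (\<And>l. E l C \<Longrightarrow> ref A u (ins l c)) \<Longrightarrow> ref A u c"

lemma ref_mono: "ref A u c \<Longrightarrow> (\<And>x. E x u \<Longrightarrow> E x v) \<Longrightarrow> ref A v c"
proof (induction rule: ref.induct)
  case (ref_contra n t c)
  then show ?case by (blast intro: ref.ref_contra)
next
  case (ref_clause C c)
  show ?case by (rule ref.ref_clause[of _ _ C]) (use ref_clause clause_mono in blast)+
qed

lemma SS_ref:
  assumes "re_set A" shows "SS (\<lambda>e. ref A (e 0) (e 1))"
proof -
  define J where "J x t \<longleftrightarrow> (\<exists>u c. x = pr u c \<and> 
     ((\<exists>n a. isnum n \<and> ist a \<and> E (lt 1 n a) c \<and> E (lt 0 n a) c \<and> t = emp) \<or>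
      (\<exists>C. clause A u C \<and> (\<forall>l. E l C \<longrightarrow> E (pr u (ins l c)) t) \<and> (\<forall>p. E p t \<longrightarrow> (\<exists>l. E l C \<and> p = pr u (ins l c))))))" for x t
  define I where "I x \<longleftrightarrow> (\<exists>u c. x = pr u c \<and> ref A u c)" for x
  have "SS (\<lambda>e. I (e 0))"
  proof (rule SS_lfpI)
    show "SS (\<lambda>e. J (e 0) (e 1))" unfolding J_def 
      by (intro SS_intros SS_isnum SS_ist SS_ball SS_bex SS_app2[of "clause A", OF SS_clause[OF assms]])
    show "I x" if J: "J x t" and IH: "\<And>y. E y t \<Longrightarrow> I y" for x t
    proof -
      obtain u c where x: "x = pr u c" and "(\<exists>n a. isnum n \<and> ist a \<and> E (lt 1 n a) c \<and> E (lt 0 n a) c) \<or>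
        (\<exists>C. clause A u C \<and> (\<forall>l. E l C \<longrightarrow> E (pr u (ins l c)) t))"
        using J unfolding J_def by blast
      then consider n a where "E (pos n a) c" "E (neg n a) c" 
        | C where "clause A u C" "\<And>l. E l C \<Longrightarrow> E (pr u (ins l c)) t"
        unfolding isnum_def ist_def by blast
      then have "ref A u c"
      proof cases
        case 1
        then show ?thesis by (rule ref_contra)
      next
        case 2
        have "ref A u (ins l c)" if "E l C" for l
          using IH[OF 2(2)[OF that]] unfolding I_def by simp
        then show ?thesis using 2(1) ref_clause by blast
      qed
      then show ?thesis unfolding I_def using x by blast
    qed
    have "lfpJ J (pr u c)" if "ref A u c" for u c
      using that
    proof induction
      case (ref_contra n t c)
      then have "J (pr u c) emp" unfolding J_def by (intro exI conjI disjI1) (auto simp: isnum_def ist_def)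
      then show ?case by (rule lfpJ.lfpJ) simp
    next
      case (ref_clause C c)
      have "SP (\<lambda>e. \<exists>q. q = ins (e 0) c \<and> e 1 = pr u q)"
        by (intro SP_ex SP_conj tmd_graph[OF tmd_const] tmd_graph[OF tmd_ins[OF tmd_var tmd_const], of _ "\<lambda>e. e"]
          tmd_graph[OF tmd_pr[OF tmd_const tmd_var], of _ "\<lambda>e. e"] tm_var)
      then have "SP (\<lambda>e. (\<lambda>l p. p = pr u (ins l c)) (e 0) (e 1))" by simp
      from SP_collection[of "\<lambda>l p. p = pr u (ins l c)", OF this, of C]
      obtain t where t: "\<forall>l. E l C \<longrightarrow> (\<exists>p. E p t \<and> p = pr u (ins l c))" "\<forall>p. E p t \<longrightarrow> (\<exists>l. E l C \<and> p = pr u (ins l c))"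
        by blast
      then have "J (pr u c) t" unfolding J_def using ref_clause(1) by blast
      then show ?case by (rule lfpJ.lfpJ) (use t(2) ref_clause in blast)
    qed
    then show "lfpJ J x" if "I x" for x using that unfolding I_def by blast
  qed
  from SS_app1[of I, OF this, of "\<lambda>e. pr (e 0) (e 1)"]
  show ?thesis unfolding I_def by (simp add: tmd_pr tmd_var)
qed

text \<open>With all \<open>u\<close> excluded at once, a clause may be treated at any stage
  whatever bound it needs.\<close>

definition consistent :: "nat set \<Rightarrow> 'a \<Rightarrow> bool" where
  "consistent A c \<longleftrightarrow> (\<forall>u. \<not> ref A u c)"

text \<open>By collection, refutations of all \<open>c \<union> {l}\<close> with \<open>l \<in> C\<close> can be given with the same \<open>u\<close>.\<close>

lemma consistent_extend:
  assumes "re_set A" "consistent A c" "clause A u C"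
  shows "\<exists>l. E l C \<and> consistent A (ins l c)"
proof (rule ccontr)
  assume "\<not> ?thesis"
  then have *: "\<exists>v. ref A v (ins l c)" if "E l C" for l using that unfolding consistent_def by blast
  have "SS (\<lambda>e. (\<lambda>l v. ref A v (ins l c)) (e 0) (e 1))"
    using SS_app2[of "ref A", OF SS_ref[OF assms(1)] tmd_var tmd_ins[OF tmd_var tmd_const]] by simp
  from SS_collection[of "\<lambda>l v. ref A v (ins l c)", OF this, of C] *
  obtain W where W: "\<And>l. E l C \<Longrightarrow> \<exists>v. E v W \<and> ref A v (ins l c)" by blast
  \<comment> \<open>The union of \<open>u\<close> and of all bounds collected in \<open>W\<close>;
    it is large enough for the clause and for every branch.\<close>
  let ?w = "un (ins u W)"
  have "ref A ?w (ins l c)" if l: "E l C" for l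
  proof -
    obtain v where v: "E v W" "ref A v (ins l c)" using W[OF l] by blast
    show ?thesis by (rule ref_mono[OF v(2)]) (use v(1) in auto)
  qed
  moreover have "clause A ?w C" by (rule clause_mono[OF assms(3)]) auto
  ultimately have "ref A ?w c" by (blast intro: ref_clause)
  then show False using assms(2) unfolding consistent_def by blast
qed

end

section \<open>Soundness of refutations, and the term model\<close>

text \<open>Numbers that are not codes decode to formulae with subformulae \<open>Fls\<close>, so that the clauses below
  are sound for arbitrary numbers.\<close>

function dec :: "nat \<Rightarrow> fm" where
  "dec n = (case prod_decode n of (k, x) \<Rightarrow>
     if k = 0 then (case prod_decode x of (i, j) \<Rightarrow> Mem i j)
     else if k = 1 then (case prod_decode x of (i, j) \<Rightarrow> Eq i j)
     else if k = 3 then (case prod_decode x of (p, q) \<Rightarrow> Imp (dec p) (dec q))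
     else if k = 4 then All (dec x) else Fls)"
  by auto
termination
proof (relation "measure id")
  have less: "x < prod_encode (k, x)" if "k > 0" for k x
    using that le_prod_encode_2[of x "k - 1"] unfolding prod_encode_def by (cases k) auto
  have n: "n = prod_encode (k, x)" if "(k, x) = prod_decode n" for k x n
    using that by (metis prod_decode_inverse)
  fix n k x p q :: nat
  assume kx: "(k, x) = prod_decode n" and "k \<noteq> 0"
  then have x: "x < n" using less[of k x] n[OF kx] by simp
  then show "(x, n) \<in> measure id" by simp
  assume "(p, q) = prod_decode x"
  from n[OF this] have "p \<le> x" "q \<le> x" using le_prod_encode_1[of p q] le_prod_encode_2[of q p] by simp_all
  then show "(p, n) \<in> measure id" "(q, n) \<in> measure id" using x by simp_all
qed simp

declare dec.simps [simp del]

lemma dec_prod_encode[simp]: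
  "dec (prod_encode (0, prod_encode (i, j))) = Mem i j"
  "dec (prod_encode (1, prod_encode (i, j))) = Eq i j"
  "dec (prod_encode (2, x)) = Fls"
  "dec (prod_encode (3, prod_encode (p, q))) = Imp (dec p) (dec q)"
  "dec (prod_encode (4, p)) = All (dec p)"
  by (subst dec.simps, simp)+

lemma dec_code[simp]: "dec (code \<phi>) = \<phi>"
proof (induction \<phi>)
  case (Eq i j)
  show ?case by (simp only: code.simps dec_prod_encode)
qed simp_all

context kp_powerset begin

text \<open>The value of a tree as a term and as an environment, with \<open>d\<close> as default.\<close>

primrec vv :: "'a \<Rightarrow> 'a trm \<Rightarrow> 'a \<times> (nat \<Rightarrow> 'a)" where
  "vv d (Par b) = (b, \<lambda>_. d)"
| "vv d New = (d, \<lambda>_. d)"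
| "vv d (Wit n t) = (SOME b. \<not> sat \<S> (case_nat b (snd (vv d t))) (dec n), \<lambda>_. d)"
| "vv d (Ext s t) = (d, case_nat (fst (vv d s)) (snd (vv d t)))"

definition holds :: "'a \<Rightarrow> nat \<Rightarrow> 'a trm \<Rightarrow> bool" where
  "holds d n t \<longleftrightarrow> sat \<S> (snd (vv d t)) (dec n)"

definition tr :: "'a \<Rightarrow> 'a \<Rightarrow> bool" where
  "tr d x \<longleftrightarrow> (\<exists>n t. x = pos n t \<and> holds d n t \<or> x = neg n t \<and> \<not> holds d n t)"

lemma tr_simps[simp]: "tr d (pos n t) \<longleftrightarrow> holds d n t" "tr d (neg n t) \<longleftrightarrow> \<not> holds d n t"
  unfolding tr_def by auto

lemma lkp_vv: "lkp n t s \<Longrightarrow> snd (vv d t) n = fst (vv d s)"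
  by (induction rule: lkp.induct) simp_all

lemma holds_simps[simp]:
  "\<not> holds d (prod_encode (2, x)) t"
  "holds d (atm 3 p q) t \<longleftrightarrow> (holds d p t \<longrightarrow> holds d q t)"
  "holds d (prod_encode (4, p)) t \<longleftrightarrow> (\<forall>b. sat \<S> (case_nat b (snd (vv d t))) (dec p))"
  "holds d (atm 0 i j) t \<longleftrightarrow> E (snd (vv d t) i) (snd (vv d t) j)"
  "holds d (atm 1 i j) t \<longleftrightarrow> snd (vv d t) i = snd (vv d t) j"
  by (simp_all only: holds_def dec_prod_encode sat.simps) simp_all

lemma clause_sound:
  assumes "clause A u C" and A: "\<And>n. n \<in> A \<Longrightarrow> sat \<S> (\<lambda>_. d) (dec n)" and d: "\<And>b. E b u \<Longrightarrow> E b d"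
  shows "\<exists>l. E l C \<and> tr d l"
proof -
  consider "cl_fls C" | "cl_imp C" | "cl_all C" | "cl_atom 0 C" | "cl_atom 1 C" | "cl_eq C" | "cl_ax A C" |
     "cl_par u C" | "cl_omit C" using assms(1) unfolding clause_def by blast
  then show ?thesis
  proof cases
    case 1
    then obtain t where "C = cl1 (neg (prod_encode (2, 0)) t)" unfolding cl_fls_def by blast
    then show ?thesis by (intro exI[of _ "neg (prod_encode (2, 0)) t"] conjI) simp_all
  next
    case 2
    then obtain p q t where "C = cl3 (neg (atm 3 p q) t) (neg p t) (pos q t) \<or>
     C = cl2 (pos (atm 3 p q) t) (pos p t) \<or> C = cl2 (pos (atm 3 p q) t) (neg q t)"
      unfolding cl_imp_def by blast
    moreover have "tr d (neg (atm 3 p q) t) \<or> tr d (neg p t) \<or> tr d (pos q t)"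
      "tr d (pos (atm 3 p q) t) \<or> tr d (pos p t)" "tr d (pos (atm 3 p q) t) \<or> tr d (neg q t)" 
      unfolding tr_simps holds_simps by blast+
    ultimately show ?thesis by (elim disjE) (auto simp del: tr_simps)
  next
    case 3
    then obtain p s t where "C = cl2 (neg (prod_encode (4, p)) t) (pos p (Ext s t)) \<or>
     C = cl2 (pos (prod_encode (4, p)) t) (neg p (Ext (Wit p t) t))" unfolding cl_all_def by blast
    moreover have "tr d (neg (prod_encode (4, p)) t) \<or> tr d (pos p (Ext s t))"
      unfolding tr_simps holds_simps by (simp add: holds_def) blast
    moreover have "tr d (pos (prod_encode (4, p)) t) \<or> tr d (neg p (Ext (Wit p t) t))"
    proof (cases "tr d (pos (prod_encode (4, p)) t)")
      case False
      then have "\<exists>b. \<not> sat \<S> (case_nat b (snd (vv d t))) (dec p)" unfolding tr_simps holds_simps by blast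
      from someI_ex[OF this] show ?thesis unfolding tr_simps by (simp add: holds_def)
    qed simp
    ultimately show ?thesis by (elim disjE) (auto simp del: tr_simps)
  next
    case 4
    then obtain i j t r s where *: "lkp i t r" "lkp j t s"
     "C = cl2 (neg (atm 0 i j) t) (pos (atm 0 0 1) (pairt r s)) \<or>
      C = cl2 (pos (atm 0 i j) t) (neg (atm 0 0 1) (pairt r s))" unfolding cl_atom_def by blast
    have "tr d (neg (atm 0 i j) t) \<or> tr d (pos (atm 0 0 1) (pairt r s))"
      "tr d (pos (atm 0 i j) t) \<or> tr d (neg (atm 0 0 1) (pairt r s))"
      unfolding tr_simps holds_simps using lkp_vv[OF *(1)] lkp_vv[OF *(2)] by simp_all
    with *(3) show ?thesis by (elim disjE) (auto simp del: tr_simps)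
  next
    case 5
    then obtain i j t r s where *: "lkp i t r" "lkp j t s"
     "C = cl2 (neg (atm 1 i j) t) (pos (atm 1 0 1) (pairt r s)) \<or>
      C = cl2 (pos (atm 1 i j) t) (neg (atm 1 0 1) (pairt r s))" unfolding cl_atom_def by blast
    have "tr d (neg (atm 1 i j) t) \<or> tr d (pos (atm 1 0 1) (pairt r s))"
      "tr d (pos (atm 1 i j) t) \<or> tr d (neg (atm 1 0 1) (pairt r s))"
      unfolding tr_simps holds_simps using lkp_vv[OF *(1)] lkp_vv[OF *(2)] by simp_all
    with *(3) show ?thesis by (elim disjE) (auto simp del: tr_simps)
  next
    case 6
    then obtain r s t v where "C = cl1 (pos (atm 1 0 1) (pairt t t)) \<or>
     C = cl3 (neg (atm 1 0 1) (pairt s t)) (neg (atm 1 0 1) (pairt s r)) (pos (atm 1 0 1) (pairt t r)) \<or>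
     C = cl4 (neg (atm 1 0 1) (pairt r s)) (neg (atm 1 0 1) (pairt t v)) (neg (atm 0 0 1) (pairt r t)) (pos (atm 0 0 1) (pairt s v))"
      unfolding cl_eq_def by (elim exE)
    moreover have "tr d (pos (atm 1 0 1) (pairt t t))"
      "tr d (neg (atm 1 0 1) (pairt s t)) \<or> tr d (neg (atm 1 0 1) (pairt s r)) \<or> tr d (pos (atm 1 0 1) (pairt t r))"
      "tr d (neg (atm 1 0 1) (pairt r s)) \<or> tr d (neg (atm 1 0 1) (pairt t v)) \<or> tr d (neg (atm 0 0 1) (pairt r t)) \<or> tr d (pos (atm 0 0 1) (pairt s v))"
      unfolding tr_simps holds_simps by auto
    ultimately show ?thesis by (elim disjE) (auto simp del: tr_simps)
  next
    case 7
    then obtain n where "n \<in> A" "C = cl1 (pos n New)" unfolding cl_ax_def by blast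
    moreover have "tr d (pos n New)" using A[OF \<open>n \<in> A\<close>] unfolding tr_simps holds_def by simp
    ultimately show ?thesis by auto
  next
    case 8
    then obtain a b where "E b u \<and> C = cl1 (pos (atm 0 0 1) (pairt (Par b) New)) \<or>
     E b a \<and> C = cl1 (pos (atm 0 0 1) (pairt (Par b) (Par a))) \<or>
     a \<noteq> b \<and> C = cl1 (neg (atm 1 0 1) (pairt (Par a) (Par b))) \<or>
     b = pw a \<and> C = cl1 (pos (code pow_fm) (pairt (Par b) (Par a)))" unfolding cl_par_def by blast
    moreover have "E b u \<Longrightarrow> tr d (pos (atm 0 0 1) (pairt (Par b) New))"
      "E b a \<Longrightarrow> tr d (pos (atm 0 0 1) (pairt (Par b) (Par a)))"
      "a \<noteq> b \<Longrightarrow> tr d (neg (atm 1 0 1) (pairt (Par a) (Par b)))"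
      unfolding tr_simps holds_simps using d by simp_all
    moreover have "tr d (pos (code pow_fm) (pairt (Par b) (Par a)))" if "b = pw a"
      unfolding tr_simps holds_def dec_code pow_fm_def that by (simp add: numeral_2_eq_2)
    ultimately show ?thesis by (elim disjE conjE) (auto simp del: tr_simps)
  next
    case 9
    then obtain a t where C: "\<forall>x. E x C \<longleftrightarrow> x = neg (atm 0 0 1) (pairt t (Par a)) \<or>
      (\<exists>b. E b a \<and> x = pos (atm 1 0 1) (pairt t (Par b)))" unfolding cl_omit_def by blast
    \<comment> \<open>If the value of \<open>t\<close> lies in \<open>a\<close>, that value is
      itself the \<open>b\<close> with \<open>t = b\<close>; otherwise the negative literal is
      true.\<close>
    show ?thesis
    proof (cases "E (fst (vv d t)) a")
      case True
      have "tr d (pos (atm 1 0 1) (pairt t (Par (fst (vv d t)))))"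
        unfolding tr_simps holds_simps by simp
      then show ?thesis using C True by blast
    next
      case False
      then have "tr d (neg (atm 0 0 1) (pairt t (Par a)))"
        unfolding tr_simps holds_simps by simp
      then show ?thesis using C by blast
    qed
  qed
qed

text \<open>Some literal \<open>l\<close> of the clause is true by \<open>clause_sound\<close>; the
  false literal found in the branch \<open>ins l c\<close> differs from \<open>l\<close>, so it lies
  in \<open>c\<close>.\<close>

lemma ref_sound:
  assumes A: "\<And>n. n \<in> A \<Longrightarrow> sat \<S> (\<lambda>_. d) (dec n)" and d: "\<And>b. E b u \<Longrightarrow> E b d" and "ref A u c"
  shows "\<exists>l. E l c \<and> \<not> tr d l"
  using assms(3)
proof induction
  case (ref_contra n t c)
  then show ?case by (cases "holds d n t") (use tr_simps in blast)+
next
  case (ref_clause C c)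
  obtain l where "E l C" "tr d l" using clause_sound[OF ref_clause(1) A d] by blast
  then show ?case using ref_clause(3)[of l] by auto
qed

lemma consistent_emp:
  assumes "\<And>n e. n \<in> A \<Longrightarrow> sat \<S> e (dec n)"
  shows "consistent A emp"
  unfolding consistent_def using ref_sound[of A _ _ emp] assms E_emp by blast

lemma clause_literal:
  assumes "clause A u C" "E l C" shows "\<exists>n t. l = pos n t \<or> l = neg n t"
proof -
  define lit where "lit l \<longleftrightarrow> (\<exists>n t. l = pos n t \<or> l = neg n t)" for l
  have lit: "lit (pos n t)" "lit (neg n t)" for n t unfolding lit_def by blast+
  have "lit l"
    using assms
    unfolding clause_def cl_fls_def cl_imp_def cl_all_def cl_atom_def cl_eq_def cl_ax_def cl_par_def cl_omit_def
    by (elim disjE exE bexE conjE) (auto simp only: E_ins E_emp lit simp_thms)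
  then show ?thesis unfolding lit_def .
qed

text \<open>All elements of the structure are enumerated, and those that are clauses for some
  \<open>u\<close> are met one after the other by adding a literal. Countability is used
  here.\<close>

lemma valuation_exists:
  assumes "countable (UNIV :: 'a set)" and re: "re_set A" and A: "\<And>n e. n \<in> A \<Longrightarrow> sat \<S> e (dec n)"
  shows "\<exists>h. \<forall>u C. clause A u C \<longrightarrow> (\<exists>n t. E (pos n t) C \<and> h n t \<or> E (neg n t) C \<and> \<not> h n t)"
proof -
  define f where "f = from_nat_into (UNIV :: 'a set)"
  have f: "\<exists>n. f n = x" for x
    unfolding f_def using from_nat_into_surj[OF assms(1), of x] by simp
  have "\<exists>c. consistent A (c 0) \<and> (\<forall>n. consistent A (c (Suc n)) \<and> 
    ((\<forall>x. E x (c n) \<longrightarrow> E x (c (Suc n))) \<and> ((\<exists>u. clause A u (f n)) \<longrightarrow> (\<exists>l. E l (f n) \<and> E l (c (Suc n))))))"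
  proof -
    have "\<exists>c. \<forall>n. consistent A (c n) \<and> 
    ((\<forall>x. E x (c n) \<longrightarrow> E x (c (Suc n))) \<and> ((\<exists>u. clause A u (f n)) \<longrightarrow> (\<exists>l. E l (f n) \<and> E l (c (Suc n)))))"
    proof (rule dependent_nat_choice)
      show "\<exists>x. consistent A x" using consistent_emp[OF A] by blast
    next
      fix c n assume c: "consistent A c"
      show "\<exists>y. consistent A y \<and> ((\<forall>x. E x c \<longrightarrow> E x y) \<and> ((\<exists>u. clause A u (f n)) \<longrightarrow> (\<exists>l. E l (f n) \<and> E l y)))"
      proof (cases "\<exists>u. clause A u (f n)")
        case True
        then obtain u where "clause A u (f n)" by blast
        from consistent_extend[OF re c this] obtain l where "E l (f n)" "consistent A (ins l c)" by blast
        then show ?thesis by (intro exI[of _ "ins l c"]) auto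
      next
        case False
        then show ?thesis using c by blast
      qed
    qed
    then show ?thesis by blast
  qed
  then obtain c where c: "\<And>n. consistent A (c n)" "\<And>n x. E x (c n) \<Longrightarrow> E x (c (Suc n))"
    "\<And>n u. clause A u (f n) \<Longrightarrow> \<exists>l. E l (f n) \<and> E l (c (Suc n))" by (metis not0_implies_Suc)
  have mono: "E x (c n)" if "m \<le> n" "E x (c m)" for m n x
    using that by (induction rule: dec_induct) (auto intro: c(2))
  \<comment> \<open>Formulae never decided count as false. A chosen negative literal is still
    respected: a positive counterpart chosen at any stage would make a later set
    contradictory.\<close>
  define h where "h n t \<longleftrightarrow> (\<exists>k. E (pos n t) (c k))" for n t
  have "\<exists>n t. E (pos n t) C \<and> h n t \<or> E (neg n t) C \<and> \<not> h n t" if C: "clause A u C" for u C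
  proof -
    obtain k where k: "f k = C" using f by blast
    obtain l where l: "E l C" "E l (c (Suc k))" using c(3)[of u k] C k by blast
    from clause_literal[OF C l(1)] obtain n t where "l = pos n t \<or> l = neg n t" by blast
    then show ?thesis
    proof
      assume "l = pos n t"
      then show ?thesis using l unfolding h_def by blast
    next
      assume l': "l = neg n t"
      have "\<not> h n t"
      proof
        assume "h n t"
        then obtain m where m: "E (pos n t) (c m)" unfolding h_def by blast
        let ?k = "max m (Suc k)"
        have "E (pos n t) (c ?k)" "E (neg n t) (c ?k)" 
          using mono[OF _ m, of ?k] mono[OF _ l(2), of ?k] l' by simp_all
        then have "ref A emp (c ?k)" by (rule ref_contra)
        then show False using c(1) unfolding consistent_def by blast
      qed
      then show ?thesis using l l' by blast
    qed
  qed
  then show ?thesis by blast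
qed

end

text \<open>What the clauses say about a valuation satisfying them all; the bounds \<open>u\<close>
  and the coding in the structure have disappeared.\<close>

locale term_model =
  fixes E :: "'a \<Rightarrow> 'a \<Rightarrow> bool" and A :: "nat set" and h :: "nat \<Rightarrow> 'a trm \<Rightarrow> bool"
  assumes h_fls: "\<not> h (prod_encode (2, 0)) t"
    and h_imp: "h (atm 3 p q) t \<longleftrightarrow> (h p t \<longrightarrow> h q t)"
    and h_all: "h (prod_encode (4, p)) t \<longleftrightarrow> (\<forall>s. h p (Ext s t))"
    and h_mem: "lkp i t r \<Longrightarrow> lkp j t s \<Longrightarrow> h (atm 0 i j) t \<longleftrightarrow> h (atm 0 0 1) (pairt r s)"
    and h_eq: "lkp i t r \<Longrightarrow> lkp j t s \<Longrightarrow> h (atm 1 i j) t \<longleftrightarrow> h (atm 1 0 1) (pairt r s)"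
    and h_refl: "h (atm 1 0 1) (pairt t t)"
    and h_euclid: "h (atm 1 0 1) (pairt s t) \<Longrightarrow> h (atm 1 0 1) (pairt s r) \<Longrightarrow> h (atm 1 0 1) (pairt t r)"
    and h_cong: "h (atm 1 0 1) (pairt r s) \<Longrightarrow> h (atm 1 0 1) (pairt t v) \<Longrightarrow> h (atm 0 0 1) (pairt r t) \<Longrightarrow> h (atm 0 0 1) (pairt s v)"
    and h_ax: "n \<in> A \<Longrightarrow> h n New"
    and h_new: "h (atm 0 0 1) (pairt (Par b) New)"
    and h_par_mem: "E b a \<Longrightarrow> h (atm 0 0 1) (pairt (Par b) (Par a))"
    and h_par_eq: "h (atm 1 0 1) (pairt (Par a) (Par b)) \<Longrightarrow> a = b"
    and h_pow: "\<exists>y. h (code pow_fm) (pairt (Par y) (Par a))"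
    and h_omit: "h (atm 0 0 1) (pairt t (Par a)) \<Longrightarrow> \<exists>b. E b a \<and> h (atm 1 0 1) (pairt t (Par b))"
begin

definition cls :: "'a trm \<Rightarrow> 'a trm set" where
  "cls t = {s. h (atm 1 0 1) (pairt t s)}"

lemma cls_eq_iff: "cls s = cls t \<longleftrightarrow> h (atm 1 0 1) (pairt s t)"
proof
  assume "cls s = cls t"
  then show "h (atm 1 0 1) (pairt s t)" using h_refl[of t] unfolding cls_def by blast
next
  assume st: "h (atm 1 0 1) (pairt s t)"
  then have ts: "h (atm 1 0 1) (pairt t s)" using h_euclid h_refl by blast
  show "cls s = cls t" unfolding cls_def using h_euclid[OF st] h_euclid[OF ts] by blast
qed

definition N :: "'a trm set lstruct" where
  "N = \<lparr>univ = range cls, mem = (\<lambda>X Y. \<exists>s t. X = cls s \<and> Y = cls t \<and> h (atm 0 0 1) (pairt s t))\<rparr>"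

lemma univ_N: "univ N = range cls" by (simp add: N_def)

lemma mem_N: "mem N (cls s) (cls t) \<longleftrightarrow> h (atm 0 0 1) (pairt s t)"
proof
  assume "mem N (cls s) (cls t)"
  then obtain s' t' where "cls s = cls s'" "cls t = cls t'" "h (atm 0 0 1) (pairt s' t')" unfolding N_def by auto
  then show "h (atm 0 0 1) (pairt s t)" using h_cong cls_eq_iff by metis
qed (auto simp: N_def)

text \<open>The environment term \<open>t\<close> has to represent \<open>e\<close> at free
  variables only. In the quantifier case every element of \<open>N\<close> is the class of some
  term, so \<open>h_all\<close> covers the whole universe.\<close>

lemma truth:
  "(\<And>i. i \<in> fv \<phi> \<Longrightarrow> \<exists>s. lkp i t s \<and> e i = cls s) \<Longrightarrow> sat N e \<phi> \<longleftrightarrow> h (code \<phi>) t"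
proof (induction \<phi> arbitrary: e t)
  case (Mem i j)
  have "i \<in> fv (Mem i j)" "j \<in> fv (Mem i j)" by simp_all
  from Mem.prems[OF this(1)] Mem.prems[OF this(2)]
  obtain r s where "lkp i t r" "e i = cls r" "lkp j t s" "e j = cls s" by blast
  then show ?case using h_mem[of i t r j s] by (simp add: mem_N)
next
  case (Eq i j)
  have "i \<in> fv (Eq i j)" "j \<in> fv (Eq i j)" by simp_all
  from Eq.prems[OF this(1)] Eq.prems[OF this(2)]
  obtain r s where "lkp i t r" "e i = cls r" "lkp j t s" "e j = cls s" by blast
  then show ?case using h_eq[of i t r j s] by (simp only: sat.simps code.simps cls_eq_iff)
next
  case Fls
  then show ?case using h_fls by simp
next
  case (Imp \<phi> \<psi>)
  have "sat N e \<phi> \<longleftrightarrow> h (code \<phi>) t" by (rule Imp.IH(1)) (simp add: Imp.prems)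
  moreover have "sat N e \<psi> \<longleftrightarrow> h (code \<psi>) t" by (rule Imp.IH(2)) (simp add: Imp.prems)
  ultimately show ?case by (simp add: h_imp)
next
  case (All \<phi>)
  have "sat N (case_nat (cls s) e) \<phi> \<longleftrightarrow> h (code \<phi>) (Ext s t)" for s
  proof (rule All.IH)
    fix i assume i: "i \<in> fv \<phi>"
    show "\<exists>s'. lkp i (Ext s t) s' \<and> case_nat (cls s) e i = cls s'"
    proof (cases i)
      case 0
      then show ?thesis using lkp_0 by fastforce
    next
      case (Suc k)
      then obtain s' where "lkp k t s'" "e k = cls s'" using All.prems[of k] i by auto
      then show ?thesis using Suc lkp_Suc by fastforce
    qed
  qed
  then show ?case by (simp add: h_all univ_N)
qed

text \<open>A sentence requires no lookups, so \<open>New\<close> may serve as its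
  environment.\<close>

lemma sat_sentence: "sentence \<sigma> \<Longrightarrow> code \<sigma> \<in> A \<Longrightarrow> sat N e \<sigma>"
  using truth[of \<sigma> New e] h_ax unfolding sentence_def by simp

lemma cls_Par_inj: "cls (Par a) = cls (Par b) \<longleftrightarrow> a = b"
  using cls_eq_iff h_par_eq by blast

lemma mem_Par: "mem N X (cls (Par a)) \<Longrightarrow> X \<in> univ N \<Longrightarrow> \<exists>b. E b a \<and> X = cls (Par b)"
  unfolding univ_N using mem_N h_omit cls_eq_iff by blast

text \<open>From left to right, \<open>h_omit\<close> yields an old element of \<open>a\<close>
  equal to \<open>b\<close>, and distinct parameters name distinct elements.\<close>

lemma mem_Par_Par: "mem N (cls (Par b)) (cls (Par a)) \<longleftrightarrow> E b a"
proof
  assume "mem N (cls (Par b)) (cls (Par a))"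
  then obtain c where "E c a" "cls (Par b) = cls (Par c)" using mem_Par univ_N by blast
  then show "E b a" by (simp add: cls_Par_inj)
qed (use mem_N h_par_mem in blast)

text \<open>By \<open>h_pow\<close> a subset of \<open>a\<close> in \<open>N\<close> is an element
  of some old \<open>y\<close>, and old elements acquire no new members.\<close>

lemma sub_Par:
  assumes X: "X \<in> univ N" "sub_in N X (cls (Par a))" shows "\<exists>b. X = cls (Par b)"
proof -
  obtain y where y: "h (code pow_fm) (pairt (Par y) (Par a))" using h_pow by blast
  obtain t where t: "X = cls t" using X(1) univ_N by blast
  define e where "e = case_nat (cls (Par y)) (\<lambda>_. cls (Par a))"
  have "sat N e pow_fm \<longleftrightarrow> h (code pow_fm) (pairt (Par y) (Par a))"
  proof (rule truth)
    fix i assume "i \<in> fv pow_fm"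
    then have "i = 0 \<or> i = 1" unfolding pow_fm_def by (auto simp: numeral_2_eq_2)
    moreover have "lkp 0 (pairt (Par y) (Par a)) (Par y)" "lkp 1 (pairt (Par y) (Par a)) (Par a)"
      using lkp_0 lkp_Suc[OF lkp_0] by simp_all
    ultimately show "\<exists>s. lkp i (pairt (Par y) (Par a)) s \<and> e i = cls s" unfolding e_def by auto
  qed
  then have "sat N e pow_fm" using y by simp
  then have "mem N X (cls (Par y))" using X unfolding pow_fm_def e_def sub_in_def
    by (simp add: numeral_2_eq_2)
  then show ?thesis using mem_Par X(1) by blast
qed

lemma mem_New: "mem N (cls (Par b)) (cls New)"
  using mem_N h_new by blast

end

section \<open>The extension\<close>

instance trm :: (countable) countable
  by countable_datatype

section \<open>Transport of structures and unwinding of the axioms\<close>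

lemma sat_iso:
  assumes "bij_betw g (univ K) (univ L)" "\<And>x y. x \<in> univ K \<Longrightarrow> y \<in> univ K \<Longrightarrow> mem K x y \<longleftrightarrow> mem L (g x) (g y)"
  shows "range e \<subseteq> univ K \<Longrightarrow> sat K e \<phi> \<longleftrightarrow> sat L (\<lambda>i. g (e i)) \<phi>"
proof (induction \<phi> arbitrary: e)
  case (Mem i j)
  then show ?case using assms(2)[of "e i" "e j"] by auto
next
  case (Eq i j)
  then have "e i \<in> univ K" "e j \<in> univ K" by auto
  then show ?case using assms(1) inj_on_eq_iff[of g "univ K" "e i" "e j"] by (simp add: bij_betw_def)
next
  case (All \<phi>)
  have "sat K (case_nat a e) \<phi> \<longleftrightarrow> sat L (case_nat (g a) (\<lambda>i. g (e i))) \<phi>" if "a \<in> univ K" for a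
  proof -
    have "range (case_nat a e) \<subseteq> univ K"
      using All.prems that by (simp add: image_subset_iff split: nat.split)
    moreover have "(\<lambda>i. g (case_nat a e i)) = case_nat (g a) (\<lambda>i. g (e i))" 
      by (rule ext) (simp split: nat.split)
    ultimately show ?thesis using All.IH[of "case_nat a e"] by simp
  qed
  moreover have "univ L = g ` univ K" using assms(1) by (simp add: bij_betw_def)
  ultimately show ?case by simp
qed auto

lemma case_nat_separation: "(\<lambda>i. case_nat x (case_nat y (case_nat w e)) (case_nat 0 (\<lambda>k. k + 3) i)) = case_nat x e"
  by (rule ext) (simp add: numeral_3_eq_3 split: nat.split)

lemma case_nat_collection1:
  "(\<lambda>i. case_nat y (case_nat x (case_nat w e)) (case_nat 0 (case_nat 1 (\<lambda>k. k + 3)) i)) = case_nat y (case_nat x e)"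
  by (rule ext) (simp add: numeral_3_eq_3 split: nat.split)

lemma case_nat_collection2:
  "(\<lambda>i. case_nat y (case_nat x (case_nat C (case_nat w e))) (case_nat 0 (case_nat 1 (\<lambda>k. k + 4)) i)) = case_nat y (case_nat x e)"
  by (rule ext) (simp add: eval_nat_numeral split: nat.split)

lemma case_nat_foundation: "(\<lambda>i. case_nat x (case_nat y e) (case_nat 0 (\<lambda>k. k + 2) i)) = case_nat x e"
  by (rule ext) (simp add: numeral_2_eq_2 split: nat.split)

lemma kp_powersetI:
  fixes E :: "'a \<Rightarrow> 'a \<Rightarrow> bool"
  assumes ax: "\<And>\<phi> e. \<phi> \<in> KP \<union> {powerset_ax} \<union> collection Delta0P \<union> foundation Sigma1P \<Longrightarrow>
     sat \<lparr>univ = UNIV, mem = E\<rparr> e \<phi>"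
  shows "kp_powerset E"
proof
  fix x y assume "\<And>z. E z x \<longleftrightarrow> E z y"
  then show "x = y" using ax[of extensionality_ax "\<lambda>_. undefined"]
    by (simp add: KP_def extensionality_ax_def numeral_2_eq_2; blast)
next
  show "\<exists>z. \<forall>w. E w z \<longleftrightarrow> w = x \<or> w = y" for x y
    using ax[of pair_ax "\<lambda>_. undefined"]
    by (simp add: KP_def pair_ax_def numeral_2_eq_2 numeral_3_eq_3; blast)
next
  fix x
  have "\<forall>x. \<exists>z. \<forall>w. (E w z \<longrightarrow> (\<exists>v. E v x \<and> E w v)) \<and> ((\<forall>v. E v x \<longrightarrow> \<not> E w v) \<or> E w z)"
    using ax[of union_ax "\<lambda>_. undefined"] by (simp add: KP_def union_ax_def numeral_2_eq_2 numeral_3_eq_3)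
  then obtain z where "\<forall>w. (E w z \<longrightarrow> (\<exists>v. E v x \<and> E w v)) \<and> ((\<forall>v. E v x \<longrightarrow> \<not> E w v) \<or> E w z)" by blast
  then show "\<exists>z. \<forall>w. E w z \<longleftrightarrow> (\<exists>v. E v x \<and> E w v)" by (intro exI[of _ z]) blast
next
  fix x
  have "\<forall>x. \<exists>z. \<forall>w. (E w z \<longrightarrow> (\<forall>v. E v w \<longrightarrow> E v x)) \<and> ((\<exists>v. E v w \<and> \<not> E v x) \<or> E w z)"
    using ax[of powerset_ax "\<lambda>_. undefined"] by (simp add: powerset_ax_def numeral_2_eq_2 numeral_3_eq_3)
  then obtain z where "\<forall>w. (E w z \<longrightarrow> (\<forall>v. E v w \<longrightarrow> E v x)) \<and> ((\<exists>v. E v w \<and> \<not> E v x) \<or> E w z)" by blast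
  then show "\<exists>z. \<forall>w. E w z \<longleftrightarrow> (\<forall>v. E v w \<longrightarrow> E v x)" by (intro exI[of _ z]) blast
next
  fix \<phi> w e assume "\<phi> \<in> Delta0"
  let ?\<psi> = "All (Ex (All (Iff (Mem 0 1) (And (Mem 0 2) (ren (case_nat 0 (\<lambda>k. k + 3)) \<phi>)))))"
  have "univ_closure ?\<psi> \<in> KP" unfolding KP_def separation_def using \<open>\<phi> \<in> Delta0\<close> by blast
  then have "\<forall>e. sat \<lparr>univ = UNIV, mem = E\<rparr> e ?\<psi>" using ax by (subst sat_univ_closure[symmetric]) blast
  from this[rule_format, of e]
  show "\<exists>y. \<forall>x. E x y \<longleftrightarrow> E x w \<and> sat \<lparr>univ = UNIV, mem = E\<rparr> (case_nat x e) \<phi>"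
    unfolding sat.simps sat_ren case_nat_separation by (simp add: numeral_2_eq_2; blast)
next
  fix \<phi> w e assume "\<phi> \<in> Delta0P"
    and *: "\<And>x. E x w \<Longrightarrow> \<exists>y. sat \<lparr>univ = UNIV, mem = E\<rparr> (case_nat y (case_nat x e)) \<phi>"
  let ?\<psi> = "All (Imp
        (All_in 0 (Ex (ren (case_nat 0 (case_nat 1 (\<lambda>k. k + 3))) \<phi>)))
        (Ex (All_in 1 (Ex_in 1 (ren (case_nat 0 (case_nat 1 (\<lambda>k. k + 4))) \<phi>)))))"
  have "univ_closure ?\<psi> \<in> collection Delta0P" unfolding collection_def using \<open>\<phi> \<in> Delta0P\<close> by blast
  then have "\<forall>e. sat \<lparr>univ = UNIV, mem = E\<rparr> e ?\<psi>" using ax by (subst sat_univ_closure[symmetric]) blast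
  from this[rule_format, of e] *
  show "\<exists>C. \<forall>x. E x w \<longrightarrow> (\<exists>y. E y C \<and> sat \<lparr>univ = UNIV, mem = E\<rparr> (case_nat y (case_nat x e)) \<phi>)"
    unfolding sat.simps sat_ren case_nat_collection1 case_nat_collection2 by simp
next
  fix \<phi> x e assume "\<phi> \<in> Sigma1P" and *: "sat \<lparr>univ = UNIV, mem = E\<rparr> (case_nat x e) \<phi>"
  let ?\<psi> = "Imp (Ex \<phi>) (Ex (And \<phi> (All_in 0 (Neg (ren (case_nat 0 (\<lambda>k. k + 2)) \<phi>)))))"
  have "univ_closure ?\<psi> \<in> foundation Sigma1P" unfolding foundation_def using \<open>\<phi> \<in> Sigma1P\<close> by blast
  then have "\<forall>e. sat \<lparr>univ = UNIV, mem = E\<rparr> e ?\<psi>" using ax by (subst sat_univ_closure[symmetric]) blast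
  from this[rule_format, of e] *
  show "\<exists>y. sat \<lparr>univ = UNIV, mem = E\<rparr> (case_nat y e) \<phi> \<and> (\<forall>x. E x y \<longrightarrow> \<not> sat \<lparr>univ = UNIV, mem = E\<rparr> (case_nat x e) \<phi>)"
    unfolding sat.simps sat_ren case_nat_foundation by (simp; blast)
qed

text \<open>The singleton map is injective, so on a finite universe it would be onto; but the empty
  set is not a singleton. Infinity is what allows a countable model to be transported onto all of
  \<open>nat\<close>.\<close>

lemma KP_infinite:
  assumes "is_struct M" and ax: "\<And>\<phi> e. \<phi> \<in> KP \<Longrightarrow> range e \<subseteq> univ M \<Longrightarrow> sat M e \<phi>"
  shows "infinite (univ M)"
proof
  assume fin: "finite (univ M)"
  obtain c where c: "c \<in> univ M" using assms(1) unfolding is_struct_def by blast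
  have "sat M (\<lambda>_. c) pair_ax" using ax[of pair_ax "\<lambda>_. c"] c by (auto simp: KP_def)
  then have "\<exists>z\<in>univ M. \<forall>w\<in>univ M. mem M w z \<longleftrightarrow> w = x" if "x \<in> univ M" for x
    unfolding pair_ax_def using that by (simp add: numeral_2_eq_2 numeral_3_eq_3; blast)
  then obtain sg where sg: "\<And>x. x \<in> univ M \<Longrightarrow> sg x \<in> univ M"
    "\<And>x w. x \<in> univ M \<Longrightarrow> w \<in> univ M \<Longrightarrow> mem M w (sg x) \<longleftrightarrow> w = x" by metis
  have "inj_on sg (univ M)" by (rule inj_onI) (metis sg(2))
  then have surj: "sg ` univ M = univ M" using fin sg(1) by (simp add: endo_inj_surj image_subset_iff)
  let ?\<psi> = "All (Ex (All (Iff (Mem 0 1) (And (Mem 0 2) (ren (case_nat 0 (\<lambda>k. k + 3)) Fls)))))"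
  have "univ_closure ?\<psi> \<in> KP" unfolding KP_def separation_def using Delta0.intros(3) by blast
  moreover have "univ_closure ?\<psi> = ?\<psi>"
  proof -
    have "fv ?\<psi> = {}" by (auto simp: numeral_2_eq_2)
    then show ?thesis unfolding univ_closure_def by simp
  qed
  ultimately have "sat M (\<lambda>_. c) ?\<psi>" using ax[of ?\<psi> "\<lambda>_. c"] c by auto
  then obtain z where "z \<in> univ M" "\<And>w. w \<in> univ M \<Longrightarrow> \<not> mem M w z" using c by auto
  then show False using surj sg(2) by (metis imageE)
qed

context kp_powerset begin

lemma term_modelI:
  assumes H: "\<And>u C. clause A u C \<Longrightarrow> \<exists>n t. E (pos n t) C \<and> h n t \<or> E (neg n t) C \<and> \<not> h n t"
  shows "term_model E A h"
proof -
  define hv where "hv l \<longleftrightarrow> (\<exists>n t. l = pos n t \<and> h n t \<or> l = neg n t \<and> \<not> h n t)" for l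
  have hv: "hv (pos n t) \<longleftrightarrow> h n t" "hv (neg n t) \<longleftrightarrow> \<not> h n t" for n t
    unfolding hv_def by auto
  have H: "\<exists>l. E l C \<and> hv l" if "clause A u C" for u C
    using H[OF that] unfolding hv_def by blast
  have H1: "hv x" if "clause A u (cl1 x)" for u x
    using H[OF that] by auto
  have H2: "hv x \<or> hv y" if "clause A u (cl2 x y)" for u x y
    using H[OF that] by auto
  have H3: "hv x \<or> hv y \<or> hv z" if "clause A u (cl3 x y z)" for u x y z
    using H[OF that] by auto
  have H4: "hv x \<or> hv y \<or> hv z \<or> hv w" if "clause A u (cl4 x y z w)" for u x y z w
    using H[OF that] by auto
  have atom: "h (atm k i j) t \<longleftrightarrow> h (atm k 0 1) (pairt r s)" 
    if "k = 0 \<or> k = 1" "lkp i t r" "lkp j t s" for k i j t r s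
  proof -
    have "clause A emp (cl2 (neg (atm k i j) t) (pos (atm k 0 1) (pairt r s)))"
      "clause A emp (cl2 (pos (atm k i j) t) (neg (atm k 0 1) (pairt r s)))"
      unfolding clause_def cl_atom_def using that by blast+
    from H2[OF this(1)] H2[OF this(2)] show ?thesis unfolding hv by blast
  qed
  show ?thesis
  proof
    fix t
    have "clause A emp (cl1 (neg (prod_encode (2, 0)) t))"
      unfolding clause_def cl_fls_def by blast
    from H1[OF this] show "\<not> h (prod_encode (2, 0)) t" unfolding hv .
  next
    fix p q t
    have "clause A emp (cl3 (neg (atm 3 p q) t) (neg p t) (pos q t))"
      "clause A emp (cl2 (pos (atm 3 p q) t) (pos p t))" "clause A emp (cl2 (pos (atm 3 p q) t) (neg q t))"
      unfolding clause_def cl_imp_def by blast+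
    from H3[OF this(1)] H2[OF this(2)] H2[OF this(3)]
    show "h (atm 3 p q) t \<longleftrightarrow> (h p t \<longrightarrow> h q t)" unfolding hv by blast
  next
    fix p t
    have "clause A emp (cl2 (neg (prod_encode (4, p)) t) (pos p (Ext s t)))" for s
      unfolding clause_def cl_all_def by blast
    from H2[OF this] have 1: "h (prod_encode (4, p)) t \<Longrightarrow> h p (Ext s t)" for s unfolding hv by blast
    have "clause A emp (cl2 (pos (prod_encode (4, p)) t) (neg p (Ext (Wit p t) t)))"
      unfolding clause_def cl_all_def by blast
    from H2[OF this] 1 show "h (prod_encode (4, p)) t \<longleftrightarrow> (\<forall>s. h p (Ext s t))" unfolding hv by blast
  next
    show "h (atm 0 i j) t \<longleftrightarrow> h (atm 0 0 1) (pairt r s)" if "lkp i t r" "lkp j t s" for i j t r s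
      using atom[OF _ that] by blast
  next
    show "h (atm 1 i j) t \<longleftrightarrow> h (atm 1 0 1) (pairt r s)" if "lkp i t r" "lkp j t s" for i j t r s
      using atom[OF _ that] by blast
  next
    fix t
    have "clause A emp (cl1 (pos (atm 1 0 1) (pairt t t)))"
      unfolding clause_def cl_eq_def by blast
    from H1[OF this] show "h (atm 1 0 1) (pairt t t)" unfolding hv .
  next
    fix s t r
    have "clause A emp (cl3 (neg (atm 1 0 1) (pairt s t)) (neg (atm 1 0 1) (pairt s r)) (pos (atm 1 0 1) (pairt t r)))"
      unfolding clause_def cl_eq_def by blast
    from H3[OF this] show "h (atm 1 0 1) (pairt s t) \<Longrightarrow> h (atm 1 0 1) (pairt s r) \<Longrightarrow> h (atm 1 0 1) (pairt t r)"
      unfolding hv by blast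
  next
    fix r s t v
    have "clause A emp (cl4 (neg (atm 1 0 1) (pairt r s)) (neg (atm 1 0 1) (pairt t v)) (neg (atm 0 0 1) (pairt r t)) (pos (atm 0 0 1) (pairt s v)))"
      unfolding clause_def cl_eq_def by blast
    from H4[OF this] 
    show "h (atm 1 0 1) (pairt r s) \<Longrightarrow> h (atm 1 0 1) (pairt t v) \<Longrightarrow> h (atm 0 0 1) (pairt r t) \<Longrightarrow> h (atm 0 0 1) (pairt s v)"
      unfolding hv by blast
  next
    fix n assume "n \<in> A"
    then have "clause A emp (cl1 (pos n New))" unfolding clause_def cl_ax_def by blast
    from H1[OF this] show "h n New" unfolding hv .
  next
    fix b
    \<comment> \<open>The valuation satisfies the clauses for every bound, so the singleton of
      \<open>b\<close> may be taken as \<open>u\<close>.\<close>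
    have "E b (cl1 b)" by simp
    then have "clause A (cl1 b) (cl1 (pos (atm 0 0 1) (pairt (Par b) New)))" unfolding clause_def cl_par_def by blast
    from H1[OF this] show "h (atm 0 0 1) (pairt (Par b) New)" unfolding hv .
  next
    fix a b assume "E b a"
    then have "clause A emp (cl1 (pos (atm 0 0 1) (pairt (Par b) (Par a))))" unfolding clause_def cl_par_def by blast
    from H1[OF this] show "h (atm 0 0 1) (pairt (Par b) (Par a))" unfolding hv .
  next
    fix a b assume *: "h (atm 1 0 1) (pairt (Par a) (Par b))"
    show "a = b"
    proof (rule ccontr)
      assume "a \<noteq> b"
      then have "clause A emp (cl1 (neg (atm 1 0 1) (pairt (Par a) (Par b))))" unfolding clause_def cl_par_def by blast
      from H1[OF this] * show False unfolding hv by blast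
    qed
  next
    fix a
    have "clause A emp (cl1 (pos (code pow_fm) (pairt (Par (pw a)) (Par a))))" unfolding clause_def cl_par_def by blast
    from H1[OF this] show "\<exists>y. h (code pow_fm) (pairt (Par y) (Par a))" unfolding hv by blast
  next
    fix t a assume *: "h (atm 0 0 1) (pairt t (Par a))"
    define L where "L b = pos (atm 1 0 1) (pairt t (Par b))" for b
    \<comment> \<open>The valuation only satisfies clauses that are elements of the structure;
      collection shows that the omission clause for \<open>t\<close> and \<open>a\<close> is
      one.\<close>
    have "SP (\<lambda>e. e 1 = lt 1 (num (atm 1 0 1)) (pr (num 3) (pr (tc t) (pr (num 3) (pr (pr (num 0) (e 0)) (tc New))))))"
      by (rule tmd_graph[where s = "\<lambda>e. lt 1 (num (atm 1 0 1)) (pr (num 3) (pr (tc t) (pr (num 3) (pr (pr (num 0) (e 0)) (tc New)))))" and f = "\<lambda>e. e"])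
         (intro tmd_pr tmd_const tmd_var tm_var)+
    then have "SP (\<lambda>e. e 1 = L (e 0))" unfolding L_def tc.simps(1,4) .
    from SP_collection[of "\<lambda>b p. p = L b", OF this, of a]
    obtain W where W: "\<forall>b. E b a \<longrightarrow> (\<exists>p. E p W \<and> p = L b)" "\<forall>p. E p W \<longrightarrow> (\<exists>b. E b a \<and> p = L b)" by blast
    let ?l = "neg (atm 0 0 1) (pairt t (Par a))"
    have "\<forall>x. E x (ins ?l W) \<longleftrightarrow> x = ?l \<or> (\<exists>b. E b a \<and> x = L b)"
      using W unfolding E_ins by blast
    then have "clause A emp (ins ?l W)" unfolding clause_def cl_omit_def L_def by blast
    from H[OF this] obtain l where l: "E l (ins ?l W)" "hv l" by blast
    have "l \<noteq> ?l" using l(2) * hv by blast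
    then obtain b where "E b a" "l = L b" using l(1) W(2) unfolding E_ins by blast
    then show "\<exists>b. E b a \<and> h (atm 1 0 1) (pairt t (Par b))" using l(2) hv unfolding L_def by blast
  qed
qed

end

theorem theorem5p3:
  fixes S :: "fm set" and M :: "'a lstruct"
  assumes "re_theory S"
    and "derives_theory S
           (KP \<union> {powerset_ax} \<union> collection Delta0P \<union> foundation Sigma1P)"
    and "is_model M S"
    and "countable (univ M)"
  shows "\<exists>N :: ('a + nat) lstruct.
           powerset_end_ext (inl_copy M) N \<and> is_model N S \<and>
           (\<exists>d\<in>univ N. \<forall>x\<in>univ (inl_copy M :: ('a + nat) lstruct). mem N x d)"
proof -
  let ?T = "KP \<union> {powerset_ax} \<union> collection Delta0P \<union> foundation Sigma1P"
  have struct: "is_struct M" using assms(3) unfolding is_model_def by blast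
  have sound: "sat M e \<phi>" if "\<phi> \<in> S \<or> \<phi> \<in> ?T" "range e \<subseteq> univ M" for \<phi> e
  proof -
    have S: "\<forall>\<psi>\<in>S. sat M e \<psi>" using assms(3) that(2) unfolding is_model_def by blast
    have "S \<turnstile> \<phi>" using that(1) assms(2) unfolding derives_theory_def by (blast intro: derives.Hyp)
    from derives_sound[OF this that(2) S] show ?thesis .
  qed
  have inf: "infinite (univ M)" by (rule KP_infinite[OF struct sound]) auto
  obtain f where f: "bij_betw f (UNIV :: nat set) (univ M)"
    using bij_betw_from_nat_into[OF assms(4) inf] by (rule that)
  \<comment> \<open>From here on the argument works with a copy of \<open>M\<close> whose universe
    is the type \<open>nat\<close>.\<close>
  define E where "E i j \<longleftrightarrow> mem M (f i) (f j)" for i j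
  let ?S = "\<lparr>univ = UNIV, mem = E\<rparr>"
  have f_univ: "f i \<in> univ M" for i using f unfolding bij_betw_def by blast
  have sound': "sat ?S e \<phi>" if "\<phi> \<in> S \<or> \<phi> \<in> ?T" for \<phi> e
  proof -
    have "sat ?S e \<phi> \<longleftrightarrow> sat M (\<lambda>i. f (e i)) \<phi>"
      by (rule sat_iso) (use f in \<open>auto simp: E_def\<close>)
    moreover have "range (\<lambda>i. f (e i)) \<subseteq> univ M" using f_univ by (simp add: image_subset_iff)
    ultimately show ?thesis using sound[OF that] by simp
  qed
  interpret kp_powerset E by (rule kp_powersetI) (use sound' in blast)
  have re: "re_set (code ` S)" and sentences: "\<And>\<sigma>. \<sigma> \<in> S \<Longrightarrow> sentence \<sigma>"
    using assms(1) unfolding re_theory_def by blast+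
  have dec: "sat ?S e (dec n)" if "n \<in> code ` S" for n e
    using that sound' by auto
  obtain h where "\<forall>u C. clause (code ` S) u C \<longrightarrow> (\<exists>n t. E (pos n t) C \<and> h n t \<or> E (neg n t) C \<and> \<not> h n t)"
    using valuation_exists[OF _ re dec] by auto
  then interpret tm: term_model E "code ` S" h by (intro term_modelI) blast
  let ?K = "tm.N"
  define P where "P b = tm.cls (Par b)" for b
  \<comment> \<open>The old elements return to their places in \<open>M\<close>. The new ones are
    numbered, which is possible since there are only countably many terms over
    \<open>nat\<close>.\<close>
  define g :: "nat trm set \<Rightarrow> 'a + nat" where
    "g X = (if X \<in> range P then Inl (f (inv P X)) else Inr (to_nat_on (univ ?K) X))" for X
  have injP: "inj P" unfolding P_def inj_def tm.cls_Par_inj by blast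
  have gP: "g (P b) = Inl (f b)" for b using injP unfolding g_def by simp
  have PK: "P b \<in> univ ?K" for b unfolding P_def tm.univ_N by blast
  have "countable (univ ?K)" unfolding tm.univ_N by simp
  have inj: "inj_on g (univ ?K)"
  proof (rule inj_onI)
    fix X Y assume XY: "X \<in> univ ?K" "Y \<in> univ ?K" "g X = g Y"
    show "X = Y"
    proof (cases "X \<in> range P")
      case True
      then obtain a where "X = P a" by blast
      then have "Y \<in> range P" using XY(3) gP unfolding g_def by (auto split: if_splits)
      then obtain b where "Y = P b" by blast
      then have "f a = f b" using \<open>X = P a\<close> XY(3) gP by simp
      then show ?thesis using f \<open>X = P a\<close> \<open>Y = P b\<close> by (simp add: bij_betw_def inj_eq)
    next
      case False
      then have "Y \<notin> range P" using XY(3) unfolding g_def by (auto split: if_splits)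
      then have "to_nat_on (univ ?K) X = to_nat_on (univ ?K) Y" using False XY(3) unfolding g_def by simp
      then show ?thesis using XY(1,2) \<open>countable (univ ?K)\<close> by simp
    qed
  qed
  define N :: "('a + nat) lstruct" where
    "N = \<lparr>univ = g ` univ ?K, mem = (\<lambda>x y. \<exists>X\<in>univ ?K. \<exists>Y\<in>univ ?K. x = g X \<and> y = g Y \<and> mem ?K X Y)\<rparr>"
  have univ_N: "univ N = g ` univ ?K" by (simp add: N_def)
  have mem_N: "mem N (g X) (g Y) \<longleftrightarrow> mem ?K X Y" if "X \<in> univ ?K" "Y \<in> univ ?K" for X Y
    using that inj by (auto simp: N_def inj_on_eq_iff)
  have iso: "bij_betw g (univ ?K) (univ N)" using inj univ_N by (simp add: bij_betw_def)
  have model: "is_model N S" unfolding is_model_def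
  proof (intro conjI ballI allI impI)
    show "is_struct N" using PK unfolding is_struct_def univ_N by blast
    fix \<sigma> and e :: "nat \<Rightarrow> 'a + nat" assume \<sigma>: "\<sigma> \<in> S" and e: "range e \<subseteq> univ N"
    define e' where "e' i = inv_into (univ ?K) g (e i)" for i
    have "e i \<in> g ` univ ?K" for i using e unfolding univ_N by blast
    then have e': "e' i \<in> univ ?K" "g (e' i) = e i" for i
      unfolding e'_def by (rule inv_into_into, rule f_inv_into_f)
    have "sat ?K e' \<sigma>" by (rule tm.sat_sentence[OF sentences[OF \<sigma>]]) (use \<sigma> in blast)
    moreover have "sat ?K e' \<sigma> \<longleftrightarrow> sat N (\<lambda>i. g (e' i)) \<sigma>"
      by (rule sat_iso[OF iso]) (use mem_N e'(1) in auto)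
    ultimately show "sat N e \<sigma>" by (simp add: e'(2))
  qed
  have Inl_P: "x \<in> univ (inl_copy M :: ('a + nat) lstruct) \<longleftrightarrow> (\<exists>b. x = g (P b))" for x
    using f unfolding inl_copy_def gP bij_betw_def by auto
  have mem_copy: "mem (inl_copy M :: ('a + nat) lstruct) (g (P b)) (g (P a)) \<longleftrightarrow> E b a" for a b
    unfolding inl_copy_def gP E_def by simp
  have "powerset_end_ext (inl_copy M) N"
    unfolding powerset_end_ext_def end_ext_def substructure_def
  proof (intro conjI ballI impI)
    show "is_struct (inl_copy M :: ('a + nat) lstruct)" using Inl_P unfolding is_struct_def by blast
    show "is_struct N" using model unfolding is_model_def by blast
    show "univ (inl_copy M) \<subseteq> univ N" using Inl_P PK univ_N by blast
  next
    fix x y :: "'a + nat" assume "x \<in> univ (inl_copy M)" "y \<in> univ (inl_copy M)"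
    then obtain a b where "x = g (P b)" "y = g (P a)" using Inl_P by blast
    then show "mem (inl_copy M) x y \<longleftrightarrow> mem N x y"
      using mem_copy mem_N[OF PK PK] tm.mem_Par_Par unfolding P_def by simp
  next
    fix y x :: "'a + nat" assume "y \<in> univ (inl_copy M)" "x \<in> univ N" "mem N x y"
    then obtain a X where "y = g (P a)" "x = g X" "X \<in> univ ?K" "mem ?K X (P a)"
      using Inl_P univ_N mem_N PK by auto
    then show "x \<in> univ (inl_copy M)" using tm.mem_Par[of X a] Inl_P unfolding P_def by blast
  next
    fix y x :: "'a + nat" assume "y \<in> univ (inl_copy M)" "x \<in> univ N" and sub: "sub_in N x y"
    then obtain a X where *: "y = g (P a)" "x = g X" "X \<in> univ ?K" using Inl_P univ_N by auto
    have "sub_in ?K X (P a)" unfolding sub_in_def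
    proof (intro ballI impI)
      fix Z assume Z: "Z \<in> univ ?K" "mem ?K Z X"
      then have "mem N (g Z) x" "g Z \<in> univ N" using mem_N[OF Z(1) *(3)] * univ_N by simp_all
      then have "mem N (g Z) (g (P a))" using sub * unfolding sub_in_def by blast
      then show "mem ?K Z (P a)" using mem_N[OF Z(1) PK] by simp
    qed
    then show "x \<in> univ (inl_copy M)" using tm.sub_Par[OF *(3), of a] *(2) Inl_P unfolding P_def by blast
  qed
  moreover have "\<exists>d\<in>univ N. \<forall>x\<in>univ (inl_copy M :: ('a + nat) lstruct). mem N x d"
  proof
    have New: "tm.cls New \<in> univ ?K" unfolding tm.univ_N by blast
    then show "g (tm.cls New) \<in> univ N" unfolding univ_N by blast
    show "\<forall>x\<in>univ (inl_copy M :: ('a + nat) lstruct). mem N x (g (tm.cls New))"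
      using Inl_P mem_N[OF PK New] tm.mem_New unfolding P_def by auto
  qed
  ultimately show ?thesis using model by blast
qed

end
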